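(* Let $m\ge1$ be an integer and let $\tilde B,\tilde H\in\Omega_{2n}$ with $\tilde H$ invertible and Hermitian and $\tilde B$ $\tilde H$-selfadjoint. Then there exists an $\tilde H$-selfadjoint $\tilde A\in\Omega_{2n}$ with $\tilde A^m=\tilde B$ if and only if the canonical form of $(\tilde B,\tilde H)$ (up to permutation of blocks) has the following two properties: 1. If $m$ is even, the part $(\tilde B_-,\tilde H_-)$ of the canonical form corresponding to the negative eigenvalues has the form $$\tilde B_-=\bigoplus_{j=1}^t\big(J_{k_j}(\lambda_j)\oplus J_{k_j}(\lambda_j)\big)\oplus\bigoplus_{j=1}^t\big(J_{k_j}(\lambda_j)\oplus J_{k_j}(\lambda_j)\big),\quad \tilde H_-=\bigoplus_{j=1}^t\big(Q_{k_j}\oplus -Q_{k_j}\big)\oplus\bigoplus_{j=1}^t\big(Q_{k_j}\oplus -Q_{k_j}\big)$$ for some $t\ge0$, $k_j\ge1$ and $\lambda_j<0$. (If $m$ is odd, no condition is imposed on the negative eigenvalues.) 2. The part $(\tilde B_0,\tilde H_0)$ of the canonical form corresponding to the eigenvalue $0$ has the form $\tilde B_0=J_B\oplus J_B$, $\tilde H_0=H_B\oplus H_B$ with $$J_B=\bigoplus_{j=1}^t\Big(\bigoplus_{i=1}^{r_j}J_{a_j+1}(0)\oplus\bigoplus_{i=r_j+1}^{m}J_{a_j}(0)\Big),\quad H_B=\bigoplus_{j=1}^t\Big(\bigoplus_{i=1}^{r_j}\varepsilon^{(j)}_iQ_{a_j+1}\oplus\bigoplus_{i=r_j+1}^{m}\varepsilon^{(j)}_iQ_{a_j}\Big),$$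 for some $t\ge0$, integers $a_j\ge0$, $0<r_j\le m$, and signs $\varepsilon_i^{(j)}\in\{1,-1\}$ satisfying: for each $j$ there is $\eta_j\in\{1,-1\}$ such that, among $\varepsilon^{(j)}_1,\dots,\varepsilon^{(j)}_{r_j}$, if $r_j$ is even then half equal $\eta_j$ and half equal $-\eta_j$, and if $r_j$ is odd then exactly one more equals $\eta_j$ than equals $-\eta_j$; and the same rule (with the same $\eta_j$) holds for $\varepsilon^{(j)}_{r_j+1},\dots,\varepsilon^{(j)}_m$ with $m-r_j$ in place of $r_j$. (No conditions are imposed on the parts corresponding to positive or nonreal eigenvalues.)
   Context: $\Omega_{2n}=\{\begin{bmatrix}A_1&\bar A_2\\-A_2&\bar A_1\end{bmatrix}: A_1,A_2\in\mathbb{C}^{n\times n}\}\subset\mathbb{C}^{2n\times 2n}$ (the image of $\mathbb{H}^{n\times n}$ under the standard complex representation). $J_k(\lambda)$: $k\times k$ upper triangular Jordan block; $J_0(0)$ and $Q_0$ are understood as empty (absent) blocks. $Q_k$: $k\times k$ matrix with ones on the anti-diagonal, zeros elsewhere. For invertible Hermitian $H$, $A$ is $H$-selfadjoint if $HA=A^*H$. Canonical form: for $\tilde H\in\Omega_{2n}$ invertible Hermitian and $\tilde B\in\Omega_{2n}$ $\tilde H$-selfadjoint, there is an invertible $S\in\Omega_{2n}$ with $S^{-1}\tilde BS=M\oplus M'$, $S^*\tilde HS=N\oplus N$, where $M=\bigoplus_{i=1}^{\alpha}J_{k_i}(\lambda_i)\oplus\bigoplus_{i=\alpha+1}^{\beta}(J_{k_i}(\lambda_i)\oplus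 J_{k_i}(\bar\lambda_i))$, $M'=\bigoplus_{i=1}^{\alpha}J_{k_i}(\lambda_i)\oplus\bigoplus_{i=\alpha+1}^{\beta}(J_{k_i}(\bar\lambda_i)\oplus J_{k_i}(\lambda_i))$, $N=\bigoplus_{i=1}^\alpha\eta_iQ_{k_i}\oplus\bigoplus_{i=\alpha+1}^\beta Q_{2k_i}$, with $\lambda_1,\dots,\lambda_\alpha$ real, $\lambda_{\alpha+1},\dots,\lambda_\beta$ with positive imaginary part, $\eta_i=\pm1$; it is unique up to permutation of blocks. The "part corresponding to" a set of eigenvalues consists of the blocks of $S^{-1}\tilde BS$ with those eigenvalues (in both copies) together with the corresponding blocks of $S^*\tilde HS$. *)

theory Defs
  imports "Jordan_Normal_Form.Jordan_Normal_Form" "Jordan_Normal_Form.Schur_Decomposition"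
    "HOL-Library.Multiset"
begin

definition conj_mat :: "complex mat \<Rightarrow> complex mat" where
  "conj_mat A = map_mat cnj A"

text \<open>Omega_{2n}: the complex representation of quaternion n x n matrices.\<close>
definition Omega :: "nat \<Rightarrow> complex mat set" where
  "Omega n = {four_block_mat A1 (conj_mat A2) (- A2) (conj_mat A1) | A1 A2.
               A1 \<in> carrier_mat n n \<and> A2 \<in> carrier_mat n n}"

definition hermitian_mat :: "complex mat \<Rightarrow> bool" where
  "hermitian_mat H \<longleftrightarrow> H \<in> carrier_mat (dim_row H) (dim_row H) \<and> mat_adjoint H = H"

definition H_selfadjoint :: "complex mat \<Rightarrow> complex mat \<Rightarrow> bool" where
  "H_selfadjoint H A \<longleftrightarrow> A \<in> carrier_mat (dim_row H) (dim_row H) \<and> H * A = mat_adjoint A * H"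

definition Qmat :: "nat \<Rightarrow> complex mat" where
  "Qmat k = mat k k (\<lambda>(i,j). if i + j = k - 1 then 1 else 0)"

definition dsum :: "complex mat \<Rightarrow> complex mat \<Rightarrow> complex mat" where
  "dsum A B = diag_block_mat [A, B]"

text \<open>Canonical-form data: a list of blocks (lambda, k, eta).  A block with real lambda
  stands for J_k(lambda) with sign eta; a block with Im lambda > 0 stands for the pair
  J_k(lambda) + J_k(conj lambda) (eta is then fixed to 1 and unused).  The order of the
  list is arbitrary, which accounts for "up to permutation of blocks".\<close>
definition canon_data :: "(complex \<times> nat \<times> int) list \<Rightarrow> bool" where
  "canon_data D \<longleftrightarrow> (\<forall>(l,k,e) \<in> set D. k \<ge> 1 \<and>
      ((Im l = 0 \<and> (e = 1 \<or> e = -1)) \<or> (Im l > 0 \<and> e = 1)))"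

definition canon_M :: "(complex \<times> nat \<times> int) list \<Rightarrow> complex mat" where
  "canon_M D = diag_block_mat (map (\<lambda>(l,k,e). if Im l = 0 then jordan_block k l
      else dsum (jordan_block k l) (jordan_block k (cnj l))) D)"

definition canon_M' :: "(complex \<times> nat \<times> int) list \<Rightarrow> complex mat" where
  "canon_M' D = diag_block_mat (map (\<lambda>(l,k,e). if Im l = 0 then jordan_block k l
      else dsum (jordan_block k (cnj l)) (jordan_block k l)) D)"

definition canon_N :: "(complex \<times> nat \<times> int) list \<Rightarrow> complex mat" where
  "canon_N D = diag_block_mat (map (\<lambda>(l,k,e). if Im l = 0 then of_int e \<cdot>\<^sub>m Qmat k
      else Qmat (2 * k)) D)"

definition is_canonical_form ::
  "nat \<Rightarrow> complex mat \<Rightarrow> complex mat \<Rightarrow> (complex \<times> nat \<times> int) list \<Rightarrow> complex mat \<Rightarrow> bool" where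
  "is_canonical_form n B H D S \<longleftrightarrow> canon_data D \<and> S \<in> Omega n \<and>
     (\<exists>Si. Si \<in> carrier_mat (2*n) (2*n) \<and> S * Si = 1\<^sub>m (2*n) \<and> Si * S = 1\<^sub>m (2*n) \<and>
        Si * B * S = dsum (canon_M D) (canon_M' D)) \<and>
     mat_adjoint S * H * S = dsum (canon_N D) (canon_N D)"

definition sign_balanced :: "int \<Rightarrow> int list \<Rightarrow> bool" where
  "sign_balanced eta es \<longleftrightarrow>
     int (count_list es eta) - int (count_list es (- eta)) = (if even (length es) then 0 else 1)"

definition neg_condition :: "(complex \<times> nat \<times> int) list \<Rightarrow> bool" where
  "neg_condition D \<longleftrightarrow> (\<exists>(t::nat) (lam::nat \<Rightarrow> real) (k::nat \<Rightarrow> nat).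
     (\<forall>j<t. lam j < 0 \<and> k j \<ge> 1) \<and>
     mset (filter (\<lambda>(l,_,_). Im l = 0 \<and> Re l < 0) D) =
       (\<Sum>j<t. {# (complex_of_real (lam j), k j, 1), (complex_of_real (lam j), k j, -1) #}))"

text \<open>Condition 2 (eigenvalue zero), on the blocks of D (one copy, i.e. J_B, H_B).
  Blocks J_0(0) are absent.\<close>
definition zero_condition :: "nat \<Rightarrow> (complex \<times> nat \<times> int) list \<Rightarrow> bool" where
  "zero_condition m D \<longleftrightarrow> (\<exists>(t::nat) (a::nat \<Rightarrow> nat) (r::nat \<Rightarrow> nat) (eps::nat \<Rightarrow> nat \<Rightarrow> int).
     (\<forall>j<t. 0 < r j \<and> r j \<le> m \<and> (\<forall>i<m. eps j i = 1 \<or> eps j i = -1) \<and>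
        (\<exists>eta. (eta = 1 \<or> eta = -1) \<and>
           sign_balanced eta (map (eps j) [0..<r j]) \<and>
           sign_balanced eta (map (eps j) [r j..<m]))) \<and>
     mset (filter (\<lambda>(l,_,_). l = 0) D) =
       (\<Sum>j<t. mset (map (\<lambda>i. (0, a j + 1, eps j i)) [0..<r j]) +
              mset (filter (\<lambda>(_,k,_). k \<noteq> 0) (map (\<lambda>i. (0, a j, eps j i)) [r j..<m]))))"

end

theory Submission
  imports Defs
    "Jordan_Normal_Form.Jordan_Normal_Form_Existence"
    "HOL-Computational_Algebra.Formal_Power_Series"
    "HOL-Combinatorics.Permutations"
begin

text \<open>
  Only the existence of the canonical form is needed, never its uniqueness. It is obtained by
  splitting off one block at a time from the \<open>H\<close>-orthogonal complement of the blocks found so far.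
  Let \<open>j\<close> be the antilinear map of square \<open>-1\<close> commuting with \<open>Omega n\<close>, and \<open>[x, y]\<close> the form
  given by \<open>H\<close>. On a chain at a real eigenvalue \<open>[x, j y]\<close> is both symmetric and skew, so the chain
  is orthogonal to its image under \<open>j\<close>; a chain at a nonreal eigenvalue is paired with one at the
  conjugate eigenvalue. Gram matrices of chains are Hankel, i.e. a flip times a Toeplitz
  matrix, and are normalised by inverses and square roots of power series.

  The canonical form of \<open>A ^ m\<close> is then computed block by block. A block at \<open>c \<noteq> 0\<close> stays a single
  block at \<open>c ^ m\<close>, except that a pair at \<open>c\<close> and its conjugate splits into two blocks of opposite
  sign when \<open>c ^ m\<close> is real. A nilpotent block splits along residue classes of the index modulo
  \<open>m\<close>; the flip exchanges residue classes, and two exchanged classes contribute opposite signs.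
  Read backwards, the same computations produce the roots.
\<close>

text \<open>The conditions are asked of some canonical form of \<open>B\<close>, so for their
  necessity it suffices to exhibit one; it is produced from the canonical form of the root
  \<open>A\<close> by taking powers of its blocks.

  The obstacle is that the basis change has to lie in \<open>Omega n\<close>, which a complex
  reduction of the pair does not provide. Hence vectors are chosen together with their images under
  j, and every new block must be orthogonal to its own j-image. Once such a frame exists, everything
  happens in one complex copy, because a complex T acts on the frame as the quaternionic matrix
  \<open>dsum T (conj_mat T)\<close>.

  The balance rule at zero comes from counting. In a nilpotent block of size a*m + r the residues
  below r have a + 1 representatives, the others a, and the flip reverses each of these two
  intervals of residues. An interval of odd length has a middle residue; it is fixed and keeps the
  sign of the block, which accounts for the one extra sign. Both intervals belong to the same block,
  hence the common eta. At a real eigenvalue c different from 0 the sign is multiplied by that of (m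
  c^(m-1))^(k-1).\<close>

no_notation vec_index (infixl \<open>$\<close> 100)
unbundle fps_syntax

section \<open>Matrix algebra without carriers\<close>

abbreviation sq_mats :: "nat \<Rightarrow> complex mat set" where
  "sq_mats k \<equiv> carrier_mat k k"

abbreviation adj :: "complex mat \<Rightarrow> complex mat" where
  "adj \<equiv> mat_adjoint"

lemma dim_mat_adjoint [simp]:
  "dim_row (adj A) = dim_col A" "dim_col (adj A) = dim_row A"
  by (auto simp: mat_adjoint_def)

lemma index_mat_adjoint [simp]:
  fixes A :: "complex mat"
  assumes "i < dim_col A" "j < dim_row A"
  shows "adj A $$ (i, j) = cnj (A $$ (j, i))"
  using assms by (simp add: mat_adjoint_def mat_of_rows_def)

lemma dim_conj_mat [simp]:
  "dim_row (conj_mat A) = dim_row A" "dim_col (conj_mat A) = dim_col A"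
  by (auto simp: conj_mat_def)

lemma index_conj_mat [simp]:
  assumes "i < dim_row A" "j < dim_col A"
  shows "conj_mat A $$ (i, j) = cnj (A $$ (i, j))"
  using assms by (simp add: conj_mat_def)

lemma index_mult_sum:
  fixes A B :: "'a :: comm_semiring_0 mat"
  assumes "i < dim_row A" "j < dim_col B" "dim_col A = dim_row B"
  shows "(A * B) $$ (i, j) = (\<Sum>l<dim_row B. A $$ (i, l) * B $$ (l, j))"
  using assms by (auto simp: scalar_prod_def atLeast0LessThan intro!: sum.cong)

declare index_mult_mat(1) [simp del]

lemma mult_mat_assoc:
  fixes A B C :: "'a :: semiring_0 mat"
  assumes "dim_col A = dim_row B" "dim_col B = dim_row C"
  shows "A * B * C = A * (B * C)"
  using assms by (intro assoc_mult_mat[of _ "dim_row A" "dim_row B" _ "dim_row C" _ "dim_col C"]) auto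

lemma mult_mat_add_right:
  fixes A B C :: "'a :: semiring_0 mat"
  assumes "dim_col A = dim_row B" "dim_row C = dim_row B" "dim_col C = dim_col B"
  shows "A * (B + C) = A * B + A * C"
  using assms by (intro mult_add_distrib_mat[of _ "dim_row A" "dim_row B" _ "dim_col C"]) auto

lemma mult_mat_add_left:
  fixes A B C :: "'a :: semiring_0 mat"
  assumes "dim_col A = dim_row C" "dim_row B = dim_row A" "dim_col B = dim_col A"
  shows "(A + B) * C = A * C + B * C"
  using assms by (intro add_mult_distrib_mat[of _ "dim_row A" "dim_row C" _ _ "dim_col C"]) auto

lemma mult_mat_diff_right:
  fixes A B C :: "'a :: ring mat"
  assumes "dim_col A = dim_row B" "dim_row C = dim_row B" "dim_col C = dim_col B"
  shows "A * (B - C) = A * B - A * C"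
  using assms by (intro mult_minus_distrib_mat[of _ "dim_row A" "dim_row B" _ "dim_col C"]) auto

lemma mult_mat_diff_left:
  fixes A B C :: "'a :: ring mat"
  assumes "dim_col A = dim_row C" "dim_row B = dim_row A" "dim_col B = dim_col A"
  shows "(A - B) * C = A * C - B * C"
  using assms by (intro minus_mult_distrib_mat[of _ "dim_row A" "dim_row C" _ _ "dim_col C"]) auto

lemma mult_mat_smult_left:
  fixes A B :: "'a :: comm_semiring_0 mat"
  assumes "dim_col A = dim_row B"
  shows "(c \<cdot>\<^sub>m A) * B = c \<cdot>\<^sub>m (A * B)"
  using assms by (intro mult_smult_assoc_mat[of _ "dim_row A" "dim_row B" _ "dim_col B"]) auto

lemma mult_mat_smult_right:
  fixes A B :: "'a :: comm_semiring_0 mat"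
  assumes "dim_col A = dim_row B"
  shows "A * (c \<cdot>\<^sub>m B) = c \<cdot>\<^sub>m (A * B)"
  using assms by (intro mult_smult_distrib[of _ "dim_row A" "dim_row B" _ "dim_col B"]) auto

lemma mult_mat_zero_left:
  fixes A :: "'a :: semiring_0 mat"
  assumes "dim_row A = n"
  shows "0\<^sub>m k n * A = 0\<^sub>m k (dim_col A)"
  using assms by (intro left_mult_zero_mat[of _ _ "dim_col A"]) auto

lemma mult_mat_zero_right:
  fixes A :: "'a :: semiring_0 mat"
  assumes "dim_col A = n"
  shows "A * 0\<^sub>m n k = 0\<^sub>m (dim_row A) k"
  using assms by (intro right_mult_zero_mat[of _ "dim_row A"]) auto

lemma mult_mat_one_left:
  fixes A :: "'a :: semiring_1 mat"
  assumes "dim_row A = n"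
  shows "1\<^sub>m n * A = A"
  using assms by (intro left_mult_one_mat[of _ _ "dim_col A"]) auto

lemma mult_mat_one_right:
  fixes A :: "'a :: semiring_1 mat"
  assumes "dim_col A = n"
  shows "A * 1\<^sub>m n = A"
  using assms by (intro right_mult_one_mat[of _ "dim_row A"]) auto

lemma add_mat_zero_right:
  fixes A :: "'a :: monoid_add mat"
  assumes "dim_row A = n" "dim_col A = k"
  shows "A + 0\<^sub>m n k = A"
  using assms by (intro eq_matI) auto

lemma add_mat_zero_left:
  fixes A :: "'a :: monoid_add mat"
  assumes "dim_row A = n" "dim_col A = k"
  shows "0\<^sub>m n k + A = A"
  using assms by (intro eq_matI) auto

lemmas mat_ring = add_mat_zero_right add_mat_zero_left mult_mat_assoc mult_mat_add_right mult_mat_add_left mult_mat_diff_right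
  mult_mat_diff_left mult_mat_smult_left mult_mat_smult_right mult_mat_zero_left
  mult_mat_zero_right mult_mat_one_left mult_mat_one_right

text \<open>\<open>mat_ring\<close> brackets products to the right, so a relation
  \<open>A * B = C * D\<close> no longer matches inside a longer product. This version carries the
  trailing factor \<open>E\<close> along; \<open>mat_rewrite1\<close> does the same for a right-hand
  side that is a single matrix.\<close>

lemma mat_rewrite:
  fixes A B C D E :: "'a :: semiring_0 mat"
  assumes "A * B = C * D" "dim_col A = dim_row B" "dim_col C = dim_row D"
    "dim_col D = dim_row E"
  shows "A * (B * E) = C * (D * E)"
proof -
  have "dim_col B = dim_col D" using assms(1) by (metis index_mult_mat(3))
  then show ?thesis using assms by (metis mult_mat_assoc)
qed

lemma mat_rewrite1:
  fixes A B C E :: "'a :: semiring_0 mat"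
  assumes "A * B = C" "dim_col A = dim_row B" "dim_col B = dim_row E"
  shows "A * (B * E) = C * E"
  using assms by (metis mult_mat_assoc)

lemma mat_adjoint_mult:
  fixes A B :: "complex mat"
  assumes "dim_col A = dim_row B"
  shows "adj (A * B) = adj B * adj A"
  using assms
  by (intro eq_matI) (auto simp: index_mult_sum mult.commute)

lemma mat_adjoint_adjoint [simp]: "adj (adj A) = (A :: complex mat)"
  by (intro eq_matI) auto

lemma mat_adjoint_add:
  fixes A B :: "complex mat"
  assumes "dim_row A = dim_row B" "dim_col A = dim_col B"
  shows "adj (A + B) = adj A + adj B"
  using assms by (intro eq_matI) auto

lemma mat_adjoint_diff:
  fixes A B :: "complex mat"
  assumes "dim_row A = dim_row B" "dim_col A = dim_col B"
  shows "adj (A - B) = adj A - adj B"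
  using assms by (intro eq_matI) auto

lemma mat_adjoint_smult: "adj (c \<cdot>\<^sub>m A) = cnj c \<cdot>\<^sub>m adj A"
  by (intro eq_matI) auto

lemma mat_adjoint_one [simp]: "adj (1\<^sub>m n :: complex mat) = 1\<^sub>m n"
  by (intro eq_matI) auto

lemma mat_adjoint_zero [simp]: "adj (0\<^sub>m n k :: complex mat) = 0\<^sub>m k n"
  by (intro eq_matI) auto

lemma conj_mat_mult:
  assumes "dim_col A = dim_row B"
  shows "conj_mat (A * B) = conj_mat A * conj_mat B"
  using assms by (intro eq_matI) (auto simp: index_mult_sum)

lemma conj_mat_conj_mat [simp]: "conj_mat (conj_mat A) = A"
  by (intro eq_matI) auto

lemma conj_mat_adjoint: "conj_mat (adj A) = adj (conj_mat A)"
  by (intro eq_matI) auto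

lemma conj_mat_add:
  assumes "dim_row A = dim_row B" "dim_col A = dim_col B"
  shows "conj_mat (A + B) = conj_mat A + conj_mat B"
  using assms by (intro eq_matI) auto

lemma conj_mat_diff:
  assumes "dim_row A = dim_row B" "dim_col A = dim_col B"
  shows "conj_mat (A - B) = conj_mat A - conj_mat B"
  using assms by (intro eq_matI) auto

lemma conj_mat_smult: "conj_mat (c \<cdot>\<^sub>m A) = cnj c \<cdot>\<^sub>m conj_mat A"
  by (intro eq_matI) auto

lemma conj_mat_one [simp]: "conj_mat (1\<^sub>m n) = 1\<^sub>m n"
  by (intro eq_matI) auto

lemma conj_mat_zero [simp]: "conj_mat (0\<^sub>m n k) = 0\<^sub>m n k"
  by (intro eq_matI) auto

section \<open>Column concatenation and the block form of Gram matrices\<close>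

definition hcat :: "'a mat \<Rightarrow> 'a mat \<Rightarrow> 'a mat" where
  "hcat X Y = mat (dim_row X) (dim_col X + dim_col Y)
     (\<lambda>(i, j). if j < dim_col X then X $$ (i, j) else Y $$ (i, j - dim_col X))"

lemma dim_hcat [simp]:
  "dim_row (hcat X Y) = dim_row X" "dim_col (hcat X Y) = dim_col X + dim_col Y"
  by (auto simp: hcat_def)

lemma index_hcat [simp]:
  assumes "i < dim_row X" "j < dim_col X + dim_col Y"
  shows "hcat X Y $$ (i, j) = (if j < dim_col X then X $$ (i, j) else Y $$ (i, j - dim_col X))"
  using assms by (simp add: hcat_def)

lemma mult_hcat:
  fixes X Y M :: "'a :: comm_semiring_0 mat"
  assumes "dim_col M = dim_row X" "dim_row Y = dim_row X"
  shows "M * hcat X Y = hcat (M * X) (M * Y)"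
  using assms by (intro eq_matI) (auto simp: index_mult_sum)

lemma sum_lessThan_add:
  fixes f :: "nat \<Rightarrow> 'a :: comm_monoid_add"
  shows "(\<Sum>l<a + b. f l) = (\<Sum>l<a. f l) + (\<Sum>l<b. f (a + l))"
  by (induction b) (auto simp: add.assoc)

lemma hcat_mult_four_block:
  fixes X Y :: "'a :: comm_semiring_0 mat"
  assumes "dim_row Y = dim_row X"
    "dim_row P = dim_col X" "dim_row Q = dim_col X" "dim_row R = dim_col Y" "dim_row S = dim_col Y"
    "dim_col R = dim_col P" "dim_col Q = dim_col S"
  shows "hcat X Y * four_block_mat P Q R S = hcat (X * P + Y * R) (X * Q + Y * S)"
  using assms
  by (intro eq_matI) (auto simp: index_mult_sum sum_lessThan_add)

lemma gram_hcat:
  fixes X Y X' Y' :: "complex mat"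
  assumes "dim_row Y = dim_row X" "dim_row X' = dim_row X" "dim_row Y' = dim_row X"
  shows "adj (hcat X Y) * hcat X' Y' =
    four_block_mat (adj X * X') (adj X * Y') (adj Y * X') (adj Y * Y')"
  using assms by (intro eq_matI) (auto simp: index_mult_sum)

lemma gram_form_hcat:
  fixes X Y U V H :: "complex mat"
  assumes "dim_row Y = dim_row X" "dim_row U = dim_col H" "dim_row V = dim_col H" "dim_row H = dim_row X"
  shows "adj (hcat X Y) * H * hcat U V = four_block_mat (adj X * H * U)
    (adj X * H * V) (adj Y * H * U) (adj Y * H * V)"
proof -
  have "adj (hcat X Y) * H * hcat U V = adj (hcat X Y) * hcat (H * U) (H * V)"
    using assms by (simp add: mult_mat_assoc mult_hcat[of H])
  then show ?thesis using assms by (simp add: gram_hcat mult_mat_assoc)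
qed

lemma conj_hcat:
  assumes "dim_row Y = dim_row X"
  shows "conj_mat (hcat X Y) = hcat (conj_mat X) (conj_mat Y)"
  using assms by (intro eq_matI) auto

lemma mult_mat_left_inverse:
  fixes A B :: "complex mat"
  assumes "A \<in> sq_mats n" "B \<in> sq_mats n" "A * B = 1\<^sub>m n"
  shows "B * A = 1\<^sub>m n"
  using mat_mult_left_right_inverse[OF assms] .

section \<open>Toeplitz matrices and intertwiners of Jordan blocks\<close>

abbreviation J :: "nat \<Rightarrow> complex \<Rightarrow> complex mat" where
  "J \<equiv> jordan_block"

text \<open>This is f evaluated at the nilpotent Jordan block, that is, multiplication by f modulo
  X^k. It transports inverses and radicals of power series to matrices; coefficients from degree k
  on are invisible.\<close>

definition toep :: "nat \<Rightarrow> complex fps \<Rightarrow> complex mat" where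
  "toep k f = mat k k (\<lambda>(i, j). if i \<le> j then f $ (j - i) else 0)"

lemma dim_toep [simp]: "dim_row (toep k f) = k" "dim_col (toep k f) = k"
  by (auto simp: toep_def)

lemma index_toep [simp]:
  "i < k \<Longrightarrow> j < k \<Longrightarrow> toep k f $$ (i, j) = (if i \<le> j then f $ (j - i) else 0)"
  by (simp add: toep_def)

lemma toep_mult: "toep k f * toep k g = toep k (f * g)"
proof (intro eq_matI)
  fix i j assume "i < dim_row (toep k (f * g))" "j < dim_col (toep k (f * g))"
  then have ij: "i < k" "j < k" by auto
  have "(toep k f * toep k g) $$ (i, j) =
      (\<Sum>l<k. if i \<le> l \<and> l \<le> j then f $ (l - i) * g $ (j - l) else 0)"
    using ij by (auto simp: index_mult_sum intro!: sum.cong)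
  also have "\<dots> = (\<Sum>l\<in>{l. i \<le> l \<and> l \<le> j}. f $ (l - i) * g $ (j - l))"
    using ij by (intro sum.mono_neutral_cong_right) auto
  also have "\<dots> = toep k (f * g) $$ (i, j)"
  proof (cases "i \<le> j")
    case True
    have "(\<Sum>l\<in>{l. i \<le> l \<and> l \<le> j}. f $ (l - i) * g $ (j - l)) =
        (\<Sum>q=0..j - i. f $ q * g $ (j - i - q))"
      by (rule sum.reindex_bij_witness[of _ "\<lambda>q. q + i" "\<lambda>l. l - i"]) (use True in auto)
    then show ?thesis using ij True by (simp add: fps_mult_nth)
  next
    case False
    then have "{l. i \<le> l \<and> l \<le> j} = {}" by auto
    then show ?thesis using ij False by simp
  qed
  finally show "(toep k f * toep k g) $$ (i, j) = toep k (f * g) $$ (i, j)" .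
qed auto

lemma toep_one [simp]: "toep k 1 = 1\<^sub>m k"
  by (intro eq_matI) auto

lemma toep_const: "toep k (fps_const c) = c \<cdot>\<^sub>m 1\<^sub>m k"
  by (intro eq_matI) auto

lemma toep_diff: "toep k (f - g) = toep k f - toep k g"
  by (intro eq_matI) auto

lemma toep_power: "toep k f ^\<^sub>m r = toep k (f ^ r)"
  by (induction r) (auto simp: toep_mult mult.commute)

lemma toep_cong: "(\<And>n. n < k \<Longrightarrow> f $ n = g $ n) \<Longrightarrow> toep k f = toep k g"
  by (intro eq_matI) auto

lemma jordan_block_toep: "J k l = toep k (fps_const l + fps_X)"
  by (intro eq_matI) auto

lemma jordan_block_commute_toep: "J k l * toep k f = toep k f * J k l"
  by (simp add: jordan_block_toep toep_mult mult.commute)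

definition fps_cnj :: "complex fps \<Rightarrow> complex fps" where
  "fps_cnj f = Abs_fps (\<lambda>n. cnj (f $ n))"

section \<open>The flip matrix, and intertwiners between Jordan blocks and their adjoints\<close>

lemma dim_Qmat [simp]: "dim_row (Qmat k) = k" "dim_col (Qmat k) = k"
  by (auto simp: Qmat_def)

lemma index_Qmat [simp]:
  "i < k \<Longrightarrow> j < k \<Longrightarrow> Qmat k $$ (i, j) = (if i + j = k - 1 then 1 else 0)"
  by (simp add: Qmat_def)

lemma index_Qmat_mult [simp]:
  assumes "i < k" "j < dim_col A" "dim_row A = k"
  shows "(Qmat k * A) $$ (i, j) = A $$ (k - 1 - i, j)"
proof -
  have "(Qmat k * A) $$ (i, j) = (\<Sum>l<dim_row A. Qmat k $$ (i, l) * A $$ (l, j))"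
    using assms by (intro index_mult_sum) auto
  also have "\<dots> = (\<Sum>l<k. if l = k - 1 - i then A $$ (l, j) else 0)"
    using assms by (intro sum.cong) auto
  finally show ?thesis using assms by simp
qed

lemma index_mult_Qmat [simp]:
  assumes "i < dim_row A" "j < k" "dim_col A = k"
  shows "(A * Qmat k) $$ (i, j) = A $$ (i, k - 1 - j)"
proof -
  have "(A * Qmat k) $$ (i, j) = (\<Sum>l<dim_row (Qmat k). A $$ (i, l) * Qmat k $$ (l, j))"
    using assms by (intro index_mult_sum) auto
  also have "\<dots> = (\<Sum>l<k. if l = k - 1 - j then A $$ (i, l) else 0)"
    using assms by (intro sum.cong) auto
  finally show ?thesis using assms by simp
qed

lemma Qmat_square: "Qmat k * Qmat k = 1\<^sub>m k"
  by (intro eq_matI) auto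

lemma adjoint_Qmat [simp]: "adj (Qmat k) = Qmat k"
  by (intro eq_matI) auto

lemma conj_Qmat [simp]: "conj_mat (Qmat k) = Qmat k"
  by (intro eq_matI) auto

lemma Qmat_cancel: "dim_row A = k \<Longrightarrow> Qmat k * (Qmat k * A) = A"
  by (simp add: mat_rewrite1[OF Qmat_square] mat_ring)

text \<open>Reflection in the antidiagonal leaves a Toeplitz matrix unchanged, so moving the adjoint
  past the flip only conjugates the coefficients.\<close>

lemma adjoint_toep_Qmat: "adj (toep k f) * Qmat k = Qmat k * toep k (fps_cnj f)"
  by (intro eq_matI) (auto simp: fps_cnj_def intro!: arg_cong[of _ _ "($) f"])

lemma adjoint_jordan_block_Qmat:
  "adj (J k l) * Qmat k = Qmat k * J k (cnj l)"
proof -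
  have "fps_cnj (fps_const l + fps_X) = fps_const (cnj l) + fps_X"
    by (intro fps_ext) (auto simp: fps_cnj_def)
  then show ?thesis by (simp add: jordan_block_toep adjoint_toep_Qmat)
qed

lemma Qmat_jordan_block:
  "Qmat k * J k l = adj (J k (cnj l)) * Qmat k"
  using adjoint_jordan_block_Qmat[of k "cnj l"] by simp

lemma index_jordan_block_mult:
  fixes X :: "complex mat"
  assumes "i < k" "j < dim_col X" "dim_row X = k"
  shows "(J k l * X) $$ (i, j) =
    l * X $$ (i, j) + (if Suc i < k then X $$ (Suc i, j) else 0)"
proof -
  have "(J k l * X) $$ (i, j) = (\<Sum>q<dim_row X. J k l $$ (i, q) * X $$ (q, j))"
    using assms by (intro index_mult_sum) auto
  also have "\<dots> = (\<Sum>q<k. (if q = i then l * X $$ (i, j) else 0) + (if q = Suc i then X $$ (Suc i, j) else 0))"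
    using assms by (intro sum.cong) auto
  finally show ?thesis using assms by (simp add: sum.distrib)
qed

lemma index_mult_jordan_block:
  fixes X :: "complex mat"
  assumes "i < dim_row X" "j < k" "dim_col X = k"
  shows "(X * J k l) $$ (i, j) =
    X $$ (i, j) * l + (if j > 0 then X $$ (i, j - 1) else 0)"
proof -
  have "(X * J k l) $$ (i, j) = (\<Sum>q<dim_row (J k l). X $$ (i, q) * J k l $$ (q, j))"
    using assms by (intro index_mult_sum) auto
  also have "\<dots> = (\<Sum>q<k. (if q = j then X $$ (i, j) * l else 0) + (if Suc q = j then X $$ (i, j - 1) else 0))"
    using assms by (intro sum.cong) auto
  also have "\<dots> = X $$ (i, j) * l + (\<Sum>q<k. if q = j - 1 \<and> 0 < j then X $$ (i, j - 1) else 0)"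
    using assms by (simp add: sum.distrib) (auto intro!: sum.cong)
  finally show ?thesis using assms by (cases j) simp_all
qed

text \<open>Comparing the two products at (i, j+1) makes \<open>X\<close> constant along diagonals,
  and comparing them in column 0 kills everything below the diagonal; f is read off the first
  row.\<close>

lemma commute_jordan_block_toep:
  assumes X: "X \<in> sq_mats k" and c: "X * J k l = J k l * X"
  shows "\<exists>f. X = toep k f"
proof
  have e: "(X * J k l) $$ (i, j) = (J k l * X) $$ (i, j)" for i j
    using c by simp
  have s1: "X $$ (Suc i, Suc j) = X $$ (i, j)" if "Suc i < k" "Suc j < k" for i j
    using e[of i "Suc j"] that X by (auto simp: index_jordan_block_mult index_mult_jordan_block
       )
  have s2: "X $$ (Suc i, 0) = 0" if "Suc i < k" for i
    using e[of i 0] that X by (auto simp: index_jordan_block_mult index_mult_jordan_block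
       )
  have s: "X $$ (i, j) = (if i \<le> j then X $$ (0, j - i) else 0)" if "i < k" "j < k" for i j
    using that
  proof (induction i arbitrary: j)
    case (Suc i)
    then show ?case by (cases j) (auto simp: s1 s2)
  qed simp
  show "X = toep k (Abs_fps (\<lambda>n. X $$ (0, n)))"
  proof (intro eq_matI)
    fix i j assume "i < dim_row (toep k (Abs_fps (\<lambda>n. X $$ (0, n))))"
      "j < dim_col (toep k (Abs_fps (\<lambda>n. X $$ (0, n))))"
    then have "i < k" "j < k" by auto
    then show "X $$ (i, j) = toep k (Abs_fps (\<lambda>n. X $$ (0, n))) $$ (i, j)"
      by (subst s) auto
  qed (use X in auto)
qed

text \<open>The flip turns \<open>adj (J k l)\<close> into \<open>J k (cnj l)\<close>, so
  \<open>Qmat k * K\<close> lies in the centraliser of a Jordan block. Thus \<open>K\<close> is a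
  Hankel matrix, and its entry (0, k-1) is the constant term of h.\<close>

lemma Qmat_intertwiner_toep:
  assumes K: "K \<in> sq_mats k"
    and c: "K * J k (cnj l) = adj (J k l) * K"
  obtains h where "K = Qmat k * toep k h"
proof -
  have "(Qmat k * K) * J k (cnj l) = Qmat k * (adj (J k l) * K)"
    using K by (simp add: mat_ring c)
  also have "adj (J k l) * K =
      adj (J k l) * (Qmat k * (Qmat k * K))"
    using K by (simp add: Qmat_cancel)
  also have "\<dots> = Qmat k * (J k (cnj l) * (Qmat k * K))"
    using K by (simp add: mat_rewrite[OF adjoint_jordan_block_Qmat])
  finally have "(Qmat k * K) * J k (cnj l) = J k (cnj l) * (Qmat k * K)"
    using K by (simp add: Qmat_cancel)
  moreover have "Qmat k * K \<in> sq_mats k" using K by (intro carrier_matI) auto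
  ultimately obtain h where "Qmat k * K = toep k h"
    using commute_jordan_block_toep by blast
  then have "Qmat k * toep k h = K" using K Qmat_cancel[of K k] by auto
  then show thesis using that[of h] by simp
qed

text \<open>A Sylvester argument: the entrywise equation expresses (b - cnj a) L(i, j) through
  entries with smaller i + j, so induction on i + j applies. For chains it means that non-conjugate
  eigenvalues are orthogonal.\<close>

lemma intertwiner_zero:
  assumes L: "L \<in> carrier_mat k k'"
    and c: "L * J k' b = adj (J k a) * L" and ne: "b \<noteq> cnj a"
  shows "L = 0\<^sub>m k k'"
proof -
  have adj: "(adj (J k a) * L) $$ (i, j) =
      cnj a * L $$ (i, j) + (if i > 0 then L $$ (i - 1, j) else 0)" if "i < k" "j < k'" for i j
  proof -
    have "(adj (J k a) * L) = adj (adj L * J k a)"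
      using L by (simp add: mat_adjoint_mult)
    then show ?thesis using that L
      by (simp add: index_mult_jordan_block)
  qed
  have "L $$ (i, j) = 0" if "i < k" "j < k'" for i j
    using that
  proof (induction "i + j" arbitrary: i j rule: less_induct)
    case less
    have "L $$ (i, j) * b + (if j > 0 then L $$ (i, j - 1) else 0) =
        cnj a * L $$ (i, j) + (if i > 0 then L $$ (i - 1, j) else 0)"
      using adj[OF less.prems] index_mult_jordan_block[of i L j k' b] less.prems L c by auto
    moreover have "(if j > 0 then L $$ (i, j - 1) else 0) = 0" using less by auto
    moreover have "(if i > 0 then L $$ (i - 1, j) else 0) = 0" using less by auto
    ultimately have "L $$ (i, j) * (b - cnj a) = 0" by (simp add: algebra_simps)
    then show ?case using ne by simp
  qed
  then show ?thesis using L by (intro eq_matI) auto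
qed

text \<open>The (i, j) entry of a flip times a Toeplitz matrix depends on i + j alone.\<close>

lemma intertwiner_symmetric:
  assumes K: "K \<in> sq_mats k"
    and c: "K * J k (cnj l) = adj (J k l) * K"
  shows "transpose_mat K = K"
proof -
  from Qmat_intertwiner_toep[OF K c] obtain h where h: "K = Qmat k * toep k h" .
  show ?thesis unfolding h
    by (intro eq_matI) (auto intro!: arg_cong[of _ _ "($) h"])
qed

text \<open>The corner entry is the constant term of the series behind \<open>K\<close>, so it
  decides invertibility. The correction acts on one side only: the two chains of a conjugate pair
  may be changed independently, and an inverse series is enough.\<close>

lemma intertwiner_normalise_pair:
  assumes K: "K \<in> sq_mats k" and k: "k > 0"
    and c: "K * J k (cnj l) = adj (J k l) * K"
    and nz: "K $$ (0, k - 1) \<noteq> 0"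
  shows "\<exists>W \<in> sq_mats k.
    J k (cnj l) * W = W * J k (cnj l) \<and> K * W = Qmat k"
proof -
  from Qmat_intertwiner_toep[OF K c] obtain h where h: "K = Qmat k * toep k h" .
  have "h $ 0 \<noteq> 0" using nz k unfolding h by simp
  then have "K * toep k (inverse h) = Qmat k"
    unfolding h by (simp add: mat_ring toep_mult inverse_mult_eq_1')
  then show ?thesis
    by (intro bexI[of _ "toep k (inverse h)"])
      (auto simp: jordan_block_commute_toep)
qed

definition fps_of_real :: "real fps \<Rightarrow> complex fps" where
  "fps_of_real f = Abs_fps (\<lambda>n. complex_of_real (f $ n))"

lemma fps_of_real_mult: "fps_of_real (f * g) = fps_of_real f * fps_of_real g"
  by (intro fps_ext) (simp add: fps_of_real_def fps_mult_nth)

text \<open>Here the same chain stands on both sides, so a square root of the inverse series is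
  needed. Hermitian symmetry makes the coefficients real, hence the sign of the constant term cannot
  be scaled away: it is the sign attached to the block.\<close>

lemma intertwiner_normalise_real:
  assumes K: "K \<in> sq_mats k" and k: "k > 0" and herm: "adj K = K"
    and c: "K * J k l = adj (J k l) * K" and l: "Im l = 0"
    and nz: "K $$ (0, k - 1) \<noteq> 0"
  shows "\<exists>W \<in> sq_mats k. J k l * W = W * J k l \<and>
    adj W * K * W = of_int (if Re (K $$ (0, k - 1)) > 0 then 1 else -1) \<cdot>\<^sub>m Qmat k"
proof -
  have cl: "cnj l = l" using l by (simp add: complex_eq_iff)
  have "K * J k (cnj l) = adj (J k l) * K" using c by (simp only: cl)
  from Qmat_intertwiner_toep[OF K this] obtain h where h: "K = Qmat k * toep k h" .
  have h0: "h $ 0 = K $$ (0, k - 1)" using k unfolding h by simp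
  have "Qmat k * toep k h = Qmat k * toep k (fps_cnj h)"
    using herm unfolding h by (simp add: mat_adjoint_mult adjoint_toep_Qmat)
  then have "Qmat k * (Qmat k * toep k h) = Qmat k * (Qmat k * toep k (fps_cnj h))" by simp
  then have tt: "toep k h = toep k (fps_cnj h)" by (simp add: Qmat_cancel)
  have real: "h $ n = cnj (h $ n)" if "n < k" for n
  proof -
    have "toep k h $$ (0, n) = toep k (fps_cnj h) $$ (0, n)" using tt by simp
    then show ?thesis using that by (simp add: fps_cnj_def)
  qed
  \<comment> \<open>Only the coefficients below k are known to be real. Taking real parts of all of
    them changes nothing modulo X^k and leads to real power series.\<close>
  define hr where "hr = Abs_fps (\<lambda>n. Re (h $ n))"
  have hhr: "toep k h = toep k (fps_of_real hr)"
  proof (rule toep_cong)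
    fix n assume "n < k"
    from real[OF this] show "h $ n = fps_of_real hr $ n"
      by (simp add: fps_of_real_def hr_def complex_eq_iff)
  qed
  have hr0: "hr $ 0 = Re (K $$ (0, k - 1))" by (simp add: hr_def h0)
  have hrne: "hr $ 0 \<noteq> 0"
    using real[of 0] k nz by (auto simp: hr0 h0 complex_eq_iff)
  define e :: real where "e = (if hr $ 0 > 0 then 1 else -1)"
  define g where "g = inverse (fps_const e * hr)"
  have g0: "g $ 0 > 0" using hrne by (auto simp: g_def e_def)
  \<comment> \<open>The factor \<open>e\<close> makes the constant term of g positive, so g has a
    real square root as a power series.\<close>
  define w where "w = fps_radical root 2 g"
  have w: "w ^ 2 = g"
  proof -
    have "root (Suc 1) (g $ 0) ^ Suc 1 = g $ 0" using g0 by (intro real_root_pow_pos2) auto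
    moreover have "g $ 0 \<noteq> 0" using g0 by simp
    ultimately show ?thesis
      using power_radical[of g root 1] unfolding w_def numeral_2_eq_2 One_nat_def by blast
  qed
  have "g * (fps_const e * hr) = 1" unfolding g_def
    using hrne by (intro inverse_mult_eq_1) (auto simp: e_def)
  then have "fps_const e * (g * hr) = 1" by (simp add: mult_ac)
  then have "fps_const e * (fps_const e * (g * hr)) = fps_const e" by simp
  moreover have "fps_const e * (fps_const e * (g * hr)) = g * hr"
    by (auto simp: e_def mult.assoc[symmetric])
  ultimately have ghr: "g * hr = fps_const e" by simp
  define W where "W = toep k (fps_of_real w)"
  have "fps_cnj (fps_of_real w) = fps_of_real w"
    by (intro fps_ext) (simp add: fps_cnj_def fps_of_real_def)
  then have "adj W * K * W = Qmat k * toep k (fps_of_real w * (fps_of_real hr * fps_of_real w))"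
    unfolding W_def h hhr
    by (simp add: mult_mat_assoc mat_rewrite[OF adjoint_toep_Qmat] toep_mult mult.assoc)
  also have "fps_of_real w * (fps_of_real hr * fps_of_real w) = fps_of_real (g * hr)"
    by (simp add: fps_of_real_mult[symmetric] w[symmetric] power2_eq_square mult_ac)
  also have "\<dots> = fps_const (of_real e)"
    unfolding ghr by (intro fps_ext) (auto simp: fps_of_real_def)
  also have "Qmat k * toep k (fps_const (of_real e)) = of_real e \<cdot>\<^sub>m Qmat k"
    by (simp add: toep_const mat_ring)
  also have "complex_of_real e = of_int (if Re (K $$ (0, k - 1)) > 0 then 1 else -1)"
    by (simp add: e_def hr0)
  finally show ?thesis
    by (intro bexI[of _ W]) (auto simp: W_def jordan_block_commute_toep)
qed

text \<open>The highest power comes first, so that \<open>N\<close> moves each column to its left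
  neighbour, in accordance with upper triangular Jordan blocks.\<close>

definition chain :: "nat \<Rightarrow> complex mat \<Rightarrow> complex mat \<Rightarrow> complex mat" where
  "chain k N x = mat (dim_row x) k (\<lambda>(i, j). (N ^\<^sub>m (k - 1 - j) * x) $$ (i, 0))"

lemma dim_chain [simp]: "dim_row (chain k N x) = dim_row x" "dim_col (chain k N x) = k"
  by (auto simp: chain_def)

lemma index_chain [simp]:
  "i < dim_row x \<Longrightarrow> j < k \<Longrightarrow> chain k N x $$ (i, j) = (N ^\<^sub>m (k - 1 - j) * x) $$ (i, 0)"
  by (simp add: chain_def)

lemma dim_pow_mat_square [simp]:
  "dim_row A = dim_col A \<Longrightarrow> dim_row (A ^\<^sub>m r) = dim_col A"
  "dim_row A = dim_col A \<Longrightarrow> dim_col (A ^\<^sub>m r) = dim_col A"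
  by (auto simp: pow_mat_dim)

lemma pow_mat_Suc_left:
  fixes A :: "'a :: semiring_1 mat"
  assumes "dim_row A = dim_col A"
  shows "A * A ^\<^sub>m r = A ^\<^sub>m Suc r"
proof (induction r)
  case (Suc r)
  have "A * A ^\<^sub>m Suc r = (A * A ^\<^sub>m r) * A" using assms by (simp add: mat_ring)
  then show ?case using Suc by simp
qed (use assms in \<open>simp add: mat_ring\<close>)

lemma chain_jordan_block:
  assumes A: "A \<in> sq_mats d" and x: "x \<in> carrier_mat d 1"
    and N: "N = A - l \<cdot>\<^sub>m 1\<^sub>m d" and nil: "N ^\<^sub>m k * x = 0\<^sub>m d 1"
  shows "A * chain k N x = chain k N x * J k l"
proof (intro eq_matI)
  fix i j assume "i < dim_row (chain k N x * J k l)" "j < dim_col (chain k N x * J k l)"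
  then have ij: "i < d" "j < k" using x by auto
  let ?y = "N ^\<^sub>m (k - 1 - j) * x"
  have dN: "dim_row N = d" "dim_col N = d" using N A by auto
  have AN: "A = N + l \<cdot>\<^sub>m 1\<^sub>m d" using A unfolding N by (intro eq_matI) auto
  have "(A * chain k N x) $$ (i, j) = (A * ?y) $$ (i, 0)"
    using ij A x dN by (auto simp: index_mult_sum)
  also have "A * ?y = N * ?y + l \<cdot>\<^sub>m ?y"
    using A x dN by (subst AN) (simp add: mat_ring)
  also have "N * ?y = N ^\<^sub>m (Suc (k - 1 - j)) * x"
    using dN x by (simp add: pow_mat_Suc_left mult_mat_assoc[symmetric] del: pow_mat.simps)
  also have "Suc (k - 1 - j) = k - j" using ij by auto
  finally have 1: "(A * chain k N x) $$ (i, j) = (N ^\<^sub>m (k - j) * x) $$ (i, 0) + l * ?y $$ (i, 0)"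
    using ij dN x by simp
  have "(chain k N x * J k l) $$ (i, j) =
      ?y $$ (i, 0) * l + (if j > 0 then (N ^\<^sub>m (k - j) * x) $$ (i, 0) else 0)"
    using ij dN x by (auto simp: index_mult_jordan_block)
  also have "(if j > 0 then (N ^\<^sub>m (k - j) * x) $$ (i, 0) else 0) = (N ^\<^sub>m (k - j) * x) $$ (i, 0)"
    using nil ij by auto
  finally show "(A * chain k N x) $$ (i, j) = (chain k N x * J k l) $$ (i, j)"
    using 1 by (simp add: mult.commute)
qed (use A x in auto)

text \<open>The corner pairs the first column of one chain, which carries the highest power, with
  the last column of the other, which is z itself. This is the entry that decides whether a Gram
  matrix can be normalised.\<close>

lemma gram_chain_corner:
  assumes x: "x \<in> carrier_mat d 1" and z: "z \<in> carrier_mat d 1" and k: "k > 0"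
    and H: "H \<in> sq_mats d" and N: "N \<in> sq_mats d" and N': "N' \<in> sq_mats d"
  shows "(adj (chain k N x) * H * chain k N' z) $$ (0, k - 1) =
    (adj (N ^\<^sub>m (k - 1) * x) * H * z) $$ (0, 0)"
proof -
  have d: "dim_row x = d" "dim_col x = 1" "dim_row z = d" "dim_col z = 1" "dim_row H = d"
    "dim_col H = d" "dim_row N = d" "dim_col N = d" "dim_row N' = d" "dim_col N' = d"
    using assms by auto
  have "(adj (chain k N x) * (H * chain k N' z)) $$ (0, k - 1) =
    (adj (N ^\<^sub>m (k - 1) * x) * (H * z)) $$ (0, 0)"
    using k by (auto simp: index_mult_sum d mat_ring)
  then show ?thesis using d by (simp add: mat_ring)
qed

section \<open>Simultaneous congruence and similarity\<close>

lemma four_block_mult: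
  fixes A1 A2 B1 B2 C1 C2 D1 D2 :: "'a :: semiring_0 mat"
  assumes "dim_row B1 = dim_row A1" "dim_col C1 = dim_col A1" "dim_row C1 = dim_row D1"
    "dim_col B1 = dim_col D1" "dim_row A2 = dim_col A1" "dim_row B2 = dim_col A1"
    "dim_row C2 = dim_col D1" "dim_row D2 = dim_col D1" "dim_col C2 = dim_col A2"
    "dim_col B2 = dim_col D2"
  shows "four_block_mat A1 B1 C1 D1 * four_block_mat A2 B2 C2 D2
    = four_block_mat (A1 * A2 + B1 * C2) (A1 * B2 + B1 * D2) (C1 * A2 + D1 * C2) (C1 * B2 + D1 * D2)"
  using assms
  by (intro mult_four_block_mat[of _ "dim_row A1" "dim_col A1" _ "dim_col D1" _ "dim_row D1"
        _ _ "dim_col A2" _ "dim_col D2"]) auto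

lemma adjoint_four_block:
  fixes A B C D :: "complex mat"
  assumes "dim_row B = dim_row A" "dim_col C = dim_col A" "dim_row C = dim_row D"
    "dim_col B = dim_col D"
  shows "adj (four_block_mat A B C D) =
    four_block_mat (adj A) (adj C) (adj B) (adj D)"
  using assms by (intro eq_matI) auto

lemma dsum_four_block:
  "dsum A B = four_block_mat A (0\<^sub>m (dim_row A) (dim_col B)) (0\<^sub>m (dim_row B) (dim_col A)) B"
proof -
  have "four_block_mat B (0\<^sub>m (dim_row B) 0) (0\<^sub>m 0 (dim_col B)) (0\<^sub>m 0 0) = B"
    by (intro eq_matI) auto
  then show ?thesis by (simp add: dsum_def Let_def)
qed

lemma dim_dsum [simp]:
  "dim_row (dsum A B) = dim_row A + dim_row B" "dim_col (dsum A B) = dim_col A + dim_col B"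
  by (auto simp: dsum_four_block)

lemma diag_block_mat_Cons_dsum: "diag_block_mat (A # As) = dsum A (diag_block_mat As)"
  by (simp add: dsum_four_block Let_def)

lemma diag_block_mat_append_dsum:
  "diag_block_mat (As @ Bs) = dsum (diag_block_mat As) (diag_block_mat Bs)"
  by (simp add: dsum_four_block diag_block_mat_append Let_def)

lemma dsum_mult:
  assumes "dim_col A = dim_row C" "dim_col B = dim_row D"
  shows "dsum A B * dsum C D = dsum (A * C) (B * D)"
  using assms by (simp add: dsum_four_block four_block_mult mat_ring)

lemma adjoint_dsum: "adj (dsum A B) = dsum (adj A) (adj B)"
  by (simp add: dsum_four_block adjoint_four_block)

lemma conj_dsum: "conj_mat (dsum A B) = dsum (conj_mat A) (conj_mat B)"
  unfolding dsum_four_block by (intro eq_matI) auto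

lemma dsum_one: "dsum (1\<^sub>m a) (1\<^sub>m b) = 1\<^sub>m (a + b)"
  by (simp add: dsum_four_block)

lemma dsum_empty [simp]: "dsum A (0\<^sub>m 0 0) = A"
  by (simp add: dsum_def Let_def) (intro eq_matI, auto)

lemma dsum_power:
  assumes "dim_row A = dim_col A" "dim_row B = dim_col B"
  shows "dsum A B ^\<^sub>m r = dsum (A ^\<^sub>m r) (B ^\<^sub>m r)"
  using diag_block_pow_mat[of "[A, B]" r] assms by (simp add: dsum_def del: diag_block_mat.simps)

text \<open>Pairs related in this way describe the same operator and the same form in different
  bases: similarity on the first component, congruence on the second. \<open>T\<close> is merely
  complex; the quaternionic basis change is \<open>dsum T (conj_mat T)\<close>.\<close>

definition pair_cong :: "complex mat \<Rightarrow> complex mat \<Rightarrow> complex mat \<Rightarrow> complex mat \<Rightarrow> bool" where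
  "pair_cong M N M' N' \<longleftrightarrow> (\<exists>k. \<exists>T \<in> sq_mats k. \<exists>Ti \<in> sq_mats k.
     M \<in> sq_mats k \<and> N \<in> sq_mats k \<and> M' \<in> sq_mats k \<and> N' \<in> sq_mats k \<and>
     T * Ti = 1\<^sub>m k \<and> Ti * T = 1\<^sub>m k \<and> M * T = T * M' \<and> adj T * N * T = N')"

lemma pair_cong_intro:
  assumes "M \<in> sq_mats k" "N \<in> sq_mats k" "M' \<in> sq_mats k"
    "N' \<in> sq_mats k" "T \<in> sq_mats k" "Ti \<in> sq_mats k"
    "T * Ti = 1\<^sub>m k" "Ti * T = 1\<^sub>m k" "M * T = T * M'" "adj T * N * T = N'"
  shows "pair_cong M N M' N'"
  using assms unfolding pair_cong_def by blast

text \<open>As \<open>N'\<close> is its own inverse, \<open>N' * (adj T * N)\<close> is a left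
  inverse of \<open>T\<close>, and for square matrices a left inverse is two-sided.\<close>

lemma left_invertible_from_gram:
  fixes T N N' :: "complex mat"
  assumes T: "T \<in> sq_mats k" and N: "N \<in> sq_mats k" and N': "N' \<in> sq_mats k"
    and g: "adj T * N * T = N'" and inv: "N' * N' = 1\<^sub>m k"
  shows "\<exists>Ti \<in> sq_mats k. T * Ti = 1\<^sub>m k \<and> Ti * T = 1\<^sub>m k"
proof -
  let ?Ti = "N' * (adj T * N)"
  have c: "?Ti \<in> sq_mats k" using T N N' by (intro carrier_matI) auto
  have "?Ti * T = N' * (adj T * N * T)" using T N N' by (simp add: mat_ring)
  then have "?Ti * T = 1\<^sub>m k" using g inv by simp
  then show ?thesis using c mult_mat_left_inverse[OF c T] by blast
qed

lemma pair_congI: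
  assumes "M \<in> sq_mats k" "N \<in> sq_mats k" "M' \<in> sq_mats k"
    "N' \<in> sq_mats k" "T \<in> sq_mats k"
    "M * T = T * M'" "adj T * N * T = N'" "N' * N' = 1\<^sub>m k"
  shows "pair_cong M N M' N'"
  using left_invertible_from_gram[OF assms(5,2,4,7,8)] assms unfolding pair_cong_def by blast

lemma pair_cong_refl:
  assumes "M \<in> sq_mats k" "N \<in> sq_mats k"
  shows "pair_cong M N M N"
  unfolding pair_cong_def using assms
  by (intro exI[of _ k] bexI[of _ "1\<^sub>m k"]) (auto simp: mat_ring)

lemma pair_cong_trans:
  assumes "pair_cong M N M' N'" "pair_cong M' N' M'' N''"
  shows "pair_cong M N M'' N''"
proof -
  from assms(1) obtain k T Ti where 1: "T \<in> sq_mats k" "Ti \<in> sq_mats k"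
    "M \<in> sq_mats k" "N \<in> sq_mats k" "M' \<in> sq_mats k" "N' \<in> sq_mats k"
    "T * Ti = 1\<^sub>m k" "Ti * T = 1\<^sub>m k" "M * T = T * M'" "adj T * N * T = N'"
    unfolding pair_cong_def by auto
  from assms(2) 1(5) obtain U Ui where 2: "U \<in> sq_mats k" "Ui \<in> sq_mats k"
    "M'' \<in> sq_mats k" "N'' \<in> sq_mats k"
    "U * Ui = 1\<^sub>m k" "Ui * U = 1\<^sub>m k" "M' * U = U * M''" "adj U * N' * U = N''"
    unfolding pair_cong_def by auto
  note d = carrier_matD[OF 1(1)] carrier_matD[OF 1(2)] carrier_matD[OF 1(3)] carrier_matD[OF 1(4)]
    carrier_matD[OF 1(5)] carrier_matD[OF 1(6)] carrier_matD[OF 2(1)] carrier_matD[OF 2(2)]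
    carrier_matD[OF 2(3)] carrier_matD[OF 2(4)]
  have a: "T * U * (Ui * Ti) = 1\<^sub>m k"
    by (simp add: d mat_ring mat_rewrite1[OF 2(5)] 1(7))
  have b: "Ui * Ti * (T * U) = 1\<^sub>m k"
    by (simp add: d mat_ring mat_rewrite1[OF 1(8)] 2(6))
  have c: "M * (T * U) = T * U * M''"
    by (simp add: d mat_ring mat_rewrite[OF 1(9)] 2(7))
  have "adj (T * U) * N * (T * U) = adj U * (adj T * N * T) * U"
    by (simp add: d mat_ring mat_adjoint_mult)
  then have e: "adj (T * U) * N * (T * U) = N''" using 1(10) 2(8) by simp
  show ?thesis
    by (rule pair_cong_intro[OF 1(3,4) 2(3,4) mult_carrier_mat[OF 1(1) 2(1)]
          mult_carrier_mat[OF 2(2) 1(2)] a b c e])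
qed

lemma pair_cong_dsum:
  assumes "pair_cong M1 N1 M1' N1'" "pair_cong M2 N2 M2' N2'"
  shows "pair_cong (dsum M1 M2) (dsum N1 N2) (dsum M1' M2') (dsum N1' N2')"
proof -
  from assms(1) obtain k T Ti where 1: "T \<in> sq_mats k" "Ti \<in> sq_mats k"
    "M1 \<in> sq_mats k" "N1 \<in> sq_mats k" "M1' \<in> sq_mats k" "N1' \<in> sq_mats k"
    "T * Ti = 1\<^sub>m k" "Ti * T = 1\<^sub>m k" "M1 * T = T * M1'" "adj T * N1 * T = N1'"
    unfolding pair_cong_def by auto
  from assms(2) obtain j U Ui where 2: "U \<in> sq_mats j" "Ui \<in> sq_mats j"
    "M2 \<in> sq_mats j" "N2 \<in> sq_mats j" "M2' \<in> sq_mats j" "N2' \<in> sq_mats j"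
    "U * Ui = 1\<^sub>m j" "Ui * U = 1\<^sub>m j" "M2 * U = U * M2'" "adj U * N2 * U = N2'"
    unfolding pair_cong_def by auto
  note d = carrier_matD[OF 1(1)] carrier_matD[OF 1(2)] carrier_matD[OF 1(3)] carrier_matD[OF 1(4)]
    carrier_matD[OF 1(5)] carrier_matD[OF 1(6)] carrier_matD[OF 2(1)] carrier_matD[OF 2(2)]
    carrier_matD[OF 2(3)] carrier_matD[OF 2(4)] carrier_matD[OF 2(5)] carrier_matD[OF 2(6)]
  have c: "dsum A B \<in> sq_mats (k + j)"
    if "A \<in> sq_mats k" "B \<in> sq_mats j" for A B
    using that by (intro carrier_matI) auto
  show ?thesis
    by (rule pair_cong_intro[OF c[OF 1(3) 2(3)] c[OF 1(4) 2(4)] c[OF 1(5) 2(5)] c[OF 1(6) 2(6)]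
          c[OF 1(1) 2(1)] c[OF 1(2) 2(2)]])
      (simp_all add: d dsum_mult adjoint_dsum dsum_one 1(7-10) 2(7-10))
qed

text \<open>Indexing rows and columns by a list turns a permutation of the basis into a permutation
  of the list, and a splitting into direct summands into an append.\<close>

definition list_mat :: "'a list \<Rightarrow> ('a \<Rightarrow> 'a \<Rightarrow> complex) \<Rightarrow> complex mat" where
  "list_mat xs f = mat (length xs) (length xs) (\<lambda>(i, j). f (xs ! i) (xs ! j))"

lemma dim_list_mat [simp]:
  "dim_row (list_mat xs f) = length xs" "dim_col (list_mat xs f) = length xs"
  by (auto simp: list_mat_def)

lemma index_list_mat [simp]:
  "i < length xs \<Longrightarrow> j < length xs \<Longrightarrow> list_mat xs f $$ (i, j) = f (xs ! i) (xs ! j)"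
  by (simp add: list_mat_def)

lemma pair_cong_reindex:
  assumes "mset xs = mset ys"
  shows "pair_cong (list_mat xs f) (list_mat xs g) (list_mat ys f) (list_mat ys g)"
proof -
  let ?n = "length ys"
  from mset_eq_permutation[OF assms] obtain p
    where p: "p permutes {..<?n}" "permute_list p ys = xs" .
  have len: "length xs = ?n" using assms mset_eq_length by blast
  have xs: "xs ! i = ys ! p i" if "i < ?n" for i
    using p that by (auto simp: permute_list_nth)
  have pl: "p i < ?n" if "i < ?n" for i using p(1) that permutes_in_image[of p] by fastforce
  define T where "T = mat ?n ?n (\<lambda>(i, j). if j = p i then 1 else 0 :: complex)"
  have dT [simp]: "dim_row T = ?n" "dim_col T = ?n" by (auto simp: T_def)
  have Tm: "(T * A) $$ (i, j) = A $$ (p i, j)"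
    if "i < ?n" "j < dim_col A" "dim_row A = ?n" for i j A
  proof -
    have "(T * A) $$ (i, j) = (\<Sum>l<dim_row A. T $$ (i, l) * A $$ (l, j))"
      using that by (intro index_mult_sum) auto
    also have "\<dots> = (\<Sum>l<?n. if l = p i then A $$ (l, j) else 0)"
      using that by (intro sum.cong) (auto simp: T_def)
    finally show ?thesis using that pl by simp
  qed
  \<comment> \<open>Right multiplication by \<open>T\<close> moves column j to position
    \<open>p j\<close>; every column is reached in this way by \<open>surj\<close>.\<close>
  have mT: "(A * T) $$ (i, p j) = A $$ (i, j)"
    if "i < dim_row A" "j < ?n" "dim_col A = ?n" for i j A
  proof -
    have "(A * T) $$ (i, p j) = (\<Sum>l<dim_row T. A $$ (i, l) * T $$ (l, p j))"
      using that pl by (intro index_mult_sum) auto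
    also have "\<dots> = (\<Sum>l<?n. if l = j then A $$ (i, l) else 0)"
      using that pl permutes_inj[OF p(1)] by (intro sum.cong) (auto simp: T_def dest: injD)
    finally show ?thesis using that by simp
  qed
  have surj: "\<exists>l<?n. j = p l" if "j < ?n" for j
  proof -
    have "j \<in> p ` {..<?n}" using permutes_image[OF p(1)] that by simp
    then show ?thesis by auto
  qed
  have comm: "list_mat xs h * T = T * list_mat ys h" for h
  proof (intro eq_matI)
    fix i j assume "i < dim_row (T * list_mat ys h)" "j < dim_col (T * list_mat ys h)"
    then have ij: "i < ?n" "j < ?n" by auto
    from surj[OF ij(2)] obtain l where l: "l < ?n" "j = p l" by auto
    show "(list_mat xs h * T) $$ (i, j) = (T * list_mat ys h) $$ (i, j)"
      using ij l by (simp add: Tm mT len xs pl)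
  qed (auto simp: len)
  have TT: "T * adj T = 1\<^sub>m ?n"
  proof (intro eq_matI)
    fix i j assume "i < dim_row (1\<^sub>m ?n :: complex mat)" "j < dim_col (1\<^sub>m ?n :: complex mat)"
    then show "(T * adj T) $$ (i, j) = 1\<^sub>m ?n $$ (i, j)"
      using permutes_inj[OF p(1)] by (auto simp: Tm pl) 
        (auto simp: T_def pl dest: injD)
  qed auto
  have TT': "adj T * T = 1\<^sub>m ?n"
    by (rule mult_mat_left_inverse[OF _ _ TT]) auto
  have "adj T * list_mat xs g * T = list_mat ys g"
    by (simp add: len mat_ring comm mat_rewrite1[OF TT'])
  then show ?thesis
    by (intro pair_cong_intro[of _ ?n _ _ _ T "adj T"] carrier_matI) (simp_all add: TT TT' comm len)
qed

lemma list_mat_append: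
  assumes "\<And>x y. x \<in> set xs \<Longrightarrow> y \<in> set ys \<Longrightarrow> f x y = 0 \<and> f y x = 0"
  shows "list_mat (xs @ ys) f = dsum (list_mat xs f) (list_mat ys f)"
  unfolding dsum_four_block using assms by (intro eq_matI) (auto simp: nth_append)

lemma pair_cong_dsum_swap:
  assumes "A \<in> sq_mats a" "B \<in> sq_mats b" "A' \<in> sq_mats a" "B' \<in> sq_mats b"
  shows "pair_cong (dsum A B) (dsum A' B') (dsum B A) (dsum B' A')"
proof -
  \<comment> \<open>The rotated list names the indices of the second summand first.\<close>
  let ?xs = "[0..<a + b]" and ?ys = "[a..<a + b] @ [0..<a]"
  have "?xs = [0..<a] @ [a..<a + b]" by (metis le0 upt_add_eq_append)
  then have m: "mset ?xs = mset ?ys" by (simp only: mset_append add.commute)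
  have 1: "list_mat ?xs (\<lambda>i j. dsum C D $$ (i, j)) = dsum C D"
    if "C \<in> sq_mats a" "D \<in> sq_mats b" for C D
    using that by (intro eq_matI) auto
  have 2: "list_mat ?ys (\<lambda>i j. dsum C D $$ (i, j)) = dsum D C"
    if "C \<in> sq_mats a" "D \<in> sq_mats b" for C D
    using that by (intro eq_matI) (auto simp: nth_append dsum_four_block)
  from pair_cong_reindex[OF m, of "\<lambda>i j. dsum A B $$ (i, j)" "\<lambda>i j. dsum A' B' $$ (i, j)"]
  show ?thesis using assms by (simp add: 1 2)
qed

section \<open>Canonical blocks and their powers\<close>

lemma canon_Nil [simp]: "canon_M [] = 0\<^sub>m 0 0" "canon_N [] = 0\<^sub>m 0 0"
  by (auto simp: canon_M_def canon_N_def)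

lemma canon_append:
  "canon_M (D @ E) = dsum (canon_M D) (canon_M E)"
  "canon_N (D @ E) = dsum (canon_N D) (canon_N E)"
  by (auto simp: canon_M_def canon_N_def diag_block_mat_append_dsum)

lemma canon_Cons:
  "canon_M (d # D) = dsum (canon_M [d]) (canon_M D)"
  "canon_N (d # D) = dsum (canon_N [d]) (canon_N D)"
  using canon_append[of "[d]" D] by auto

lemma canon_single:
  "canon_M [(l, k, e)] = (if Im l = 0 then J k l
     else dsum (J k l) (J k (cnj l)))"
  "canon_N [(l, k, e)] = (if Im l = 0 then of_int e \<cdot>\<^sub>m Qmat k else Qmat (2 * k))"
  by (auto simp: canon_M_def canon_N_def simp del: diag_block_mat.simps)

lemma dim_canon [simp]:
  "dim_col (canon_M D) = dim_row (canon_M D)"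
  "dim_row (canon_N D) = dim_row (canon_M D)"
  "dim_col (canon_N D) = dim_row (canon_M D)"
proof (induction D)
  case (Cons d D)
  obtain l k e where d: "d = (l, k, e)" by (cases d) auto
  { case 1 show ?case unfolding canon_Cons[of d D] using Cons by (simp add: d canon_single) }
  { case 2 show ?case unfolding canon_Cons[of d D] using Cons by (simp add: d canon_single) }
  { case 3 show ?case unfolding canon_Cons[of d D] using Cons by (simp add: d canon_single) }
qed auto

lemma canon_carrier:
  "canon_M D \<in> carrier_mat (dim_row (canon_M D)) (dim_row (canon_M D))"
  "canon_N D \<in> carrier_mat (dim_row (canon_M D)) (dim_row (canon_M D))"
  by (auto intro: carrier_matI)

lemma Qmat_double:
  "Qmat (2 * k) = four_block_mat (0\<^sub>m k k) (Qmat k) (Qmat k) (0\<^sub>m k k)"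
  by (intro eq_matI) auto

lemma adjoint_canon_N [simp]: "adj (canon_N D) = canon_N D"
proof (induction D)
  case (Cons d D)
  obtain l k e where d: "d = (l, k, e)" by (cases d) auto
  show ?case unfolding canon_Cons[of d D]
    by (simp add: adjoint_dsum Cons d canon_single mat_adjoint_smult)
qed auto

lemma conj_canon_N [simp]: "conj_mat (canon_N D) = canon_N D"
proof (induction D)
  case (Cons d D)
  obtain l k e where d: "d = (l, k, e)" by (cases d) auto
  show ?case unfolding canon_Cons[of d D]
    by (simp add: conj_dsum Cons d canon_single conj_mat_smult)
qed auto

lemma conj_jordan_block [simp]: "conj_mat (J k l) = J k (cnj l)"
  by (intro eq_matI) auto

text \<open>Conjugation fixes a real block and exchanges the members of a conjugate pair. The second
  copy being the conjugate of the first is what allows all work to be done in one copy.\<close>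

lemma canon_M'_conj: "canon_M' D = conj_mat (canon_M D)"
proof (induction D)
  case (Cons d D)
  obtain l k e where d: "d = (l, k, e)" by (cases d) auto
  have 1: "canon_M' (d # D) = dsum (canon_M' [d]) (canon_M' D)"
    unfolding canon_M'_def
    by (simp add: diag_block_mat_Cons_dsum del: diag_block_mat.simps(2))
  have 2: "Im l = 0 \<Longrightarrow> cnj l = l" by (simp add: complex_eq_iff)
  have "canon_M' [d] = conj_mat (canon_M [d])"
    by (simp add: d canon_single canon_M'_def diag_block_mat_Cons_dsum conj_dsum 2
        del: diag_block_mat.simps(2))
  then show ?case by (simp add: 1 canon_Cons(1)[of d D] conj_dsum Cons)
qed (simp add: canon_M'_def)

lemma smult_smult_mat: "a \<cdot>\<^sub>m (b \<cdot>\<^sub>m A) = (a * b :: complex) \<cdot>\<^sub>m A"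
  by (intro eq_matI) auto

lemma smult_one_mat [simp]: "1 \<cdot>\<^sub>m A = (A :: complex mat)"
  by (intro eq_matI) auto

lemma canon_data_Cons: "canon_data (d # D) \<longleftrightarrow> canon_data [d] \<and> canon_data D"
  by (auto simp: canon_data_def)

lemma canon_N_square: "canon_data D \<Longrightarrow> canon_N D * canon_N D = 1\<^sub>m (dim_row (canon_M D))"
proof (induction D)
  case (Cons d D)
  obtain l k e where d: "d = (l, k, e)" by (cases d) auto
  have "canon_N [d] * canon_N [d] = 1\<^sub>m (dim_row (canon_M [d]))"
    using Cons.prems
    by (auto simp: canon_single d mat_ring Qmat_square canon_data_def smult_smult_mat mult_2)
  then show ?case using Cons canon_data_Cons[of d D]
    unfolding canon_Cons[of d D] by (simp add: dsum_mult dsum_one)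
qed auto

lemma canon_N_intertwines: "canon_N D * canon_M D = adj (canon_M D) * canon_N D"
proof (induction D)
  case (Cons d D)
  obtain l k e where d: "d = (l, k, e)" by (cases d) auto
  have 1: "cnj l = l" if "Im l = 0" using that by (simp add: complex_eq_iff)
  have "canon_N [d] * canon_M [d] = adj (canon_M [d]) * canon_N [d]"
    by (simp add: canon_single d mat_ring Qmat_jordan_block 1 Qmat_double dsum_four_block
        four_block_mult adjoint_four_block)
  then show ?case using Cons
    unfolding canon_Cons[of d D] by (simp add: dsum_mult adjoint_dsum)
qed auto

text \<open>The head of \<open>D\<close> is located in \<open>E\<close> and moved past the blocks
  before it by one swap of direct summands.\<close>

lemma pair_cong_canon_mset:
  "mset D = mset E \<Longrightarrow> pair_cong (canon_M D) (canon_N D) (canon_M E) (canon_N E)"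
proof (induction D arbitrary: E)
  case Nil
  then show ?case by (auto intro!: pair_cong_refl[of _ 0])
next
  case (Cons d D)
  then have "d \<in> set E" by (metis list.set_intros(1) mset_eq_setD)
  then obtain E1 E2 where E: "E = E1 @ d # E2" by (meson split_list)
  with Cons.prems have "mset D = mset (E1 @ E2)" by auto
  from Cons.IH[OF this] have "pair_cong (canon_M (d # D)) (canon_N (d # D))
      (canon_M ([d] @ E1 @ E2)) (canon_N ([d] @ E1 @ E2))"
    unfolding canon_append canon_Cons[of d D]
    by (intro pair_cong_dsum pair_cong_refl) (auto intro: canon_carrier simp: canon_append(1) canon_append(2))
  moreover have "pair_cong (canon_M (([d] @ E1) @ E2)) (canon_N (([d] @ E1) @ E2))
      (canon_M ((E1 @ [d]) @ E2)) (canon_N ((E1 @ [d]) @ E2))"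
    unfolding canon_append
    by (intro pair_cong_dsum pair_cong_dsum_swap pair_cong_refl) (rule canon_carrier)+
  ultimately show ?case using pair_cong_trans E by fastforce
qed

section \<open>Powers of Jordan blocks at a nonzero eigenvalue\<close>

lemma fps_shifted_X_power_nth:
  fixes c :: complex
  shows "((fps_const c + fps_X) ^ m) $ 0 = c ^ m"
    "((fps_const c + fps_X) ^ m) $ Suc 0 = of_nat m * c ^ (m - 1)"
proof -
  show 0: "((fps_const c + fps_X) ^ m) $ 0 = c ^ m" for m
    by (induction m) auto
  show "((fps_const c + fps_X) ^ m) $ Suc 0 = of_nat m * c ^ (m - 1)"
  proof (induction m)
    case (Suc m)
    have "((fps_const c + fps_X) ^ Suc m) $ Suc 0 =
        c * (fps_const c + fps_X) ^ m $ Suc 0 + (fps_const c + fps_X) ^ m $ 0" by simp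
    then show ?case unfolding Suc 0 by (cases m) (auto simp: algebra_simps)
  qed auto
qed

text \<open>The columns of \<open>U\<close> are the images of the last unit vector under the powers of
  the nilpotent matrix \<open>J(c)^m - c^m\<close>.\<close>

lemma jordan_block_power_similar:
  fixes c :: complex
  assumes k: "k > 0"
  obtains U where "U \<in> sq_mats k"
    "J k c ^\<^sub>m m * U = U * J k (c ^ m)"
    "\<And>i. 0 < i \<Longrightarrow> i < k \<Longrightarrow> U $$ (i, 0) = 0"
    "U $$ (0, 0) = (of_nat m * c ^ (m - 1)) ^ (k - 1)" "U $$ (k - 1, k - 1) = 1"
proof -
  \<comment> \<open>J(c)^m - c^m is g evaluated at the nilpotent block. The linear coefficient m
    c^(m-1) of g is the derivative of z^m at c.\<close>
  define g where "g = (fps_const c + fps_X) ^ m - fps_const (c ^ m)"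
  have g0: "g $ 0 = 0" by (simp add: g_def fps_shifted_X_power_nth)
  have g1: "g $ 1 = of_nat m * c ^ (m - 1)" by (simp add: g_def fps_shifted_X_power_nth)
  define x :: "complex mat" where "x = mat k 1 (\<lambda>(i, j). if i = k - 1 then 1 else 0)"
  have x: "x \<in> carrier_mat k 1" by (simp add: x_def)
  have N: "toep k g = J k c ^\<^sub>m m - (c ^ m) \<cdot>\<^sub>m 1\<^sub>m k"
    by (simp add: g_def toep_diff jordan_block_toep toep_power toep_const)
  have tx: "(toep k f * x) $$ (i, 0) = f $ (k - 1 - i)" if "i < k" for f i
  proof -
    have "(toep k f * x) $$ (i, 0) = (\<Sum>l<dim_row x. toep k f $$ (i, l) * x $$ (l, 0))"
      using that x by (intro index_mult_sum) auto
    also have "\<dots> = (\<Sum>l<k. if l = k - 1 then toep k f $$ (i, l) else 0)"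
      using x by (intro sum.cong) (auto simp: x_def)
    also have "\<dots> = f $ (k - 1 - i)" using that k by simp
    finally show ?thesis .
  qed
  have nil: "toep k g ^\<^sub>m k * x = 0\<^sub>m k 1"
  proof (intro eq_matI)
    fix i j assume "i < dim_row (0\<^sub>m k 1 :: complex mat)" "j < dim_col (0\<^sub>m k 1 :: complex mat)"
    then have ij: "i < k" "j = 0" by auto
    then show "(toep k g ^\<^sub>m k * x) $$ (i, j) = 0\<^sub>m k 1 $$ (i, j)"
      using startsby_zero_power_prefix[OF g0, of k] k
      by (simp add: toep_power tx)
  qed (use x in auto)
  let ?U = "chain k (toep k g) x"
  have U: "?U $$ (i, j) = (g ^ (k - 1 - j)) $ (k - 1 - i)" if "i < k" "j < k" for i j
    using that x by (simp add: toep_power tx)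
  show thesis
  proof (rule that[of ?U])
    show "?U \<in> sq_mats k" using x by (intro carrier_matI) auto
    show "J k c ^\<^sub>m m * ?U = ?U * J k (c ^ m)"
      by (rule chain_jordan_block[OF _ x N nil]) auto
    \<comment> \<open>Column 0 holds coefficients of g^(k-1), which starts in degree k-1: only the
      top entry survives, and it is a power of the linear coefficient.\<close>
    show "?U $$ (i, 0) = 0" if "0 < i" "i < k" for i
      using startsby_zero_power_prefix[OF g0, of "k - 1"] that by (simp add: U)
    show "?U $$ (0, 0) = (of_nat m * c ^ (m - 1)) ^ (k - 1)"
      using startsby_zero_power_nth_same[OF g0, of "k - 1"] k g1 by (simp add: U)
    show "?U $$ (k - 1, k - 1) = 1" using k by (simp add: U)
  qed
qed

lemma gram_Qmat_corner:
  assumes U: "U \<in> sq_mats k" and V: "V \<in> sq_mats k" and k: "k > 0"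
    and z: "\<And>i. 0 < i \<Longrightarrow> i < k \<Longrightarrow> U $$ (i, 0) = 0"
  shows "(adj U * Qmat k * V) $$ (0, k - 1) = cnj (U $$ (0, 0)) * V $$ (k - 1, k - 1)"
proof -
  have "(adj U * (Qmat k * V)) $$ (0, k - 1) =
      (\<Sum>l<dim_row (Qmat k * V). adj U $$ (0, l) * (Qmat k * V) $$ (l, k - 1))"
    using assms by (intro index_mult_sum) auto
  also have "\<dots> = (\<Sum>l<k. if l = 0 then cnj (U $$ (0, 0)) * V $$ (k - 1, k - 1) else 0)"
    using assms by (intro sum.cong) auto
  finally show ?thesis using assms by (simp add: mat_ring)
qed

lemma mat_power_intertwine:
  fixes A H :: "complex mat"
  assumes "A \<in> sq_mats d" "H \<in> sq_mats d" "B \<in> sq_mats d"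
    and "H * A = adj B * H"
  shows "H * A ^\<^sub>m r = adj (B ^\<^sub>m r) * H"
proof (induction r)
  case 0
  then show ?case using assms by (simp add: mat_ring)
next
  case (Suc r)
  have d: "dim_row A = d" "dim_col A = d" "dim_row H = d" "dim_col H = d"
    "dim_row B = d" "dim_col B = d" using assms by auto
  have "H * A ^\<^sub>m Suc r = adj (B ^\<^sub>m r) * (H * A)"
    by (simp add: d mat_ring mat_rewrite[OF Suc])
  also have "\<dots> = adj (B * B ^\<^sub>m r) * H"
    unfolding assms(4) by (simp add: d mat_ring mat_adjoint_mult)
  also have "B * B ^\<^sub>m r = B ^\<^sub>m Suc r" by (simp add: d pow_mat_Suc_left del: pow_mat.simps)
  finally show ?case .
qed

text \<open>The basis \<open>U\<close> multiplies the corner of the Gram matrix by the real number r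
  = (m c^(m-1))^(k-1), whose sign is s. As s does not depend on e, the sign of the original block
  can also be solved for when a root is sought.\<close>

lemma pair_cong_power_real:
  assumes c: "Im c = 0" "c \<noteq> 0" and k: "k > 0" and m: "m > 0"
  shows "\<exists>s :: int. (s = 1 \<or> s = -1) \<and> (\<forall>e. e = 1 \<or> e = -1 \<longrightarrow>
    pair_cong (J k c ^\<^sub>m m) (of_int e \<cdot>\<^sub>m Qmat k)
      (canon_M [(c ^ m, k, e * s)]) (canon_N [(c ^ m, k, e * s)]))"
proof -
  from jordan_block_power_similar[OF k, of c m] obtain U where U: "U \<in> sq_mats k"
    "J k c ^\<^sub>m m * U = U * J k (c ^ m)"
    "\<And>i. 0 < i \<Longrightarrow> i < k \<Longrightarrow> U $$ (i, 0) = 0"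
    "U $$ (0, 0) = (of_nat m * c ^ (m - 1)) ^ (k - 1)" "U $$ (k - 1, k - 1) = 1" by blast
  have dU: "dim_row U = k" "dim_col U = k" using U by auto
  define r where "r = (real m * Re c ^ (m - 1)) ^ (k - 1)"
  have cr: "c = of_real (Re c)" using c(1) by (simp add: complex_eq_iff)
  have Rc: "Re c \<noteq> 0" using c by (auto simp: complex_eq_iff)
  have U0: "U $$ (0, 0) = of_real r" unfolding U(4) r_def by (subst cr) simp
  have r: "r \<noteq> 0" using Rc m by (simp add: r_def)
  have cm: "Im (c ^ m) = 0" by (subst cr) (simp flip: of_real_power)
  define s :: int where "s = (if r > 0 then 1 else -1)"
  have cc: "cnj c = c" using c(1) by (simp add: complex_eq_iff)
  have QJ: "Qmat k * J k c ^\<^sub>m m = adj (J k c ^\<^sub>m m) * Qmat k"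
    by (rule mat_power_intertwine[of _ k]) (auto simp: Qmat_jordan_block cc carrier_matI)
  have "pair_cong (J k c ^\<^sub>m m) (of_int e \<cdot>\<^sub>m Qmat k)
      (canon_M [(c ^ m, k, e * s)]) (canon_N [(c ^ m, k, e * s)])" if e: "e = 1 \<or> e = -1" for e :: int
  proof -
    define K where "K = adj U * (of_int e \<cdot>\<^sub>m Qmat k) * U"
    have K: "K \<in> sq_mats k" using U by (intro carrier_matI) (auto simp: K_def)
    have K0: "K $$ (0, k - 1) = of_int e * of_real r"
    proof -
      have "K = of_int e \<cdot>\<^sub>m (adj U * Qmat k * U)"
        by (simp add: K_def mat_ring dU)
      then show ?thesis using k gram_Qmat_corner[OF U(1) U(1) k U(3)] U0 U(5) dU
        by simp
    qed
    have "adj K = K"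
      by (simp add: K_def mat_adjoint_mult dU mat_ring mat_adjoint_smult)
    moreover have "K * J k (c ^ m) = adj (J k (c ^ m)) * K"
    proof -
      have "K * J k (c ^ m) = of_int e \<cdot>\<^sub>m (adj U * (Qmat k * (U * J k (c ^ m))))"
        by (simp add: K_def dU mat_ring)
      also have "\<dots> = of_int e \<cdot>\<^sub>m (adj (J k c ^\<^sub>m m * U) * Qmat k * U)"
        unfolding U(2)[symmetric] by (simp add: dU mat_ring mat_rewrite[OF QJ] mat_adjoint_mult)
      also have "\<dots> = adj (J k (c ^ m)) * K"
        unfolding U(2) by (simp add: K_def dU mat_ring mat_adjoint_mult)
      finally show ?thesis .
    qed
    moreover have "K $$ (0, k - 1) \<noteq> 0" using K0 r e by auto
    ultimately obtain W where W: "W \<in> sq_mats k"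
      "J k (c ^ m) * W = W * J k (c ^ m)"
      "adj W * K * W = of_int (if Re (K $$ (0, k - 1)) > 0 then 1 else -1) \<cdot>\<^sub>m Qmat k"
      using intertwiner_normalise_real[OF K k _ _ cm] by blast
    have dW: "dim_row W = k" "dim_col W = k" using W by auto
    have es: "(if Re (K $$ (0, k - 1)) > 0 then 1 else -1) = e * s"
      unfolding K0 using e r by (auto simp: s_def)
    show ?thesis
    proof (rule pair_congI[of _ k _ _ _ "U * W"])
      show "J k c ^\<^sub>m m * (U * W) = U * W * canon_M [(c ^ m, k, e * s)]"
        using cm by (simp add: canon_single dU dW mat_ring mat_rewrite[OF U(2)] W(2))
      have "adj (U * W) * (of_int e \<cdot>\<^sub>m Qmat k) * (U * W) = adj W * K * W"
        by (simp add: K_def dU dW mat_ring mat_adjoint_mult)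
      then show "adj (U * W) * (of_int e \<cdot>\<^sub>m Qmat k) * (U * W) = canon_N [(c ^ m, k, e * s)]"
        using cm W(3) es by (simp add: canon_single)
      have "canon_data [(c ^ m, k, e * s)]" using cm k e by (auto simp: canon_data_def s_def)
      from canon_N_square[OF this]
      show "canon_N [(c ^ m, k, e * s)] * canon_N [(c ^ m, k, e * s)] = 1\<^sub>m k"
        using cm by (simp add: canon_single)
    qed (use U W cm in \<open>auto simp: canon_single intro!: carrier_matI\<close>)
  qed
  then show ?thesis by (intro exI[of _ s]) (auto simp: s_def)
qed

text \<open>Each half of the pair is isotropic, so only the off-diagonal Gram block has to be
  normalised; this is done by correcting the second chain alone.\<close>

lemma pair_cong_power_pair:
  assumes c: "c \<noteq> 0" and k: "k > 0" and m: "m > 0"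
  shows "pair_cong (dsum (J k c) (J k (cnj c)) ^\<^sub>m m) (Qmat (2 * k))
    (dsum (J k (c ^ m)) (J k (cnj (c ^ m)))) (Qmat (2 * k))"
proof -
  from jordan_block_power_similar[OF k, of c m] obtain U where U: "U \<in> sq_mats k"
    "J k c ^\<^sub>m m * U = U * J k (c ^ m)"
    "\<And>i. 0 < i \<Longrightarrow> i < k \<Longrightarrow> U $$ (i, 0) = 0"
    "U $$ (0, 0) = (of_nat m * c ^ (m - 1)) ^ (k - 1)" "U $$ (k - 1, k - 1) = 1" by blast
  from jordan_block_power_similar[OF k, of "cnj c" m] obtain V where V: "V \<in> sq_mats k"
    "J k (cnj c) ^\<^sub>m m * V = V * J k (cnj c ^ m)"
    "V $$ (k - 1, k - 1) = 1" by blast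
  note V2 = V(2)[folded complex_cnj_power]
  have dU: "dim_row U = k" "dim_col U = k" "dim_row V = k" "dim_col V = k" using U V by auto
  have QJ: "Qmat k * J k (cnj c) ^\<^sub>m m = adj (J k c ^\<^sub>m m) * Qmat k"
    by (rule mat_power_intertwine[of _ k]) (auto simp: Qmat_jordan_block carrier_matI)
  define K where "K = adj U * Qmat k * V"
  have K: "K \<in> sq_mats k" using dU by (intro carrier_matI) (auto simp: K_def)
  have "K $$ (0, k - 1) \<noteq> 0"
  proof -
    have "K $$ (0, k - 1) = cnj (U $$ (0, 0)) * V $$ (k - 1, k - 1)"
      unfolding K_def by (rule gram_Qmat_corner[OF U(1) V(1) k]) (rule U(3))
    then show ?thesis unfolding U(4) V(3) using c m by auto
  qed
  moreover have "K * J k (cnj (c ^ m)) = adj (J k (c ^ m)) * K"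
  proof -
    have "K * J k (cnj (c ^ m)) = adj U * (Qmat k * (V * J k (cnj (c ^ m))))"
      by (simp add: K_def dU mat_ring)
    also have "\<dots> = adj (J k c ^\<^sub>m m * U) * Qmat k * V"
      unfolding V2[symmetric] by (simp add: dU mat_ring mat_rewrite[OF QJ] mat_adjoint_mult)
    also have "\<dots> = adj (J k (c ^ m)) * K"
      unfolding U(2) by (simp add: K_def dU mat_ring mat_adjoint_mult)
    finally show ?thesis .
  qed
  ultimately obtain W where W: "W \<in> sq_mats k"
    "J k (cnj (c ^ m)) * W = W * J k (cnj (c ^ m))" "K * W = Qmat k"
    using intertwiner_normalise_pair[OF K k] by blast
  have dW: "dim_row W = k" "dim_col W = k" using W by auto
  have 1: "adj U * (Qmat k * (V * W)) = Qmat k"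
    using W(3) by (simp add: K_def dU dW mat_ring)
  have "adj (adj U * (Qmat k * (V * W))) = Qmat k" unfolding 1 by simp
  then have 2: "adj (V * W) * (Qmat k * U) = Qmat k"
    by (simp add: mat_adjoint_mult dU dW mat_ring)
  let ?T = "dsum U (V * W)"
  show ?thesis
  proof (rule pair_congI[of _ "2 * k" _ _ _ ?T])
    show "dsum (J k c) (J k (cnj c)) ^\<^sub>m m * ?T =
        ?T * dsum (J k (c ^ m)) (J k (cnj (c ^ m)))"
      by (simp add: dsum_power dsum_mult dU dW U(2) mat_ring mat_rewrite[OF V2] W(2)
          del: complex_cnj_power)
    show "adj ?T * Qmat (2 * k) * ?T = Qmat (2 * k)"
      by (simp add: Qmat_double dsum_four_block adjoint_four_block four_block_mult mat_ring dU dW 1 2)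
    show "Qmat (2 * k) * Qmat (2 * k) = 1\<^sub>m (2 * k)" by (rule Qmat_square)
  qed (auto simp: dU dW mult_2 intro!: carrier_matI)
qed

lemma pair_cong_swap_conj:
  "pair_cong (dsum (J k c) (J k c')) (Qmat (2 * k))
    (dsum (J k c') (J k c)) (Qmat (2 * k))"
proof (rule pair_congI[of _ "2 * k" _ _ _ "four_block_mat (0\<^sub>m k k) (1\<^sub>m k) (1\<^sub>m k) (0\<^sub>m k k)"])
  show "Qmat (2 * k) * Qmat (2 * k) = 1\<^sub>m (2 * k)" by (rule Qmat_square)
qed (auto simp: mult_2 Qmat_double[unfolded mult_2] adjoint_four_block dsum_four_block four_block_mult mat_ring intro!: carrier_matI)

text \<open>Two equal blocks paired by the flip form a hyperbolic plane with off-diagonal entries e.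
  The vectors (1, e) and (1, -e), divided by sqrt 2, are orthogonal with values 1 and -1, and scalar
  mixtures of equal blocks commute with the operator.\<close>

lemma pair_cong_split_real:
  assumes l: "Im l = 0" and k: "k > 0" and e: "e = 1 \<or> e = (-1 :: int)"
  shows "pair_cong (dsum (J k l) (J k l)) (of_int e \<cdot>\<^sub>m Qmat (2 * k))
    (canon_M [(l, k, 1), (l, k, -1)]) (canon_N [(l, k, 1), (l, k, -1)])"
proof -
  let ?h = "complex_of_real (1 / sqrt 2)"
  have h: "?h * ?h = 1 / 2" unfolding of_real_mult[symmetric] by simp
  define T where "T = four_block_mat (?h \<cdot>\<^sub>m 1\<^sub>m k) (?h \<cdot>\<^sub>m 1\<^sub>m k)
    ((of_int e * ?h) \<cdot>\<^sub>m 1\<^sub>m k) ((- of_int e * ?h) \<cdot>\<^sub>m 1\<^sub>m k)"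
  have cM: "canon_M [(l, k, 1), (l, k, -1)] = dsum (J k l) (J k l)"
    and cN: "canon_N [(l, k, 1), (l, k, -1)] = dsum (Qmat k) ((-1) \<cdot>\<^sub>m Qmat k)"
    using l by (auto simp: canon_Cons[of _ "[_]"] canon_single)
  have add: "a \<cdot>\<^sub>m A + b \<cdot>\<^sub>m A = (a + b) \<cdot>\<^sub>m A" for a b :: complex and A
    by (intro eq_matI) (auto simp: algebra_simps)
  have zero: "0 \<cdot>\<^sub>m Qmat k = 0\<^sub>m k k" by (intro eq_matI) auto
  have sm: "a \<cdot>\<^sub>m four_block_mat (0\<^sub>m k k) (Qmat k) (Qmat k) (0\<^sub>m k k) =
      four_block_mat (0\<^sub>m k k) (a \<cdot>\<^sub>m Qmat k) (a \<cdot>\<^sub>m Qmat k) (0\<^sub>m k k)" for a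
    by (intro eq_matI) auto
  show ?thesis
  proof (rule pair_congI[of _ "2 * k" _ _ _ T])
    show "dsum (J k l) (J k l) * T = T * canon_M [(l, k, 1), (l, k, -1)]"
      by (simp add: cM T_def dsum_four_block four_block_mult mat_ring)
    show "adj T * (of_int e \<cdot>\<^sub>m Qmat (2 * k)) * T = canon_N [(l, k, 1), (l, k, -1)]"
      using e h by (auto simp: cN T_def dsum_four_block Qmat_double sm four_block_mult mat_ring
          adjoint_four_block mat_adjoint_smult smult_smult_mat add zero)
    show "canon_N [(l, k, 1), (l, k, -1)] * canon_N [(l, k, 1), (l, k, -1)] = 1\<^sub>m (2 * k)"
      by (simp add: cN dsum_mult mat_ring Qmat_square smult_smult_mat dsum_one mult_2)
  qed (auto simp: T_def cM cN mult_2 intro!: carrier_matI)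
qed

section \<open>Powers of nilpotent blocks\<close>

text \<open>An orbit of the shift by m; along it J_k(0)^m acts as one nilpotent Jordan
  block.\<close>

definition residue_chain :: "nat \<Rightarrow> nat \<Rightarrow> nat \<Rightarrow> nat list" where
  "residue_chain m L c = map (\<lambda>q. c + q * m) [0..<L]"

definition residue_chains :: "nat \<Rightarrow> nat \<Rightarrow> nat \<Rightarrow> nat \<Rightarrow> nat list" where
  "residue_chains m L lo hi = concat (map (residue_chain m L) [lo..<hi])"

text \<open>\<open>shift_entry\<close> gives the entries of J_k(0)^m and \<open>flip_entry\<close>
  those of a signed flip, as functions of two indices, so that \<open>list_mat\<close> can rearrange
  the basis.\<close>

definition shift_entry :: "nat \<Rightarrow> nat \<Rightarrow> nat \<Rightarrow> complex" where
  "shift_entry m i j = (if j = i + m then 1 else 0)"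

definition flip_entry :: "int \<Rightarrow> nat \<Rightarrow> nat \<Rightarrow> nat \<Rightarrow> complex" where
  "flip_entry e k i j = (if i + j + 1 = k then of_int e else 0)"

lemma length_residue_chain [simp]: "length (residue_chain m L c) = L"
  by (simp add: residue_chain_def)

lemma nth_residue_chain [simp]: "q < L \<Longrightarrow> residue_chain m L c ! q = c + q * m"
  by (simp add: residue_chain_def)

lemma set_residue_chain: "x \<in> set (residue_chain m L c) \<longleftrightarrow> (\<exists>q<L. x = c + q * m)"
  by (auto simp: residue_chain_def)

lemma set_residue_chains:
  "x \<in> set (residue_chains m L lo hi) \<longleftrightarrow> (\<exists>c q. lo \<le> c \<and> c < hi \<and> q < L \<and> x = c + q * m)"
  by (auto simp: residue_chains_def set_residue_chain)

lemma residue_unique: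
  fixes c c' :: nat
  assumes "c + q * m = c' + q' * m" "c < m" "c' < m"
  shows "c = c'"
proof -
  have "(c + q * m) mod m = (c' + q' * m) mod m" using assms(1) by simp
  then have "c mod m = c' mod m" by (simp only: mod_mult_self1)
  then show ?thesis using assms(2,3) by simp
qed

lemma shift_entry_zero:
  assumes "c < m" "c' < m" "c \<noteq> c'"
  shows "shift_entry m (c + q * m) (c' + q' * m) = 0"
  using residue_unique[of c' q' m c "Suc q"] assms by (auto simp: shift_entry_def)

text \<open>The numerical hypothesis says b + (c + (L-1)*m) = k - 1: the flip i -> k-1-i carries the
  residue chain of b onto that of c. No other residue c' can then be paired with b.\<close>

lemma flip_entry_zero:
  assumes "b + c + L * m = k + m - 1" "L > 0" "b < m" "c < m" "c' < m" "c \<noteq> c'" "k > 0"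
  shows "flip_entry e k (b + q * m) (c' + q' * m) = 0" "flip_entry e k (c' + q' * m) (b + q * m) = 0"
proof -
  have "(b + q * m) + (c' + q' * m) + 1 \<noteq> k"
  proof
    assume a: "(b + q * m) + (c' + q' * m) + 1 = k"
    obtain L' where L: "L = Suc L'" using assms by (cases L) auto
    have "b + c + L' * m + 1 = k" using assms(1,7) L by simp
    then have "c' + (q + q') * m = c + L' * m" using a by (simp add: algebra_simps)
    from residue_unique[OF this] show False using assms by simp
  qed
  then show "flip_entry e k (b + q * m) (c' + q' * m) = 0" "flip_entry e k (c' + q' * m) (b + q * m) = 0"
    by (auto simp: flip_entry_def)
qed

lemma shift_residue_chain:
  assumes "m > 0"
  shows "list_mat (residue_chain m L c) (shift_entry m) = J L 0"
proof (intro eq_matI)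
  fix i j assume "i < dim_row (J L (0 :: complex))" "j < dim_col (J L (0 :: complex))"
  then have ij: "i < L" "j < L" by auto
  have "c + j * m = c + i * m + m \<longleftrightarrow> j * m = Suc i * m" by auto
  also have "\<dots> \<longleftrightarrow> j = Suc i" using assms by (simp only: mult_cancel2) simp
  finally show "list_mat (residue_chain m L c) (shift_entry m) $$ (i, j) = J L 0 $$ (i, j)"
    using ij by (auto simp: shift_entry_def)
qed auto

lemma flip_residue_iff:
  fixes b c L m k q q' :: nat
  assumes "b + c + L * m = k + m - 1" "L > 0" "m > 0" "k > 0"
  shows "(b + q * m) + (c + q' * m) + 1 = k \<longleftrightarrow> q + q' = L - 1"
proof -
  obtain L' where L: "L = Suc L'" using assms by (cases L) auto
  have k: "k = b + c + L' * m + 1" using assms(1,4) L by simp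
  have "(b + q * m) + (c + q' * m) + 1 = k \<longleftrightarrow> (q + q') * m = L' * m"
    unfolding k by (simp add: algebra_simps)
  also have "\<dots> \<longleftrightarrow> q + q' = L'" using assms by (simp only: mult_cancel2) simp
  finally show ?thesis using L by simp
qed

lemma flip_residue_chain:
  assumes "c + c + L * m = k + m - 1" "L > 0" "m > 0" "k > 0"
  shows "list_mat (residue_chain m L c) (flip_entry e k) = of_int e \<cdot>\<^sub>m Qmat L"
  using flip_residue_iff[OF assms] by (intro eq_matI) (auto simp: flip_entry_def)

lemma flip_residue_chain_pair:
  assumes "b + c + L * m = k + m - 1" "L > 0" "b < m" "c < m" "b \<noteq> c" "k > 0"
  shows "list_mat (residue_chain m L b @ residue_chain m L c) (flip_entry e k) =
    of_int e \<cdot>\<^sub>m Qmat (2 * L)"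
proof -
  have m: "m > 0" using assms by simp
  have bc: "c + b + L * m = k + m - 1" using assms by simp
  have 1: "flip_entry e k (b + q * m) (b + q' * m) = 0" for q q'
    using flip_entry_zero(1)[OF assms(1,2,3,4,3) _ assms(6)] assms by auto
  have 2: "flip_entry e k (c + q * m) (c + q' * m) = 0" for q q'
    using flip_entry_zero(1)[OF bc assms(2,4,3,4) _ assms(6)] assms by auto
  have 3: "flip_entry e k (b + q * m) (c + q' * m) = (if q + q' = L - 1 then of_int e else 0)" for q q'
    using flip_residue_iff[OF assms(1,2) m assms(6)] by (simp add: flip_entry_def)
  have 4: "flip_entry e k (c + q * m) (b + q' * m) = (if q + q' = L - 1 then of_int e else 0)" for q q'
    using flip_residue_iff[OF bc assms(2) m assms(6)] by (simp add: flip_entry_def)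
  show ?thesis unfolding Qmat_double
    by (intro eq_matI) (auto simp: nth_append 1 2 3 4 mult_2)
qed

lemma residue_chains_peel:
  assumes "Suc lo < hi"
  shows "mset (residue_chains m L lo hi) =
    mset ((residue_chain m L lo @ residue_chain m L (hi - 1)) @ residue_chains m L (Suc lo) (hi - 1))"
proof -
  obtain h where h: "hi = Suc h" using assms by (cases hi) auto
  have "[lo..<hi] = lo # [Suc lo..<h] @ [h]" using assms h
    by (simp add: upt_conv_Cons)
  then show ?thesis by (simp add: residue_chains_def h)
qed

text \<open>Balance with at least two entries forces both signs to occur; deleting one of each
  preserves the difference of the counts and the parity of the length.\<close>

lemma sign_balanced_peel:
  assumes "sign_balanced e es" "set es \<subseteq> {1, -1}" "e = 1 \<or> e = -1" "length es \<ge> 2"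
  obtains es' where "mset es = {#1, -1#} + mset es'" "sign_balanced e es'" "set es' \<subseteq> {1, -1}"
    "length es' = length es - 2"
proof -
  have len: "length es = count_list es e + count_list es (-e)"
    using assms(2)
  proof (induction es)
    case (Cons a es)
    then show ?case using assms(3) by auto
  qed simp
  have bal: "int (count_list es e) - int (count_list es (- e)) = (if even (length es) then 0 else 1)"
    using assms(1) by (simp add: sign_balanced_def)
  have ce: "count_list es e \<ge> 1" "count_list es (-e) \<ge> 1"
    using len bal assms(4) by (auto split: if_splits)
  then have in1: "e \<in> set es" "-e \<in> set es" by (metis count_list_0_iff not_one_le_zero)+
  have ne: "e \<noteq> -e" using assms(3) by auto
  define es' where "es' = remove1 (-e) (remove1 e es)"
  have me: "-e \<in> set (remove1 e es)" using in1 ne by (simp add: in_set_remove1)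
  have ms: "mset es = {#e, -e#} + mset es'"
  proof -
    have "mset es = add_mset e (mset (remove1 e es))" using in1 by simp
    also have "mset (remove1 e es) = add_mset (-e) (mset es')"
      unfolding es'_def using me by (metis insert_DiffM mset_remove1 set_mset_mset)
    finally show ?thesis by simp
  qed
  have ms1: "mset es = {#1, -1#} + mset es'" using ms assms(3) by auto
  have cl: "count_list es x = count (mset es) x" for x :: int and es
    by (induction es) auto
  have len': "length es = 2 + length es'" using arg_cong[OF ms, of size] by simp
  have "count_list es e = Suc (count_list es' e)" "count_list es (-e) = Suc (count_list es' (-e))"
    using ne by (simp_all add: cl ms)
  then have "sign_balanced e es'" using bal len' by (simp add: sign_balanced_def)
  moreover have "set es' \<subseteq> {1, -1}"
    using assms(2) unfolding es'_def by (meson notin_set_remove1 set_remove1_subset subset_trans)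
  ultimately show thesis using that[OF ms1] len' by simp
qed

text \<open>The condition lo + hi + L*m = k + m says that the flip reverses the interval of
  residues, and it survives removal of both ends. Each outer pair yields the signs 1 and -1; a
  single remaining residue is fixed by the flip and inherits e. This is the balance rule.\<close>

lemma pair_cong_residue_chains:
  assumes "lo \<le> hi" "hi \<le> m" "lo + hi + L * m = k + m" "L > 0" "k > 0"
    "sign_balanced e es" "set es \<subseteq> {1, -1}" "e = 1 \<or> e = -1" "length es = hi - lo"
  shows "pair_cong (list_mat (residue_chains m L lo hi) (shift_entry m))
    (list_mat (residue_chains m L lo hi) (flip_entry e k))
    (canon_M (map (\<lambda>s. (0, L, s)) es)) (canon_N (map (\<lambda>s. (0, L, s)) es))"
  using assms
proof (induction "hi - lo" arbitrary: lo hi es rule: less_induct)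
  case less
  consider "hi = lo" | "hi = Suc lo" | "Suc lo < hi" using less.prems(1) by linarith
  then show ?case
  proof cases
    case 1
    then have "es = []" using less.prems by simp
    moreover have "list_mat [] f = 0\<^sub>m 0 0" for f :: "nat \<Rightarrow> nat \<Rightarrow> complex" by (intro eq_matI) auto
    ultimately show ?thesis using 1
      by (auto simp: residue_chains_def intro!: pair_cong_refl[of _ 0])
  next
    case 2
    then obtain s where s: "es = [s]" using less.prems(9) by (cases es) auto
    have "s = e" using less.prems(6-8) by (auto simp: s sign_balanced_def)
    moreover have "residue_chains m L lo hi = residue_chain m L lo"
      by (simp add: residue_chains_def 2)
    moreover have "m > 0" using 2 less.prems by simp
    moreover have "list_mat (residue_chain m L lo) (flip_entry e k) = of_int e \<cdot>\<^sub>m Qmat L"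
      by (rule flip_residue_chain) (use less.prems 2 in auto)
    ultimately show ?thesis
      by (simp add: s canon_single shift_residue_chain pair_cong_refl[of _ L] carrier_matI)
  next
    case 3
    define c1 where "c1 = hi - 1"
    have m: "m > 0" using 3 less.prems by simp
    have c: "lo < m" "c1 < m" "lo \<noteq> c1" using 3 less.prems by (auto simp: c1_def)
    have bc: "lo + c1 + L * m = k + m - 1" using less.prems 3 by (simp add: c1_def)
    have cb: "c1 + lo + L * m = k + m - 1" using bc by simp
    have "length es \<ge> 2" using less.prems(9) 3 by simp
    from sign_balanced_peel[OF less.prems(6-8) this]
    obtain es' where es': "mset es = {#1, -1#} + mset es'" "sign_balanced e es'" "set es' \<subseteq> {1, -1}"
      "length es' = length es - 2" .
    let ?A = "residue_chain m L lo @ residue_chain m L c1"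
    let ?B = "residue_chains m L (Suc lo) c1"
    have IH: "pair_cong (list_mat ?B (shift_entry m)) (list_mat ?B (flip_entry e k))
        (canon_M (map (\<lambda>s. (0, L, s)) es')) (canon_N (map (\<lambda>s. (0, L, s)) es'))"
      by (rule less.hyps) (use less.prems 3 es' in \<open>auto simp: c1_def\<close>)
    \<comment> \<open>The shift preserves residues and the flip pairs \<open>lo\<close> with
      \<open>c1\<close> only, so the inner residues split off.\<close>
    have cross: "shift_entry m x y = 0 \<and> shift_entry m y x = 0"
      "flip_entry e k x y = 0 \<and> flip_entry e k y x = 0" if "x \<in> set ?A" "y \<in> set ?B" for x y
    proof -
      from that(2) obtain d q where d: "Suc lo \<le> d" "d < c1" "y = d + q * m"
        by (auto simp: set_residue_chains)
      from that(1) obtain q' where x: "x = lo + q' * m \<or> x = c1 + q' * m"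
        by (auto simp: set_residue_chain)
      have dm: "d < m" "d \<noteq> lo" "d \<noteq> c1" using d c by auto
      show "shift_entry m x y = 0 \<and> shift_entry m y x = 0"
        using x c dm d by (auto simp: shift_entry_zero)
      show "flip_entry e k x y = 0 \<and> flip_entry e k y x = 0"
        using x flip_entry_zero[OF bc less.prems(4) c(1,2) dm(1) _ less.prems(5)]
          flip_entry_zero[OF cb less.prems(4) c(2,1) dm(1) _ less.prems(5)] dm d by auto
    qed
    have AS: "list_mat ?A (shift_entry m) = dsum (J L 0) (J L 0)"
    proof -
      have "list_mat ?A (shift_entry m) = dsum (list_mat (residue_chain m L lo) (shift_entry m))
          (list_mat (residue_chain m L c1) (shift_entry m))"
        by (rule list_mat_append) (use c in \<open>auto simp: set_residue_chain shift_entry_zero\<close>)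
      then show ?thesis using m by (simp add: shift_residue_chain)
    qed
    have AF: "list_mat ?A (flip_entry e k) = of_int e \<cdot>\<^sub>m Qmat (2 * L)"
      by (rule flip_residue_chain_pair[OF bc less.prems(4) c less.prems(5)])
    have A: "pair_cong (list_mat ?A (shift_entry m)) (list_mat ?A (flip_entry e k))
        (canon_M [(0, L, 1), (0, L, -1)]) (canon_N [(0, L, 1), (0, L, -1)])"
      unfolding AS AF by (rule pair_cong_split_real) (use less.prems in auto)
    have s1: "pair_cong (list_mat (residue_chains m L lo hi) (shift_entry m))
        (list_mat (residue_chains m L lo hi) (flip_entry e k))
        (list_mat (?A @ ?B) (shift_entry m)) (list_mat (?A @ ?B) (flip_entry e k))"
      by (rule pair_cong_reindex[OF residue_chains_peel[OF 3, folded c1_def]])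
    have s2: "pair_cong (list_mat (?A @ ?B) (shift_entry m)) (list_mat (?A @ ?B) (flip_entry e k))
        (canon_M ([(0, L, 1), (0, L, -1)] @ map (\<lambda>s. (0, L, s)) es'))
        (canon_N ([(0, L, 1), (0, L, -1)] @ map (\<lambda>s. (0, L, s)) es'))"
    proof -
      have "list_mat (?A @ ?B) (shift_entry m) =
          dsum (list_mat ?A (shift_entry m)) (list_mat ?B (shift_entry m))"
        by (rule list_mat_append) (rule cross(1))
      moreover have "list_mat (?A @ ?B) (flip_entry e k) =
          dsum (list_mat ?A (flip_entry e k)) (list_mat ?B (flip_entry e k))"
        by (rule list_mat_append) (rule cross(2))
      ultimately show ?thesis unfolding canon_append by (simp only: pair_cong_dsum[OF A IH])
    qed
    have "mset ([(0, L, 1), (0, L, -1)] @ map (\<lambda>s. (0, L, s)) es') =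
        image_mset (\<lambda>s. (0 :: complex, L, s)) ({#1, -1#} + mset es')" by simp
    also have "\<dots> = mset (map (\<lambda>s. (0, L, s)) es)" unfolding es'(1)[symmetric] by simp
    finally show ?thesis
      using pair_cong_trans[OF pair_cong_trans[OF s1 s2] pair_cong_canon_mset] by blast
  qed
qed

lemma jordan_block_zero_power:
  "J k 0 ^\<^sub>m m = list_mat [0..<k] (shift_entry m)"
proof (intro eq_matI)
  fix i j assume "i < dim_row (list_mat [0..<k] (shift_entry m))"
    "j < dim_col (list_mat [0..<k] (shift_entry m))"
  then have ij: "i < k" "j < k" by auto
  \<comment> \<open>The power formula multiplies a binomial coefficient by 0 to a truncated
    exponent. Below distance m the power of 0 vanishes, beyond it the binomial coefficient does, and
    at distance m the factor 0^0 = 1 remains.\<close>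
  have "(m choose (j - i)) * 0 ^ (m + i - j) = (if j = i + m then 1 else 0 :: nat)" if "i \<le> j"
  proof -
    consider "j - i < m" | "j - i = m" | "j - i > m" by linarith
    then show ?thesis using that by cases auto
  qed
  from arg_cong[OF this, of complex_of_nat]
  show "(J k 0 ^\<^sub>m m) $$ (i, j) = list_mat [0..<k] (shift_entry m) $$ (i, j)"
    using ij unfolding jordan_block_pow by (auto simp: shift_entry_def)
qed auto

lemma distinct_residue_chains: "hi \<le> m \<Longrightarrow> distinct (residue_chains m L lo hi)"
proof (induction hi)
  case (Suc hi)
  show ?case
  proof (cases "lo \<le> hi")
    case True
    then have eq: "residue_chains m L lo (Suc hi) = residue_chains m L lo hi @ residue_chain m L hi"
      by (simp add: residue_chains_def)
    have "distinct (residue_chain m L hi)"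
      using Suc.prems by (auto simp: residue_chain_def distinct_map inj_on_def)
    moreover have "set (residue_chains m L lo hi) \<inter> set (residue_chain m L hi) = {}"
      using Suc.prems residue_unique by (fastforce simp: set_residue_chain set_residue_chains)
    ultimately show ?thesis using Suc by (simp add: eq)
  next
    case False
    then show ?thesis by (simp add: residue_chains_def)
  qed
qed (simp add: residue_chains_def)

text \<open>By division with remainder, a residue smaller than r has a + 1 representatives below a*m
  + r and any other has a. Both lists are free of repetitions, so equality of the underlying sets is
  enough.\<close>

lemma residues_partition:
  fixes a m r :: nat
  assumes r: "0 < r" "r \<le> m"
  shows "mset [0..<a * m + r] = mset (residue_chains m (Suc a) 0 r @ residue_chains m a r m)"
proof -
  have "set (residue_chains m (Suc a) 0 r) \<inter> set (residue_chains m a r m) = {}"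
  proof -
    have False if "c < r" "r \<le> c'" "c' < m" "c + q * m = c' + q' * m" for c c' q q'
      using residue_unique[OF that(4)] that r by simp
    then show ?thesis by (fastforce simp: set_residue_chains)
  qed
  then have d: "distinct (residue_chains m (Suc a) 0 r @ residue_chains m a r m)"
    using distinct_residue_chains[of r m] distinct_residue_chains[of m m] r by simp
  have key: "x < a * m + r \<longleftrightarrow> x \<in> set (residue_chains m (Suc a) 0 r) \<union> set (residue_chains m a r m)" for x
  proof
    assume x: "x < a * m + r"
    have xd: "x = x mod m + x div m * m" by simp
    have xm: "x mod m < m" using r by simp
    show "x \<in> set (residue_chains m (Suc a) 0 r) \<union> set (residue_chains m a r m)"
    proof (cases "x mod m < r")
      case True
      have "x div m < Suc a"
      proof (rule ccontr)
        assume "\<not> x div m < Suc a"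
        then have "Suc a * m \<le> x div m * m" by (intro mult_le_mono1) simp
        then show False using x r xd by simp
      qed
      then have "\<exists>c q. 0 \<le> c \<and> c < r \<and> q < Suc a \<and> x = c + q * m"
        using True xd by (intro exI[of _ "x mod m"] exI[of _ "x div m"]) simp
      then show ?thesis unfolding Un_iff set_residue_chains by blast
    next
      case False
      have "x div m < a"
      proof (rule ccontr)
        assume "\<not> x div m < a"
        then have "a * m \<le> x div m * m" by (intro mult_le_mono1) simp
        then show False using x xd False by linarith
      qed
      then have "\<exists>c q. r \<le> c \<and> c < m \<and> q < a \<and> x = c + q * m"
        using False xd xm by (intro exI[of _ "x mod m"] exI[of _ "x div m"]) simp
      then show ?thesis by (auto simp: set_residue_chains)
    qed
  next
    assume "x \<in> set (residue_chains m (Suc a) 0 r) \<union> set (residue_chains m a r m)"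
    then consider c q where "c < r" "q < Suc a" "x = c + q * m"
      | c q where "c < m" "q < a" "x = c + q * m"
      by (auto simp: set_residue_chains)
    then show "x < a * m + r"
    proof cases
      case 1
      then have "q * m \<le> a * m" by (intro mult_le_mono1) simp
      then show ?thesis using 1 by linarith
    next
      case 2
      then have "Suc q * m \<le> a * m" by (intro mult_le_mono1) simp
      then show ?thesis using 2 by simp
    qed
  qed
  have "set [0..<a * m + r] = set (residue_chains m (Suc a) 0 r @ residue_chains m a r m)"
    by (intro Set.set_eqI) (simp only: set_append key[symmetric] set_upt atLeastLessThan_iff, simp)
  then show ?thesis using d set_eq_iff_mset_eq_distinct distinct_upt by blast
qed

text \<open>The flip reverses both the residues below r and those from r on: 0 + r + (a+1)*m and r +
  m + a*m both equal (a*m + r) + m. Both halves thus inherit the same sign \<open>e\<close>.\<close>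

lemma pair_cong_power_zero:
  fixes a m r :: nat
  assumes r: "0 < r" "r \<le> m" and e: "e = 1 \<or> e = -1"
    and es1: "sign_balanced e es1" "set es1 \<subseteq> {1, -1}" "length es1 = r"
    and es2: "sign_balanced e es2" "set es2 \<subseteq> {1, -1}" "length es2 = m - r"
  defines "D \<equiv> map (\<lambda>s. (0 :: complex, a + 1, s)) es1 @
    filter (\<lambda>(_, k, _). k \<noteq> 0) (map (\<lambda>s. (0, a, s)) es2)"
  shows "pair_cong (J (a * m + r) 0 ^\<^sub>m m) (of_int e \<cdot>\<^sub>m Qmat (a * m + r)) (canon_M D) (canon_N D)"
proof -
  let ?k = "a * m + r"
  have k: "?k > 0" using r by simp
  let ?A = "residue_chains m (Suc a) 0 r" and ?B = "residue_chains m a r m"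
  have Q: "of_int e \<cdot>\<^sub>m Qmat ?k = list_mat [0..<?k] (flip_entry e ?k)"
    using k by (intro eq_matI) (auto simp: flip_entry_def)
  have A: "pair_cong (list_mat ?A (shift_entry m)) (list_mat ?A (flip_entry e ?k))
      (canon_M (map (\<lambda>s. (0, Suc a, s)) es1)) (canon_N (map (\<lambda>s. (0, Suc a, s)) es1))"
    by (rule pair_cong_residue_chains) (use r e es1 in auto)
  define D2 where "D2 = filter (\<lambda>(_, k, _). k \<noteq> 0) (map (\<lambda>s. (0 :: complex, a, s)) es2)"
  have B: "pair_cong (list_mat ?B (shift_entry m)) (list_mat ?B (flip_entry e ?k))
      (canon_M D2) (canon_N D2)"
  \<comment> \<open>For a = 0 the residues from r on have no representative, which matches the
    absent blocks of size 0.\<close>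
  proof (cases "a = 0")
    case True
    have "?B = []" using True set_residue_chains[of _ m a r m] by (metis not_less_zero list.set_intros(1) neq_Nil_conv)
    moreover have "D2 = []" using True by (auto simp: D2_def filter_empty_conv)
    moreover have "list_mat [] f = 0\<^sub>m 0 0" for f :: "nat \<Rightarrow> nat \<Rightarrow> complex" by (intro eq_matI) auto
    ultimately show ?thesis by (auto intro!: pair_cong_refl[of _ 0])
  next
    case False
    then have "D2 = map (\<lambda>s. (0, a, s)) es2" by (auto simp: D2_def filter_id_conv)
    then show ?thesis using False
      by (simp only:) (rule pair_cong_residue_chains, use r e es2 k in auto)
  qed
  have cross: "shift_entry m x y = 0 \<and> shift_entry m y x = 0"
    "flip_entry e ?k x y = 0 \<and> flip_entry e ?k y x = 0" if "x \<in> set ?A" "y \<in> set ?B" for x y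
  proof -
    from that obtain c q c' q' where c: "c < r" "x = c + q * m" "r \<le> c'" "c' < m" "y = c' + q' * m"
      unfolding set_residue_chains by auto
    show "shift_entry m x y = 0 \<and> shift_entry m y x = 0"
      using c r by (auto simp: shift_entry_zero)
    \<comment> \<open>The residues c and c' add up to at least r and at most r + m - 2, so the sum
      is too large if q + q' is at least a and too small otherwise.\<close>
    have "x + y + 1 \<noteq> ?k"
    proof
      assume k: "x + y + 1 = ?k"
      have xy: "x + y = c + c' + (q + q') * m" using c by (simp add: algebra_simps)
      show False
      proof (cases "a \<le> q + q'")
        case True
        then have "a * m \<le> (q + q') * m" by (intro mult_le_mono1)
        then show False using k[unfolded xy] c(1,3) by linarith
      next
        case False
        then have "Suc (q + q') * m \<le> a * m" by (intro mult_le_mono1) simp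
        then have "m + (q + q') * m \<le> a * m" by (simp only: mult_Suc)
        then show False using k[unfolded xy] c(1,4) r by linarith
      qed
    qed
    then show "flip_entry e ?k x y = 0 \<and> flip_entry e ?k y x = 0"
      by (auto simp: flip_entry_def)
  qed
  have s1: "pair_cong (J ?k 0 ^\<^sub>m m) (of_int e \<cdot>\<^sub>m Qmat ?k)
      (list_mat (?A @ ?B) (shift_entry m)) (list_mat (?A @ ?B) (flip_entry e ?k))"
    unfolding jordan_block_zero_power Q by (rule pair_cong_reindex[OF residues_partition[OF r]])
  have D: "D = map (\<lambda>s. (0, Suc a, s)) es1 @ D2" by (simp add: D_def D2_def)
  have "pair_cong (list_mat (?A @ ?B) (shift_entry m)) (list_mat (?A @ ?B) (flip_entry e ?k))
      (canon_M D) (canon_N D)"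
  proof -
    have "list_mat (?A @ ?B) (shift_entry m) =
        dsum (list_mat ?A (shift_entry m)) (list_mat ?B (shift_entry m))"
      by (rule list_mat_append) (rule cross(1))
    moreover have "list_mat (?A @ ?B) (flip_entry e ?k) =
        dsum (list_mat ?A (flip_entry e ?k)) (list_mat ?B (flip_entry e ?k))"
      by (rule list_mat_append) (rule cross(2))
    ultimately show ?thesis unfolding D canon_append by (simp only: pair_cong_dsum[OF A B])
  qed
  then show ?thesis using pair_cong_trans[OF s1] by blast
qed

section \<open>Polynomials in a matrix, and quaternionic matrices\<close>

definition poly_mat :: "complex mat \<Rightarrow> complex poly \<Rightarrow> complex mat" where
  "poly_mat A p = fold_coeffs (\<lambda>c M. c \<cdot>\<^sub>m 1\<^sub>m (dim_row A) + A * M) p (0\<^sub>m (dim_row A) (dim_row A))"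

lemma poly_mat_0 [simp]: "poly_mat A 0 = 0\<^sub>m (dim_row A) (dim_row A)"
  by (simp add: poly_mat_def)

lemma smult_zero_mat [simp]: "0 \<cdot>\<^sub>m (1\<^sub>m d) = (0\<^sub>m d d :: complex mat)"
  by (intro eq_matI) auto

lemma poly_mat_pCons:
  assumes "dim_col A = dim_row A"
  shows "poly_mat A (pCons c p) = c \<cdot>\<^sub>m 1\<^sub>m (dim_row A) + A * poly_mat A p"
proof (cases "c = 0 \<and> p = 0")
  case True
  then show ?thesis using assms by (simp add: mat_ring)
next
  case False
  then show ?thesis by (auto simp: poly_mat_def)
qed

lemma dim_poly_mat [simp]:
  assumes "dim_col A = dim_row A"
  shows "dim_row (poly_mat A p) = dim_row A" "dim_col (poly_mat A p) = dim_row A"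
  using assms by (induction p) (auto simp: poly_mat_pCons)

lemma poly_mat_1 [simp]:
  assumes "dim_col A = dim_row A"
  shows "poly_mat A 1 = 1\<^sub>m (dim_row A)"
  using assms by (simp add: one_pCons poly_mat_pCons mat_ring)

lemma poly_mat_linear:
  assumes "dim_col A = dim_row A"
  shows "poly_mat A [:-l, 1:] = A - l \<cdot>\<^sub>m 1\<^sub>m (dim_row A)"
proof -
  have "poly_mat A [:-l, 1:] = (-l) \<cdot>\<^sub>m 1\<^sub>m (dim_row A) + A"
    using assms by (simp add: poly_mat_pCons mat_ring)
  also have "\<dots> = A - l \<cdot>\<^sub>m 1\<^sub>m (dim_row A)"
    using assms by (intro eq_matI) auto
  finally show ?thesis .
qed

lemma add_mat_4:
  fixes A B C D :: "complex mat"
  assumes "dim_row A = d" "dim_col A = d" "dim_row B = d" "dim_col B = d"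
    "dim_row C = d" "dim_col C = d" "dim_row D = d" "dim_col D = d"
  shows "(A + B) + (C + D) = (A + C) + (B + D)"
  using assms by (intro eq_matI) auto

lemma poly_mat_add:
  assumes "dim_col A = dim_row A"
  shows "poly_mat A (p + q) = poly_mat A p + poly_mat A q"
proof (induction p q rule: poly_induct2)
  case (pCons a p b q)
  have "(a + b) \<cdot>\<^sub>m 1\<^sub>m (dim_row A) = a \<cdot>\<^sub>m 1\<^sub>m (dim_row A) + b \<cdot>\<^sub>m 1\<^sub>m (dim_row A)"
    by (intro eq_matI) auto
  then show ?case using assms
    by (simp add: poly_mat_pCons pCons mat_ring add_mat_4[of _ "dim_row A"])
qed (use assms in \<open>simp add: mat_ring\<close>)

lemma poly_mat_smult:
  assumes "dim_col A = dim_row A"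
  shows "poly_mat A (Polynomial.smult c p) = c \<cdot>\<^sub>m poly_mat A p"
proof (induction p)
  case (pCons a p)
  have "c \<cdot>\<^sub>m (X + Y) = c \<cdot>\<^sub>m X + c \<cdot>\<^sub>m Y"
    if "dim_row X = dim_row Y" "dim_col X = dim_col Y" for X Y :: "complex mat"
    using that by (intro eq_matI) (auto simp: algebra_simps)
  then show ?case using assms
    by (simp add: poly_mat_pCons pCons mat_ring smult_smult_mat)
qed (use assms in \<open>auto intro!: eq_matI\<close>)

lemma poly_mat_mult:
  assumes "dim_col A = dim_row A"
  shows "poly_mat A (p * q) = poly_mat A p * poly_mat A q"
proof (induction p)
  case (pCons a p)
  then show ?case using assms
    by (simp add: poly_mat_pCons mat_ring poly_mat_add poly_mat_smult)
qed (use assms in \<open>simp add: mat_ring\<close>)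

lemma poly_mat_power:
  assumes "dim_col A = dim_row A"
  shows "poly_mat A (p ^ r) = poly_mat A p ^\<^sub>m r"
  using assms
  by (induction r) (auto simp: poly_mat_mult mult.commute[of p] simp del: power_Suc simp add: power_Suc2)

lemma poly_mat_commute:
  assumes "dim_col A = dim_row A" "dim_row R = dim_row A" "dim_col R = dim_row A" "A * R = R * A"
  shows "poly_mat A p * R = R * poly_mat A p"
proof (induction p)
  case (pCons a p)
  then show ?case using assms
    by (simp add: poly_mat_pCons mat_ring mat_rewrite[OF assms(4)])
qed (use assms in \<open>simp add: mat_ring\<close>)

lemma map_poly_cnj_pCons: "map_poly cnj (pCons a p) = pCons (cnj a) (map_poly cnj p)"
  by (intro poly_eqI) (simp add: coeff_map_poly coeff_pCons split: nat.split)

lemma poly_mat_adjoint: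
  assumes "dim_col A = dim_row A" "dim_row H = dim_row A" "dim_col H = dim_row A"
    "H * A = adj A * H"
  shows "adj (poly_mat A p) * H = H * poly_mat A (map_poly cnj p)"
proof (induction p)
  case (pCons a p)
  have c: "adj (poly_mat A p) * adj A = adj A * adj (poly_mat A p)"
    using arg_cong[OF poly_mat_commute[OF assms(1) refl assms(1) refl, of p], of adj]
      assms by (simp add: mat_adjoint_mult)
  show ?case using assms
    by (simp add: poly_mat_pCons map_poly_cnj_pCons mat_ring mat_adjoint_add mat_adjoint_mult
        mat_adjoint_smult mat_rewrite[OF assms(4)] c pCons)
qed (use assms in \<open>simp add: mat_ring\<close>)

text \<open>The hypothesis on \<open>V\<close> says that the antilinear map v -> V conj(v) commutes
  with \<open>A\<close>; antilinearity is what conjugates the coefficients.\<close>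

lemma poly_mat_semilinear:
  assumes "dim_col A = dim_row A" "dim_row V = dim_row A" "dim_col V = dim_row A"
    "V * conj_mat A = A * V"
  shows "V * conj_mat (poly_mat A p) = poly_mat A (map_poly cnj p) * V"
proof (induction p)
  case (pCons a p)
  show ?case using assms
    by (simp add: poly_mat_pCons map_poly_cnj_pCons mat_ring conj_mat_add conj_mat_mult
        conj_mat_smult mat_rewrite[OF assms(4)] pCons)
qed (use assms in \<open>simp add: mat_ring\<close>)

lemma poly_mat_similar:
  assumes "P \<in> sq_mats d" "Q \<in> sq_mats d" "B \<in> sq_mats d"
    "P * Q = 1\<^sub>m d" "Q * P = 1\<^sub>m d" "A = P * B * Q"
  shows "poly_mat A p = P * poly_mat B p * Q"
proof (induction p)
  case (pCons a p)
  have d: "dim_row P = d" "dim_col P = d" "dim_row Q = d" "dim_col Q = d" "dim_row B = d" "dim_col B = d"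
    using assms by auto
  have A: "dim_row A = d" "dim_col A = d" using assms(6) d by auto
  have AP: "A * P = P * B" using d by (simp add: assms(5,6) mat_ring)
  show ?case
    by (simp add: poly_mat_pCons A d mat_ring pCons assms(4) mat_rewrite[OF AP])
qed (use assms in \<open>simp add: mat_ring\<close>)

lemma poly_mat_dsum:
  assumes "dim_col A = dim_row A" "dim_col B = dim_row B"
  shows "poly_mat (dsum A B) p = dsum (poly_mat A p) (poly_mat B p)"
proof (induction p)
  case (pCons a p)
  have "dsum X Y + dsum X' Y' = dsum (X + X') (Y + Y')"
    if "dim_row X = dim_row X'" "dim_col X = dim_col X'" "dim_row Y = dim_row Y'" "dim_col Y = dim_col Y'"
    for X Y X' Y'
    unfolding dsum_four_block using that by (intro eq_matI) auto
  moreover have "a \<cdot>\<^sub>m 1\<^sub>m (dim_row A + dim_row B) = dsum (a \<cdot>\<^sub>m 1\<^sub>m (dim_row A)) (a \<cdot>\<^sub>m 1\<^sub>m (dim_row B))"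
    unfolding dsum_four_block by (intro eq_matI) auto
  ultimately show ?case using assms
    by (simp add: poly_mat_pCons pCons dsum_mult)
qed (use assms in \<open>simp add: dsum_four_block\<close>)

text \<open>Each block J_k(a) contributes the factor (X - a)^k, which kills it.\<close>

lemma annihilating_poly_jordan_matrix:
  "\<exists>p. p \<noteq> 0 \<and> poly_mat (jordan_matrix n_as) p = 0\<^sub>m (sum_list (map fst n_as)) (sum_list (map fst n_as))"
proof (induction n_as)
  case Nil
  show ?case by (intro exI[of _ 1]) (auto simp: jordan_matrix_def)
next
  case (Cons na n_as)
  obtain k a where na: "na = (k, a)" by (cases na)
  let ?s = "sum_list (map fst n_as)"
  from Cons obtain p where p: "p \<noteq> 0" "poly_mat (jordan_matrix n_as) p = 0\<^sub>m ?s ?s" by auto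
  have J: "jordan_matrix (na # n_as) = dsum (J k a) (jordan_matrix n_as)"
    by (simp add: jordan_matrix_def na diag_block_mat_Cons_dsum del: diag_block_mat.simps)
  have "poly_mat (J k a) [:-a, 1:] = toep k fps_X"
  proof -
    have "poly_mat (J k a) [:-a, 1:] = toep k (fps_const a + fps_X) - toep k (fps_const a)"
      by (subst poly_mat_linear) (auto simp: jordan_block_toep toep_const)
    then show ?thesis by (simp flip: toep_diff)
  qed
  then have "poly_mat (J k a) ([:-a, 1:] ^ k) = toep k (fps_X ^ k)"
    by (subst poly_mat_power) (auto simp: toep_power)
  also have "\<dots> = 0\<^sub>m k k"
    by (intro eq_matI) (auto simp: fps_X_power_nth)
  finally have 1: "poly_mat (J k a) ([:-a, 1:] ^ k) = 0\<^sub>m k k" .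
  have z: "dsum (0\<^sub>m k k) (0\<^sub>m ?s ?s) = 0\<^sub>m (k + ?s) (k + ?s)"
    by (simp add: dsum_four_block)
  have "poly_mat (jordan_matrix (na # n_as)) ([:-a, 1:] ^ k * p) = 0\<^sub>m (k + ?s) (k + ?s)"
    unfolding J by (subst poly_mat_dsum) (auto simp: poly_mat_mult 1 p(2) mat_ring z)
  then show ?case using p(1) by (intro exI[of _ "[:-a, 1:] ^ k * p"]) (auto simp: na)
qed

lemma annihilating_poly_exists:
  assumes A: "A \<in> sq_mats d"
  shows "\<exists>p. p \<noteq> 0 \<and> poly_mat A p = 0\<^sub>m d d"
proof -
  from char_poly_factorized[OF A] jordan_nf_exists[OF A] obtain n_as where "jordan_nf A n_as"
    by blast
  then have "similar_mat A (jordan_matrix n_as)" by (simp add: jordan_nf_def)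
  from similar_matD[OF this] obtain d' P Q where s: "{A, jordan_matrix n_as, P, Q} \<subseteq> carrier_mat d' d'"
    "P * Q = 1\<^sub>m d'" "Q * P = 1\<^sub>m d'" "A = P * jordan_matrix n_as * Q" by blast
  have "dim_row (jordan_matrix n_as) = d'" "dim_row A = d'" using s(1) by (meson carrier_matD(1) insert_subset)+
  then have d': "d' = d" "sum_list (map fst n_as) = d" using A by auto
  from annihilating_poly_jordan_matrix[of n_as] obtain p
    where p: "p \<noteq> 0" "poly_mat (jordan_matrix n_as) p = 0\<^sub>m d d" using d' by auto
  have "poly_mat A p = P * poly_mat (jordan_matrix n_as) p * Q"
    by (rule poly_mat_similar[of _ d]) (use s d' in auto)
  also have "\<dots> = 0\<^sub>m d d" using s d' p by (auto simp: mat_ring)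
  finally show ?thesis using p by blast
qed

text \<open>For a projection \<open>R\<close> commuting with \<open>A\<close> this is the minimal
  polynomial of \<open>A\<close> on the range of \<open>R\<close>, so its roots are eigenvalues in
  the part not yet decomposed. It is not constant because \<open>R\<close> is nonzero.\<close>

lemma relative_minimal_poly:
  assumes A: "A \<in> sq_mats d" and R: "R \<in> sq_mats d" and R0: "R \<noteq> 0\<^sub>m d d"
  obtains q where "q \<noteq> 0" "poly_mat A q * R = 0\<^sub>m d d"
    "\<And>f. f \<noteq> 0 \<Longrightarrow> poly_mat A f * R = 0\<^sub>m d d \<Longrightarrow> degree q \<le> degree f" "degree q > 0"
proof -
  have d: "dim_row A = d" "dim_col A = d" "dim_row R = d" "dim_col R = d" using A R by auto
  let ?P = "\<lambda>p. p \<noteq> 0 \<and> poly_mat A p * R = 0\<^sub>m d d"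
  from annihilating_poly_exists[OF A] obtain p
    where p: "p \<noteq> 0" "poly_mat A p = 0\<^sub>m d d" by blast
  then have "?P p" using d by (simp add: mat_ring)
  then obtain q where q: "?P q" and m: "\<And>f. ?P f \<Longrightarrow> degree q \<le> degree f"
    using ex_has_least_nat[of ?P p degree] by blast
  have "degree q > 0"
  proof (rule ccontr)
    assume "\<not> degree q > 0"
    then obtain c where c: "q = [:c:]" by (metis degree_eq_zeroE not_gr_zero)
    then have "c \<noteq> 0" using q by auto
    have "c \<cdot>\<^sub>m R = 0\<^sub>m d d" using q d unfolding c by (simp add: poly_mat_pCons mat_ring)
    then have "inverse c \<cdot>\<^sub>m (c \<cdot>\<^sub>m R) = inverse c \<cdot>\<^sub>m 0\<^sub>m d d" by simp
    then have "R = inverse c \<cdot>\<^sub>m 0\<^sub>m d d" using \<open>c \<noteq> 0\<close> by (simp add: smult_smult_mat)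
    also have "\<dots> = 0\<^sub>m d d" by (intro eq_matI) auto
    finally show False using R0 by simp
  qed
  then show thesis using that q m by blast
qed

lemma relative_minimal_poly_dvd:
  assumes A: "A \<in> sq_mats d" and R: "R \<in> sq_mats d"
    and q: "q \<noteq> 0" "poly_mat A q * R = 0\<^sub>m d d"
    and min: "\<And>f. f \<noteq> 0 \<Longrightarrow> poly_mat A f * R = 0\<^sub>m d d \<Longrightarrow> degree q \<le> degree f"
    and f: "poly_mat A f * R = 0\<^sub>m d d"
  shows "q dvd f"
proof (rule ccontr)
  assume "\<not> q dvd f"
  then have r: "f mod q \<noteq> 0" by (simp add: dvd_eq_mod_eq_0)
  have d: "dim_row A = d" "dim_col A = d" "dim_row R = d" "dim_col R = d" using A R by auto
  have "poly_mat A f = poly_mat A ((f div q) * q + f mod q)" by simp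
  also have "\<dots> = poly_mat A (f div q) * poly_mat A q + poly_mat A (f mod q)"
    using d by (subst poly_mat_add) (simp_all add: poly_mat_mult)
  finally have "poly_mat A f * R = poly_mat A (f div q) * (poly_mat A q * R) + poly_mat A (f mod q) * R"
    using d by (simp add: mat_ring)
  then have "poly_mat A (f mod q) * R = 0\<^sub>m d d" using q(2) f d by (simp add: mat_ring)
  from min[OF r this] show False using degree_mod_less[of q f] q(1) r by auto
qed

section \<open>The quaternionic structure: Omega as the commutant of an antilinear map\<close>

definition quat_J :: "nat \<Rightarrow> complex mat" where
  "quat_J n = mat (2 * n) (2 * n) (\<lambda>(i, j). if j = i + n then -1 else if i = j + n then 1 else 0)"

lemma dim_quat_J [simp]: "dim_row (quat_J n) = 2 * n" "dim_col (quat_J n) = 2 * n"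
  by (auto simp: quat_J_def)

lemma quat_J_mult:
  assumes "i < 2 * n" "j < dim_col A" "dim_row A = 2 * n"
  shows "(quat_J n * A) $$ (i, j) = (if i < n then - A $$ (i + n, j) else A $$ (i - n, j))"
proof -
  have "(quat_J n * A) $$ (i, j) = (\<Sum>l<dim_row A. quat_J n $$ (i, l) * A $$ (l, j))"
    using assms by (intro index_mult_sum) auto
  also have "\<dots> = (\<Sum>l<2 * n. if l = (if i < n then i + n else i - n)
      then (if i < n then - A $$ (i + n, j) else A $$ (i - n, j)) else 0)"
    using assms by (intro sum.cong) (auto simp: quat_J_def)
  finally show ?thesis using assms by (cases "i < n") auto
qed

lemma mult_quat_J:
  assumes "i < dim_row A" "j < 2 * n" "dim_col A = 2 * n"
  shows "(A * quat_J n) $$ (i, j) = (if j < n then A $$ (i, j + n) else - A $$ (i, j - n))"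
proof -
  have "(A * quat_J n) $$ (i, j) = (\<Sum>l<dim_row (quat_J n). A $$ (i, l) * quat_J n $$ (l, j))"
    using assms by (intro index_mult_sum) auto
  also have "\<dots> = (\<Sum>l<2 * n. if l = (if j < n then j + n else j - n)
      then (if j < n then A $$ (i, j + n) else - A $$ (i, j - n)) else 0)"
    using assms by (intro sum.cong) (auto simp: quat_J_def)
  finally show ?thesis using assms by (cases "j < n") auto
qed

lemma quat_J_square: "quat_J n * quat_J n = (-1) \<cdot>\<^sub>m 1\<^sub>m (2 * n)"
  by (intro eq_matI) (auto simp: quat_J_mult, auto simp: quat_J_def)

lemma adjoint_quat_J: "adj (quat_J n) = (-1) \<cdot>\<^sub>m quat_J n"
  by (intro eq_matI) (auto simp: quat_J_def)

lemma transpose_quat_J: "transpose_mat (quat_J n) = (-1) \<cdot>\<^sub>m quat_J n"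
  by (intro eq_matI) (auto simp: quat_J_def)

lemma conj_quat_J [simp]: "conj_mat (quat_J n) = quat_J n"
  by (intro eq_matI) (auto simp: quat_J_def)

text \<open>The equation says that \<open>M\<close> commutes with j: v -> J conj(v). Compared
  blockwise, it determines the second block column of \<open>M\<close> from the first.\<close>

lemma Omega_iff:
  "M \<in> Omega n \<longleftrightarrow> M \<in> sq_mats (2 * n) \<and> quat_J n * conj_mat M = M * quat_J n"
proof
  assume "M \<in> Omega n"
  then obtain A1 A2 where M: "M = four_block_mat A1 (conj_mat A2) (- A2) (conj_mat A1)"
    and c: "A1 \<in> sq_mats n" "A2 \<in> sq_mats n" unfolding Omega_def by auto
  have d: "dim_row M = 2 * n" "dim_col M = 2 * n" using c by (auto simp: M)
  have "quat_J n * conj_mat M = M * quat_J n"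
  proof (intro eq_matI)
    fix i j assume "i < dim_row (M * quat_J n)" "j < dim_col (M * quat_J n)"
    then have ij: "i < 2 * n" "j < 2 * n" using d by auto
    then show "(quat_J n * conj_mat M) $$ (i, j) = (M * quat_J n) $$ (i, j)"
      using d c by (auto simp: quat_J_mult mult_quat_J M)
  qed (use d in auto)
  then show "M \<in> sq_mats (2 * n) \<and> quat_J n * conj_mat M = M * quat_J n"
    using d by (auto intro: carrier_matI)
next
  assume a: "M \<in> sq_mats (2 * n) \<and> quat_J n * conj_mat M = M * quat_J n"
  then have d: "dim_row M = 2 * n" "dim_col M = 2 * n" by auto
  have e: "(quat_J n * conj_mat M) $$ (i, j) = (M * quat_J n) $$ (i, j)" for i j
    using a by simp
  have 1: "M $$ (i, j + n) = - cnj (M $$ (i + n, j))" if "i < n" "j < n" for i j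
    using e[of i j] that d by (simp add: quat_J_mult mult_quat_J)
  have 2: "M $$ (i + n, j + n) = cnj (M $$ (i, j))" if "i < n" "j < n" for i j
    using e[of "i + n" j] that d by (simp add: quat_J_mult mult_quat_J)
  define A1 where "A1 = mat n n (\<lambda>(i, j). M $$ (i, j))"
  define A2 where "A2 = mat n n (\<lambda>(i, j). - M $$ (i + n, j))"
  have "M = four_block_mat A1 (conj_mat A2) (- A2) (conj_mat A1)"
  proof (intro eq_matI)
    fix i j
    assume "i < dim_row (four_block_mat A1 (conj_mat A2) (- A2) (conj_mat A1))"
      "j < dim_col (four_block_mat A1 (conj_mat A2) (- A2) (conj_mat A1))"
    then have ij: "i < 2 * n" "j < 2 * n" by (auto simp: A1_def A2_def)
    then show "M $$ (i, j) = four_block_mat A1 (conj_mat A2) (- A2) (conj_mat A1) $$ (i, j)"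
      using 1[of i "j - n"] 2[of "i - n" "j - n"] by (auto simp: A1_def A2_def)
  qed (auto simp: A1_def A2_def d)
  moreover have "A1 \<in> sq_mats n" "A2 \<in> sq_mats n" by (auto simp: A1_def A2_def)
  ultimately show "M \<in> Omega n" unfolding Omega_def by blast
qed

lemma OmegaD:
  assumes "M \<in> Omega n"
  shows "dim_row M = 2 * n" "dim_col M = 2 * n" "quat_J n * conj_mat M = M * quat_J n"
    "M \<in> sq_mats (2 * n)"
  using assms unfolding Omega_iff by auto

lemma Omega_mult:
  assumes M: "M \<in> Omega n" and M': "M' \<in> Omega n"
  shows "M * M' \<in> Omega n"
proof -
  note d = OmegaD(1,2)[OF M] OmegaD(1,2)[OF M']
  have "quat_J n * conj_mat (M * M') = M * M' * quat_J n"
    by (simp add: d conj_mat_mult mat_ring mat_rewrite[OF OmegaD(3)[OF M]] OmegaD(3)[OF M'])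
  moreover have "M * M' \<in> sq_mats (2 * n)" by (intro carrier_matI) (simp_all add: d)
  ultimately show ?thesis unfolding Omega_iff by simp
qed

lemma Omega_inverse:
  assumes M: "M \<in> Omega n" and N: "N \<in> sq_mats (2 * n)"
    and i: "M * N = 1\<^sub>m (2 * n)" "N * M = 1\<^sub>m (2 * n)"
  shows "N \<in> Omega n"
proof -
  have d: "dim_row M = 2 * n" "dim_col M = 2 * n" "dim_row N = 2 * n" "dim_col N = 2 * n"
    using M N by (auto simp: OmegaD)
  have c: "conj_mat M * conj_mat N = 1\<^sub>m (2 * n)"
    using arg_cong[OF i(1), of conj_mat] d by (simp add: conj_mat_mult)
  have "N * quat_J n = N * (quat_J n * (conj_mat M * conj_mat N))"
    unfolding c by (simp add: mat_ring d)
  also have "\<dots> = N * ((M * quat_J n) * conj_mat N)"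
    unfolding OmegaD(3)[OF M, symmetric] by (simp add: mat_ring d)
  also have "\<dots> = quat_J n * conj_mat N"
    by (simp add: mat_ring d mat_rewrite1[OF i(2)])
  finally show ?thesis using N unfolding Omega_iff by simp
qed

text \<open>The case A2 = 0 of the definition; through it matrices found in one complex copy become
  quaternionic.\<close>

lemma dsum_conj_Omega:
  assumes "T \<in> sq_mats n"
  shows "dsum T (conj_mat T) \<in> Omega n"
proof -
  have "dsum T (conj_mat T) = four_block_mat T (conj_mat (0\<^sub>m n n)) (- 0\<^sub>m n n) (conj_mat T)"
    unfolding dsum_four_block using assms by (intro eq_matI) auto
  then show ?thesis unfolding Omega_def mem_Collect_eq using assms
    by (intro exI[of _ T] exI[of _ "0\<^sub>m n n"]) simp
qed

section \<open>Splitting off a block\<close>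

text \<open>The columns of a matrix in \<open>Omega n\<close> are \<open>X\<close> followed by \<open>quat_conj n X\<close>.\<close>

definition quat_conj :: "nat \<Rightarrow> complex mat \<Rightarrow> complex mat" where
  "quat_conj n X = quat_J n * conj_mat X"

lemma dim_quat_conj [simp]:
  "dim_row (quat_conj n X) = 2 * n" "dim_col (quat_conj n X) = dim_col X"
  by (auto simp: quat_conj_def)

lemma quat_conj_mult_right:
  assumes "dim_row X = 2 * n" "dim_row K = dim_col X"
  shows "quat_conj n (X * K) = quat_conj n X * conj_mat K"
  using assms by (simp add: quat_conj_def conj_mat_mult mat_ring)

lemma quat_conj_Omega_mult:
  assumes "M \<in> Omega n" "dim_row X = 2 * n"
  shows "M * quat_conj n X = quat_conj n (M * X)"
  using assms OmegaD[OF assms(1)]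
  by (simp add: quat_conj_def conj_mat_mult mat_ring mat_rewrite[OF OmegaD(3)[OF assms(1)]])

lemma quat_conj_hcat:
  assumes "dim_row X = 2 * n" "dim_row Y = 2 * n"
  shows "quat_conj n (hcat X Y) = hcat (quat_conj n X) (quat_conj n Y)"
  using assms by (simp add: quat_conj_def conj_hcat mult_hcat)

lemma quat_conj_quat_conj:
  assumes "dim_row X = 2 * n"
  shows "quat_conj n (quat_conj n X) = (-1) \<cdot>\<^sub>m X"
  using assms
  by (simp add: quat_conj_def conj_mat_mult mat_rewrite1[OF quat_J_square] mat_ring)

lemma transpose_adjoint: "transpose_mat (adj X) = conj_mat X"
  by (intro eq_matI) auto

lemma transpose_conj: "transpose_mat (conj_mat X) = adj X"
  by (intro eq_matI) auto

lemma transpose_hermitian: "adj H = H \<Longrightarrow> transpose_mat H = conj_mat H"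
  by (metis transpose_adjoint)

lemma transpose_mat_mult:
  fixes A B :: "complex mat"
  assumes "dim_col A = dim_row B"
  shows "transpose_mat (A * B) = transpose_mat B * transpose_mat A"
  using assms by (intro transpose_mult[of _ "dim_row A" "dim_row B" _ "dim_col B"]) auto

text \<open>Transposition turns adjoints into conjugates, and \<open>H\<close> commutes with j; the
  only sign comes from the skew-symmetry of \<open>quat_J\<close>.\<close>

lemma gram_quat_conj_skew:
  assumes H: "H \<in> Omega n" "adj H = H" and X: "dim_row X = 2 * n" and Y: "dim_row Y = 2 * n"
  shows "transpose_mat (adj X * H * quat_conj n Y) = (-1) \<cdot>\<^sub>m (adj Y * H * quat_conj n X)"
  using X Y OmegaD[OF H(1)]
  by (simp add: quat_conj_def transpose_mat_mult transpose_adjoint transpose_conj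
      transpose_hermitian[OF H(2)] transpose_quat_J mat_ring
      mat_rewrite[OF OmegaD(3)[OF H(1)]])

text \<open>\<open>H\<close> commutes with j, and \<open>adj (quat_J n) * quat_J n\<close> is the
  identity, so j is antiunitary for the form.\<close>

lemma gram_quat_conj_conj:
  assumes H: "H \<in> Omega n" and X: "dim_row X = 2 * n" and Y: "dim_row Y = 2 * n"
  shows "adj (quat_conj n X) * H * quat_conj n Y = conj_mat (adj X * H * Y)"
proof -
  have "adj (quat_conj n X) * H * quat_conj n Y =
      adj (quat_conj n X) * quat_J n * (conj_mat H * conj_mat Y)"
    using X Y OmegaD[OF H]
    by (simp add: quat_conj_def mat_ring mat_rewrite[OF OmegaD(3)[OF H]])
  also have "adj (quat_conj n X) * quat_J n = adj (conj_mat X)"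
    using X by (simp add: quat_conj_def mat_adjoint_mult adjoint_quat_J mat_ring quat_J_square smult_smult_mat)
  finally show ?thesis using X Y OmegaD[OF H] by (simp add: conj_mat_mult conj_mat_adjoint mat_ring)
qed

text \<open>Selfadjointness of \<open>A\<close> in the coordinates of two invariant families.
  Through it Gram matrices of chains become subject to the intertwiner lemmas.\<close>

lemma gram_intertwines:
  fixes A H Y Z :: "complex mat"
  assumes A: "A \<in> sq_mats d" and H: "H \<in> sq_mats d" and HA: "H * A = adj A * H"
    and Y: "dim_row Y = d" "A * Y = Y * M" "dim_row M = dim_col Y"
    and Z: "dim_row Z = d" "A * Z = Z * M'" "dim_row M' = dim_col Z"
  shows "(adj Y * H * Z) * M' = adj M * (adj Y * H * Z)"
proof -
  have d: "dim_row A = d" "dim_col A = d" "dim_row H = d" "dim_col H = d" using A H by auto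
  have "(adj Y * H * Z) * M' = adj Y * (H * (A * Z))"
    unfolding Z(2) using d Y Z by (simp add: mat_ring)
  also have "\<dots> = adj (A * Y) * (H * Z)"
    using d Y(1) Z(1) by (simp add: mat_rewrite[OF HA] mat_adjoint_mult mat_ring)
  also have "\<dots> = adj M * (adj Y * H * Z)"
    unfolding Y(2) using d Y(1,3) Z(1) by (simp add: mat_adjoint_mult mat_ring)
  finally show ?thesis .
qed

section \<open>Vectors on which a sesquilinear form does not vanish\<close>

lemma mat_nonzero_entry:
  assumes "F \<in> carrier_mat d e" "F \<noteq> 0\<^sub>m d e"
  obtains i j where "i < d" "j < e" "F $$ (i, j) \<noteq> 0"
proof -
  have "\<exists>i j. i < d \<and> j < e \<and> F $$ (i, j) \<noteq> 0"
  proof (rule ccontr)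
    assume "\<not> ?thesis"
    then have "F = 0\<^sub>m d e" using assms(1) by (intro eq_matI) auto
    then show False using assms by simp
  qed
  then show thesis using that by blast
qed

definition unit_col :: "nat \<Rightarrow> nat \<Rightarrow> complex mat" where
  "unit_col d i = mat d 1 (\<lambda>(l, _). if l = i then 1 else 0)"

lemma dim_unit_col [simp]: "dim_row (unit_col d i) = d" "dim_col (unit_col d i) = 1"
  by (auto simp: unit_col_def)

lemma mult_unit_col:
  assumes "a < dim_row F" "dim_col F = d" "j < d"
  shows "(F * unit_col d j) $$ (a, 0) = F $$ (a, j)"
proof -
  have "(F * unit_col d j) $$ (a, 0) = (\<Sum>l<dim_row (unit_col d j). F $$ (a, l) * unit_col d j $$ (l, 0))"
    using assms by (intro index_mult_sum) auto
  also have "\<dots> = (\<Sum>l<d. if l = j then F $$ (a, j) else 0)"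
    using assms by (intro sum.cong) (auto simp: unit_col_def)
  finally show ?thesis using assms by simp
qed

lemma form_unit_col:
  fixes F :: "complex mat"
  assumes "F \<in> sq_mats d" "i < d" "j < d"
  shows "(adj (unit_col d i) * (F * unit_col d j)) $$ (0, 0) = F $$ (i, j)"
proof -
  let ?B = "F * unit_col d j"
  have "(adj (unit_col d i) * ?B) $$ (0, 0) =
      (\<Sum>l<dim_row ?B. adj (unit_col d i) $$ (0, l) * ?B $$ (l, 0))"
    using assms by (intro index_mult_sum) auto
  also have "\<dots> = (\<Sum>l<d. if l = i then F $$ (i, j) else 0)"
    using assms by (intro sum.cong) (auto simp: mult_unit_col, auto simp: unit_col_def)
  finally show ?thesis using assms by simp
qed

lemma sesquilinear_nonzero:
  fixes F :: "complex mat"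
  assumes F: "F \<in> sq_mats d" "F \<noteq> 0\<^sub>m d d"
  obtains v w where "v \<in> carrier_mat d 1" "w \<in> carrier_mat d 1"
    "(adj v * (F * w)) $$ (0, 0) \<noteq> 0"
proof -
  from mat_nonzero_entry[OF F] obtain i j where "i < d" "j < d" "F $$ (i, j) \<noteq> 0" .
  moreover have "unit_col d l \<in> carrier_mat d 1" for l by (simp add: unit_col_def)
  ultimately show thesis
    using that[of "unit_col d i" "unit_col d j"] form_unit_col[OF F(1)] by metis
qed

text \<open>Over the complex numbers the quadratic values determine a sesquilinear form. A single
  vector is wanted at real eigenvalues, where one chain is paired with itself.\<close>

lemma quadratic_nonzero:
  fixes F :: "complex mat"
  assumes F: "F \<in> sq_mats d" "F \<noteq> 0\<^sub>m d d"
  obtains v where "v \<in> carrier_mat d 1" "(adj v * (F * v)) $$ (0, 0) \<noteq> 0"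
proof (rule ccontr)
  assume "\<not> thesis"
  then have z: "(adj v * (F * v)) $$ (0, 0) = 0" if "v \<in> carrier_mat d 1" for v
    using that \<open>\<And>v. v \<in> carrier_mat d 1 \<Longrightarrow> (adj v * (F * v)) $$ (0, 0) \<noteq> 0 \<Longrightarrow> thesis\<close> by blast
  from sesquilinear_nonzero[OF F] obtain v w where vw: "v \<in> carrier_mat d 1" "w \<in> carrier_mat d 1"
    "(adj v * (F * w)) $$ (0, 0) \<noteq> 0" .
  have d: "dim_row v = d" "dim_col v = 1" "dim_row w = d" "dim_col w = 1" "dim_row F = d" "dim_col F = d"
    using vw F by auto
  \<comment> \<open>polarisation: evaluate on \<open>v + c w\<close> for \<open>c = 1\<close> and \<open>c = i\<close>\<close>
  have e: "cnj c * (adj w * (F * v)) $$ (0, 0) + c * (adj v * (F * w)) $$ (0, 0) = 0" for c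
  proof -
    have "(adj (v + c \<cdot>\<^sub>m w) * (F * (v + c \<cdot>\<^sub>m w))) $$ (0, 0) = 0"
      using vw by (intro z) auto
    also have "adj (v + c \<cdot>\<^sub>m w) * (F * (v + c \<cdot>\<^sub>m w)) =
        (adj v * (F * v) + cnj c \<cdot>\<^sub>m (adj w * (F * v))) +
        c \<cdot>\<^sub>m (adj v * (F * w) + cnj c \<cdot>\<^sub>m (adj w * (F * w)))"
      by (simp add: d mat_ring mat_adjoint_add mat_adjoint_smult)
    finally show ?thesis using z[OF vw(1)] z[OF vw(2)] d
      by (simp add: algebra_simps)
  qed
  from e[of 1] e[of \<i>] have "(adj v * (F * w)) $$ (0, 0) = 0"
    by (simp add: complex_eq_iff)
  then show False using vw by simp
qed

lemma mult_chain:
  assumes "R \<in> sq_mats d" "N \<in> sq_mats d" "x \<in> carrier_mat d 1" "N * R = R * N"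
  shows "R * chain k N x = chain k N (R * x)"
proof (intro eq_matI)
  fix i j assume "i < dim_row (chain k N (R * x))" "j < dim_col (chain k N (R * x))"
  then have ij: "i < d" "j < k" using assms by auto
  have d: "dim_row R = d" "dim_col R = d" "dim_row N = d" "dim_col N = d" "dim_row x = d" "dim_col x = 1"
    using assms by auto
  have c: "N ^\<^sub>m r * R = R * N ^\<^sub>m r" for r
  proof (induction r)
    case (Suc r)
    then show ?case by (simp add: mat_ring d assms(4) mat_rewrite[OF Suc])
  qed (simp add: mat_ring d)
  have "(R * chain k N x) $$ (i, j) = (\<Sum>l<dim_row (chain k N x). R $$ (i, l) * chain k N x $$ (l, j))"
    using ij d by (intro index_mult_sum) auto
  also have "\<dots> = (\<Sum>l<dim_row (N ^\<^sub>m (k - 1 - j) * x). R $$ (i, l) * (N ^\<^sub>m (k - 1 - j) * x) $$ (l, 0))"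
    using ij d by (intro sum.cong) auto
  also have "\<dots> = (R * (N ^\<^sub>m (k - 1 - j) * x)) $$ (i, 0)"
    using ij d by (intro index_mult_sum[symmetric]) auto
  also have "R * (N ^\<^sub>m (k - 1 - j) * x) = N ^\<^sub>m (k - 1 - j) * (R * x)"
    by (rule mat_rewrite[OF c[symmetric]]) (auto simp: d)
  finally show "(R * chain k N x) $$ (i, j) = chain k N (R * x) $$ (i, j)"
    using ij d by simp
qed (use assms in auto)

lemma map_poly_cnj_mult: "map_poly cnj (p * q) = map_poly cnj p * map_poly cnj q"
  by (intro poly_eqI) (simp add: coeff_map_poly coeff_mult)

lemma map_poly_cnj_power: "map_poly cnj (p ^ r) = map_poly cnj p ^ r"
  by (induction r) (auto simp: map_poly_cnj_mult)

lemma degree_map_poly_cnj: "degree (map_poly cnj p) = degree p"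
  by (intro degree_map_poly) auto

lemma map_poly_cnj_linear: "map_poly cnj [:-l, 1:] = [:- cnj l, 1:]"
  by (simp add: map_poly_pCons)

text \<open>Applied to the projection \<open>R\<close> onto the orthogonal complement of the blocks already split off.\<close>

locale selfadjoint_projection =
  fixes n :: nat and A H R :: "complex mat"
  assumes A: "A \<in> Omega n" and H: "H \<in> Omega n" and R: "R \<in> Omega n"
    and herm: "adj H = H" and inv: "\<exists>Hi \<in> sq_mats (2 * n). Hi * H = 1\<^sub>m (2 * n)"
    and HA: "H * A = adj A * H" and HR: "H * R = adj R * H"
    and AR: "A * R = R * A" and RR: "R * R = R" and R0: "R \<noteq> 0\<^sub>m (2 * n) (2 * n)"
begin

abbreviation zero :: "complex mat" where
  "zero \<equiv> 0\<^sub>m (2 * n) (2 * n)"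

lemma dims [simp]:
  "dim_row A = 2 * n" "dim_col A = 2 * n" "dim_row H = 2 * n" "dim_col H = 2 * n"
  "dim_row R = 2 * n" "dim_col R = 2 * n"
  using OmegaD[OF A] OmegaD[OF H] OmegaD[OF R] by auto

lemma carriers:
  "A \<in> sq_mats (2 * n)" "H \<in> sq_mats (2 * n)" "R \<in> sq_mats (2 * n)"
  by (auto intro: carrier_matI)

text \<open>\<open>A\<close> and \<open>R\<close> commute with the antilinear j, and moving a
  polynomial in \<open>A\<close> past j conjugates its coefficients.\<close>

lemma annihilator_cnj:
  assumes "poly_mat A q * R = zero"
  shows "poly_mat A (map_poly cnj q) * R = zero"
proof -
  let ?P = "poly_mat A (map_poly cnj q) * R"
  have c: "quat_J n * conj_mat (poly_mat A q) = poly_mat A (map_poly cnj q) * quat_J n"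
    using poly_mat_semilinear[of A "quat_J n" q] OmegaD(3)[OF A] by simp
  have "?P * quat_J n = quat_J n * conj_mat (poly_mat A q * R)"
    by (simp add: conj_mat_mult mat_ring mat_rewrite[OF c] OmegaD(3)[OF R])
  also have "\<dots> = zero" unfolding assms by (simp add: mat_ring)
  finally have "?P * quat_J n * quat_J n = zero" by (simp add: mat_ring)
  then have "(-1) \<cdot>\<^sub>m ?P = zero" by (simp add: mat_ring quat_J_square)
  then have "(-1) \<cdot>\<^sub>m ((-1) \<cdot>\<^sub>m ?P) = (-1) \<cdot>\<^sub>m zero" by simp
  also have "(-1) \<cdot>\<^sub>m ((-1) \<cdot>\<^sub>m ?P) = ?P" by (simp add: smult_smult_mat)
  also have "(-1) \<cdot>\<^sub>m zero = zero" by (intro eq_matI) auto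
  finally show ?thesis .
qed

text \<open>The multiplicity k is taken in the minimal polynomial on the range of \<open>R\<close>,
  so (A - mu)^(k-1) u(A) is nonzero there whenever u does not vanish at mu. This leaves room for a
  chain of length k with nonzero Gram corner. A nonreal root is put in the lower half plane; its
  conjugate then labels the block as the canonical data require.\<close>

lemma obtain_root:
  obtains mu k q' where "Im mu \<le> 0" "k > 0"
    "poly_mat A ([:-mu, 1:] ^ k * q') * R = zero" "poly q' mu \<noteq> 0"
    "\<And>u. poly u mu \<noteq> 0 \<Longrightarrow> poly_mat A ([:-mu, 1:] ^ (k - 1) * u) * R \<noteq> zero"
proof -
  from relative_minimal_poly[OF carriers(1,3) R0] obtain q0 where q0: "q0 \<noteq> 0"
    "poly_mat A q0 * R = zero"
    "\<And>f. f \<noteq> 0 \<Longrightarrow> poly_mat A f * R = zero \<Longrightarrow> degree q0 \<le> degree f"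
    "degree q0 > 0" by blast
  have "\<exists>z. poly q0 z = 0"
    using fundamental_theorem_of_algebra_alt[of q0] q0(4) by (metis degree_pCons_0 less_irrefl)
  then obtain z where z: "poly q0 z = 0" by blast
  obtain q mu where q: "q \<noteq> 0" "poly_mat A q * R = zero"
    "\<And>f. f \<noteq> 0 \<Longrightarrow> poly_mat A f * R = zero \<Longrightarrow> degree q \<le> degree f"
    "poly q mu = 0" "Im mu \<le> 0"
  proof (cases "Im z \<le> 0")
    case True
    then show thesis using that[of q0 z] q0 z by blast
  next
    case False
    show thesis
    proof (rule that[of "map_poly cnj q0" "cnj z"])
      show "map_poly cnj q0 \<noteq> 0" using q0(4) degree_map_poly_cnj[of q0] by auto
      show "poly_mat A (map_poly cnj q0) * R = zero" by (rule annihilator_cnj[OF q0(2)])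
      show "degree (map_poly cnj q0) \<le> degree f"
        if "f \<noteq> 0" "poly_mat A f * R = zero" for f
        using q0(3)[OF that] by (simp add: degree_map_poly_cnj)
      show "poly (map_poly cnj q0) (cnj z) = 0" using z by simp
      show "Im (cnj z) \<le> 0" using False by simp
    qed
  qed
  define k where "k = Polynomial.order mu q"
  have k: "k > 0" using q order_root[of q mu] by (auto simp: k_def)
  from order_decomp[OF q(1), of mu] obtain q' where q': "q = [:-mu, 1:] ^ k * q'" "\<not> [:-mu, 1:] dvd q'"
    unfolding k_def by blast
  show thesis
  proof (rule that[of mu k q'])
    show "poly q' mu \<noteq> 0" using q'(2) by (simp add: poly_eq_0_iff_dvd)
    show "poly_mat A ([:-mu, 1:] ^ k * q') * R = zero" using q(2) q'(1) by simp
    show "poly_mat A ([:-mu, 1:] ^ (k - 1) * u) * R \<noteq> zero" if u: "poly u mu \<noteq> 0" for u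
    proof
      assume "poly_mat A ([:-mu, 1:] ^ (k - 1) * u) * R = zero"
      from relative_minimal_poly_dvd[OF carriers(1,3) q(1,2) q(3) this]
      have "q dvd [:-mu, 1:] ^ (k - 1) * u" by blast
      then have "[:-mu, 1:] ^ k dvd [:-mu, 1:] ^ (k - 1) * u" unfolding q'(1) by (rule dvd_mult_left)
      moreover have "[:-mu, 1:] ^ k = [:-mu, 1:] ^ (k - 1) * [:-mu, 1:]"
        using k by (metis Suc_diff_1 power_Suc2)
      ultimately have "[:-mu, 1:] dvd u" by (simp only: dvd_mult_cancel_left) simp
      then show False using u by (simp add: poly_eq_0_iff_dvd)
    qed
  qed (use q(5) k in auto)
qed

text \<open>j carries a chain at l to one at \<open>cnj l\<close>, so the matrix of [x, j y] is
  Hankel and therefore symmetric, while it is also skew. Since l is arbitrary, this settles as well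
  the pairing of a nonreal chain with its own j-image.\<close>

lemma gram_sym_skew_zero:
  assumes Y: "dim_row Y = 2 * n" "dim_col Y = k" "A * Y = Y * J k l"
  shows "adj Y * H * quat_conj n Y = 0\<^sub>m k k"
proof -
  let ?L = "adj Y * H * quat_conj n Y"
  have "A * quat_conj n Y = quat_conj n Y * J k (cnj l)"
    using Y by (simp add: quat_conj_Omega_mult[OF A] quat_conj_mult_right)
  then have "?L * J k (cnj l) = adj (J k l) * ?L"
    using Y by (intro gram_intertwines[OF carriers(1,2) HA]) auto
  then have s: "transpose_mat ?L = ?L"
    using Y by (intro intertwiner_symmetric[of _ k l] carrier_matI) auto
  have t: "transpose_mat ?L = (-1) \<cdot>\<^sub>m ?L" by (rule gram_quat_conj_skew[OF H herm]) (use Y in auto)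
  have e: "?L $$ (i, j) = - ?L $$ (i, j)" if "i < k" "j < k" for i j
  proof -
    have "?L $$ (i, j) = ((-1) \<cdot>\<^sub>m ?L) $$ (i, j)" using s t by simp
    then show ?thesis using that Y by simp
  qed
  have "?L $$ (i, j) = 0" if "i < k" "j < k" for i j
    using e[OF that] by (simp add: complex_eq_iff)
  then show ?thesis using Y by (intro eq_matI) auto
qed

lemma linear_poly_mat: "poly_mat A [:-l, 1:] = A - l \<cdot>\<^sub>m 1\<^sub>m (2 * n)"
  by (subst poly_mat_linear) auto

lemma poly_R_commute: "poly_mat A p * R = R * poly_mat A p"
  by (rule poly_mat_commute) (auto simp: AR)

lemma R_poly_R: "R * (poly_mat A p * (R * V)) = poly_mat A p * (R * V)" if "dim_row V = 2 * n"
proof -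
  have "R * (poly_mat A p * (R * V)) = poly_mat A p * (R * (R * V))"
    using that by (intro mat_rewrite[OF poly_R_commute[symmetric]]) auto
  also have "R * (R * V) = R * V"
    using that by (simp add: mat_rewrite1[OF RR])
  finally show ?thesis .
qed

lemma H_poly_R_nonzero:
  assumes "poly_mat A p * R \<noteq> zero"
  shows "H * (poly_mat A p * R) \<noteq> zero"
proof
  assume z: "H * (poly_mat A p * R) = zero"
  from inv obtain Hi where Hi: "Hi \<in> sq_mats (2 * n)" "Hi * H = 1\<^sub>m (2 * n)" by blast
  have "poly_mat A p * R = Hi * (H * (poly_mat A p * R))"
    using Hi(1) by (simp add: mat_rewrite1[OF Hi(2)] mat_ring)
  then show False using assms z Hi(1) by (simp add: mat_ring)
qed

text \<open>Everything is moved to the right argument: taking the adjoint conjugates the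
  coefficients of a polynomial in \<open>A\<close>, and the selfadjoint projection \<open>R\<close>
  is absorbed. The corner becomes a value of one fixed sesquilinear form, to be made nonzero by the
  choice of v and w.\<close>

lemma chain_gram_corner:
  fixes q1 q2 :: "complex poly"
  assumes v: "v \<in> carrier_mat (2 * n) 1" and w: "w \<in> carrier_mat (2 * n) 1" and k: "k > 0"
    and N: "N \<in> sq_mats (2 * n)"
  shows "(adj (chain k (A - l \<cdot>\<^sub>m 1\<^sub>m (2 * n)) (poly_mat A q1 * (R * v))) * H *
      chain k N (poly_mat A q2 * (R * w))) $$ (0, k - 1) =
    (adj v * ((H * (poly_mat A ([:-cnj l, 1:] ^ (k - 1) * (map_poly cnj q1 * q2)) * R)) * w)) $$ (0, 0)"
proof -
  let ?x = "poly_mat A q1 * (R * v)" and ?z = "poly_mat A q2 * (R * w)"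
  let ?p = "[:-l, 1:] ^ (k - 1) * q1"
  have dv: "dim_row v = 2 * n" "dim_col v = 1" "dim_row w = 2 * n" "dim_col w = 1" using v w by auto
  have "(adj (chain k (A - l \<cdot>\<^sub>m 1\<^sub>m (2 * n)) ?x) * H * chain k N ?z) $$ (0, k - 1) =
      (adj ((A - l \<cdot>\<^sub>m 1\<^sub>m (2 * n)) ^\<^sub>m (k - 1) * ?x) * H * ?z) $$ (0, 0)"
    by (rule gram_chain_corner[of _ "2 * n"]) (use N k dv in \<open>auto intro!: carrier_matI\<close>)
  also have "(A - l \<cdot>\<^sub>m 1\<^sub>m (2 * n)) ^\<^sub>m (k - 1) * ?x = poly_mat A ?p * (R * v)"
    by (simp add: poly_mat_mult poly_mat_power linear_poly_mat mat_ring dv)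
  also have "adj (poly_mat A ?p * (R * v)) * H * ?z =
      adj v * (adj R * ((adj (poly_mat A ?p) * H) * ?z))"
    by (simp add: mat_adjoint_mult mat_ring dv)
  also have "adj (poly_mat A ?p) * H = H * poly_mat A (map_poly cnj ?p)"
    by (rule poly_mat_adjoint) (auto simp: HA)
  also have "adj R * (H * poly_mat A (map_poly cnj ?p) * ?z) =
      H * (R * (poly_mat A (map_poly cnj ?p) * (poly_mat A q2 * (R * w))))"
    by (simp add: mat_ring dv mat_rewrite[OF HR[symmetric]])
  also have "poly_mat A (map_poly cnj ?p) * (poly_mat A q2 * (R * w)) =
      poly_mat A (map_poly cnj ?p * q2) * (R * w)"
    by (simp add: poly_mat_mult mat_ring dv)
  also have "R * (poly_mat A (map_poly cnj ?p * q2) * (R * w)) = poly_mat A (map_poly cnj ?p * q2) * (R * w)"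
    by (rule R_poly_R) (simp add: dv)
  also have "map_poly cnj ?p * q2 = [:-cnj l, 1:] ^ (k - 1) * (map_poly cnj q1 * q2)"
    by (simp only: map_poly_cnj_mult map_poly_cnj_power map_poly_cnj_linear mult.assoc)
  finally show ?thesis by (simp add: mat_ring dv)
qed

text \<open>p is the cofactor of (X - l)^k in an annihilating polynomial, so p(A) R v lies in the
  generalised eigenspace of l inside the range of \<open>R\<close>.\<close>

lemma chain_props:
  assumes v: "v \<in> carrier_mat (2 * n) 1"
    and ann: "poly_mat A ([:-l, 1:] ^ k * p) * R = zero"
  defines "X \<equiv> chain k (A - l \<cdot>\<^sub>m 1\<^sub>m (2 * n)) (poly_mat A p * (R * v))"
  shows "dim_row X = 2 * n" "dim_col X = k" "A * X = X * J k l" "R * X = X"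
proof -
  let ?N = "A - l \<cdot>\<^sub>m 1\<^sub>m (2 * n)" and ?x = "poly_mat A p * (R * v)"
  have dv: "dim_row v = 2 * n" "dim_col v = 1" using v by auto
  show "dim_row X = 2 * n" "dim_col X = k" by (auto simp: X_def)
  have N: "?N \<in> sq_mats (2 * n)" by (auto intro: carrier_matI)
  have x: "?x \<in> carrier_mat (2 * n) 1" using dv by (auto intro!: carrier_matI)
  have "?N ^\<^sub>m k * ?x = (poly_mat A ([:-l, 1:] ^ k * p) * R) * v"
    by (simp add: poly_mat_mult poly_mat_power linear_poly_mat mat_ring dv)
  then have nil: "?N ^\<^sub>m k * ?x = 0\<^sub>m (2 * n) 1" unfolding ann by (simp add: mat_ring dv)
  show "A * X = X * J k l" unfolding X_def
    by (rule chain_jordan_block[OF carriers(1) x refl nil])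
  have "R * X = chain k ?N (R * ?x)" unfolding X_def
    using poly_R_commute[of "[:-l, 1:]"] unfolding linear_poly_mat
    by (rule mult_chain[OF carriers(3) N x])
  also have "R * ?x = ?x" by (rule R_poly_R) (simp add: dv)
  finally show "R * X = X" by (simp add: X_def)
qed

lemma split_block:
  obtains d Y where "canon_data [d]" "dim_row Y = 2 * n" "dim_col Y = dim_row (canon_M [d])"
    "dim_col Y > 0" "R * Y = Y" "A * Y = Y * canon_M [d]" "adj Y * H * Y = canon_N [d]"
    "adj Y * H * quat_conj n Y = 0\<^sub>m (dim_col Y) (dim_col Y)"
proof -
  from obtain_root obtain mu k q' where mu: "Im mu \<le> 0" "k > 0"
    "poly_mat A ([:-mu, 1:] ^ k * q') * R = zero" "poly q' mu \<noteq> 0"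
    "\<And>u. poly u mu \<noteq> 0 \<Longrightarrow> poly_mat A ([:-mu, 1:] ^ (k - 1) * u) * R \<noteq> zero"
    by metis
  show thesis
  proof (cases "Im mu = 0")
    case True
    then have cmu: "cnj mu = mu" by (simp add: complex_eq_iff)
    \<comment> \<open>The left chain contributes the conjugate of q', the right one q' itself; at a
      real mu the product is nonzero.\<close>
    let ?u = "map_poly cnj q' * q'"
    let ?F = "H * (poly_mat A ([:-mu, 1:] ^ (k - 1) * ?u) * R)"
    have "poly ?u mu \<noteq> 0" using mu(4) cmu by simp
    from H_poly_R_nonzero[OF mu(5)[OF this]]
    have "?F \<noteq> zero" .
    moreover have "?F \<in> sq_mats (2 * n)" by (intro carrier_matI) auto
    ultimately obtain v where v: "v \<in> carrier_mat (2 * n) 1" "(adj v * (?F * v)) $$ (0, 0) \<noteq> 0"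
      using quadratic_nonzero by blast
    define X where "X = chain k (A - mu \<cdot>\<^sub>m 1\<^sub>m (2 * n)) (poly_mat A q' * (R * v))"
    note X = chain_props[OF v(1) mu(3), folded X_def]
    define K where "K = adj X * H * X"
    have K: "K \<in> sq_mats k" using X by (intro carrier_matI) (auto simp: K_def)
    have Kh: "adj K = K" using X herm by (simp add: K_def mat_adjoint_mult mat_ring)
    have Kc: "K * J k mu = adj (J k mu) * K"
      unfolding K_def using X by (intro gram_intertwines[OF carriers(1,2) HA]) auto
    have "K $$ (0, k - 1) = (adj v * (?F * v)) $$ (0, 0)"
      unfolding K_def X_def
      by (subst chain_gram_corner[OF v(1) v(1) mu(2)]) (auto simp: cmu intro!: carrier_matI)
    then have K0: "K $$ (0, k - 1) \<noteq> 0" using v(2) by simp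
    from intertwiner_normalise_real[OF K mu(2) Kh Kc True K0] obtain W and e :: int
      where W: "W \<in> sq_mats k" "J k mu * W = W * J k mu"
        "adj W * K * W = of_int e \<cdot>\<^sub>m Qmat k" and e: "e = 1 \<or> e = -1"
      by (metis (full_types))
    have dW: "dim_row W = k" "dim_col W = k" using W by auto
    let ?Y = "X * W"
    have AY: "A * ?Y = ?Y * J k mu"
      using X(1,2) dW by (simp add: mat_rewrite[OF X(3)] W(2) mat_ring)
    show thesis
    proof (rule that[of "(mu, k, e)" ?Y])
      show "canon_data [(mu, k, e)]" using True mu(2) e by (auto simp: canon_data_def)
      show "R * ?Y = ?Y" using X dW by (simp add: mat_rewrite1[OF X(4)])
      have "adj ?Y * H * ?Y = adj W * K * W"
        using X(1,2) dW by (simp add: K_def mat_adjoint_mult mat_ring)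
      then show "adj ?Y * H * ?Y = canon_N [(mu, k, e)]"
        using W(3) True by (simp add: canon_single)
      show "adj ?Y * H * quat_conj n ?Y = 0\<^sub>m (dim_col ?Y) (dim_col ?Y)"
        using gram_sym_skew_zero[OF _ _ AY] X dW by simp
    qed (use True AY X dW mu(2) in \<open>auto simp: canon_single\<close>)
  next
    case False
    then have im: "Im mu < 0" using mu(1) by simp
    define l where "l = cnj mu"
    have l: "Im l > 0" "l \<noteq> mu" "cnj l = mu" using im by (auto simp: l_def complex_eq_iff)
    \<comment> \<open>The left chain is built at l with the conjugate cofactor, which the adjoint
      turns back into q'. As two chains are involved, v and w may differ.\<close>
    let ?u = "q' * q'"
    let ?F = "H * (poly_mat A ([:-mu, 1:] ^ (k - 1) * ?u) * R)"
    have "poly ?u mu \<noteq> 0" using mu(4) by simp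
    from H_poly_R_nonzero[OF mu(5)[OF this]]
    have "?F \<noteq> zero" .
    moreover have "?F \<in> sq_mats (2 * n)" by (intro carrier_matI) auto
    ultimately obtain v w where v: "v \<in> carrier_mat (2 * n) 1" and w: "w \<in> carrier_mat (2 * n) 1"
      and vw: "(adj v * (?F * w)) $$ (0, 0) \<noteq> 0"
      using sesquilinear_nonzero by blast
    have cc: "map_poly cnj (map_poly cnj q') = q'" by (intro poly_eqI) (simp add: coeff_map_poly)
    have ann: "poly_mat A ([:-l, 1:] ^ k * map_poly cnj q') * R = zero"
      using annihilator_cnj[OF mu(3)]
      by (simp only: map_poly_cnj_mult map_poly_cnj_power map_poly_cnj_linear l_def)
    define X where "X = chain k (A - l \<cdot>\<^sub>m 1\<^sub>m (2 * n)) (poly_mat A (map_poly cnj q') * (R * v))"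
    define Z where "Z = chain k (A - mu \<cdot>\<^sub>m 1\<^sub>m (2 * n)) (poly_mat A q' * (R * w))"
    note X = chain_props[OF v ann, folded X_def]
    note Z = chain_props[OF w mu(3), folded Z_def]
    define K where "K = adj X * H * Z"
    have K: "K \<in> sq_mats k" using X Z by (intro carrier_matI) (auto simp: K_def)
    have Kc: "K * J k (cnj l) = adj (J k l) * K"
      unfolding K_def l(3) using X Z by (intro gram_intertwines[OF carriers(1,2) HA]) auto
    have "K $$ (0, k - 1) = (adj v * (?F * w)) $$ (0, 0)"
      unfolding K_def X_def Z_def
      by (subst chain_gram_corner[OF v w mu(2)]) (auto simp: cc l(3) intro!: carrier_matI)
    then have K0: "K $$ (0, k - 1) \<noteq> 0" using vw by simp
    from intertwiner_normalise_pair[OF K mu(2) Kc K0] obtain W where W: "W \<in> sq_mats k"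
      "J k mu * W = W * J k mu" "K * W = Qmat k" unfolding l(3) by blast
    have dW: "dim_row W = k" "dim_col W = k" using W by auto
    define Z' where "Z' = Z * W"
    have dZ': "dim_row Z' = 2 * n" "dim_col Z' = k" using Z dW by (auto simp: Z'_def)
    have AZ: "A * Z' = Z' * J k mu"
      using Z(1,2) dW by (simp add: Z'_def mat_rewrite[OF Z(3)] W(2) mat_ring)
    have RZ: "R * Z' = Z'" using Z dW by (simp add: Z'_def mat_rewrite1[OF Z(4)])
    have XZ: "adj X * H * Z' = Qmat k"
      using W(3) X(1,2) Z(1,2) dW by (simp add: Z'_def K_def mat_ring)
    have ZX: "adj Z' * H * X = Qmat k"
      using arg_cong[OF XZ, of adj] X(1,2) dZ' herm by (simp add: mat_adjoint_mult mat_ring)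
    \<comment> \<open>This covers \<open>XX\<close>, \<open>ZZ\<close>, \<open>XjZ\<close> and
      \<open>ZjX\<close>. A chain and its own j-image have conjugate eigenvalues, and there
      \<open>gram_sym_skew_zero\<close> takes over.\<close>
    have iso: "adj U * H * V = 0\<^sub>m k k"
      if "dim_row U = 2 * n" "dim_col U = k" "A * U = U * J k a"
        "dim_row V = 2 * n" "dim_col V = k" "A * V = V * J k b" "b \<noteq> cnj a" for U V a b
    proof (rule intertwiner_zero[of _ k k b a])
      show "adj U * H * V * J k b = adj (J k a) * (adj U * H * V)"
        using that by (intro gram_intertwines[OF carriers(1,2) HA]) auto
    qed (use that in \<open>auto intro!: carrier_matI\<close>)
    have XX: "adj X * H * X = 0\<^sub>m k k" using X l by (intro iso[of _ l _ l]) auto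
    have ZZ: "adj Z' * H * Z' = 0\<^sub>m k k"
      using dZ' AZ l by (intro iso[of _ mu _ mu]) (auto simp flip: l_def)
    have XjX: "adj X * H * quat_conj n X = 0\<^sub>m k k" by (rule gram_sym_skew_zero[OF X(1-3)])
    have ZjZ: "adj Z' * H * quat_conj n Z' = 0\<^sub>m k k" by (rule gram_sym_skew_zero[OF dZ' AZ])
    have AjZ: "A * quat_conj n Z' = quat_conj n Z' * J k l"
      using AZ dZ' by (simp add: quat_conj_Omega_mult[OF A] quat_conj_mult_right l_def)
    have XjZ: "adj X * H * quat_conj n Z' = 0\<^sub>m k k"
      using X dZ' AjZ l by (intro iso[of _ l _ l]) auto
    have ZjX: "adj Z' * H * quat_conj n X = 0\<^sub>m k k"
    proof -
      have AjX: "A * quat_conj n X = quat_conj n X * J k mu"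
        using X by (simp add: quat_conj_Omega_mult[OF A] quat_conj_mult_right l(3))
      show ?thesis using X dZ' AjX AZ l by (intro iso[of _ mu _ mu]) (auto simp flip: l_def)
    qed
    let ?Y = "hcat X Z'"
    have M: "canon_M [(l, k, 1)] = dsum (J k l) (J k mu)"
      and N: "canon_N [(l, k, 1)] = Qmat (2 * k)"
      using l by (auto simp: canon_single)
    show thesis
    proof (rule that[of "(l, k, 1)" ?Y])
      show "canon_data [(l, k, 1)]" using l mu(2) by (auto simp: canon_data_def)
      show "R * ?Y = ?Y" using X(1,4) RZ dZ' by (simp add: mult_hcat)
      have "A * ?Y = hcat (X * J k l) (Z' * J k mu)"
        using X(1,3) AZ dZ' by (simp add: mult_hcat)
      also have "\<dots> = ?Y * canon_M [(l, k, 1)]"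
        unfolding M dsum_four_block using X(1,2) dZ'
        by (subst hcat_mult_four_block) (auto simp: mat_ring)
      finally show "A * ?Y = ?Y * canon_M [(l, k, 1)]" .
      show "adj ?Y * H * ?Y = canon_N [(l, k, 1)]"
        unfolding N Qmat_double using X(1) dZ' by (simp add: gram_form_hcat XX XZ ZX ZZ)
      show "adj ?Y * H * quat_conj n ?Y = 0\<^sub>m (dim_col ?Y) (dim_col ?Y)"
        using X(1,2) dZ' by (simp add: quat_conj_hcat gram_form_hcat XjX XjZ ZjX ZjZ)
    qed (use X dZ' M mu(2) in auto)
  qed
qed

end

section \<open>Existence of the canonical form\<close>

text \<open>Padding with zeros to square size: the right inverse becomes a left inverse, which is
  impossible because the padded second factor has a zero row.\<close>

lemma mult_one_dim_le:
  fixes A B :: "complex mat"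
  assumes A: "A \<in> carrier_mat a b" and B: "B \<in> carrier_mat b a" and AB: "A * B = 1\<^sub>m a"
  shows "a \<le> b"
proof (rule ccontr)
  assume "\<not> a \<le> b"
  then obtain c where c: "a = b + c" "c > 0" by (metis less_imp_add_positive not_le)
  define A0 where "A0 = hcat A (0\<^sub>m a c)"
  define B0 where "B0 = mat a a (\<lambda>(i, j). if i < b then B $$ (i, j) else 0)"
  have A0: "A0 \<in> sq_mats a" and B0: "B0 \<in> sq_mats a"
    using A c by (auto simp: A0_def B0_def intro!: carrier_matI)
  have "A0 * B0 = A * B"
  proof (intro eq_matI)
    fix i j assume "i < dim_row (A * B)" "j < dim_col (A * B)"
    then have ij: "i < a" "j < a" using A B by auto
    have "(A0 * B0) $$ (i, j) = (\<Sum>l<dim_row B0. A0 $$ (i, l) * B0 $$ (l, j))"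
      using ij A0 B0 by (intro index_mult_sum) auto
    also have "\<dots> = (\<Sum>l<b + c. A0 $$ (i, l) * B0 $$ (l, j))" using B0 c by simp
    also have "\<dots> = (\<Sum>l<b. A $$ (i, l) * B $$ (l, j))"
      unfolding sum_lessThan_add using ij A c by (simp add: A0_def B0_def)
    also have "\<dots> = (\<Sum>l<dim_row B. A $$ (i, l) * B $$ (l, j))" using B by simp
    also have "\<dots> = (A * B) $$ (i, j)" using ij A B by (intro index_mult_sum[symmetric]) auto
    finally show "(A0 * B0) $$ (i, j) = (A * B) $$ (i, j)" .
  qed (use A0 B0 A B in auto)
  then have "B0 * A0 = 1\<^sub>m a" using mult_mat_left_inverse[OF A0 B0] AB by simp
  then have "(B0 * A0) $$ (b, b) = 1" using c by simp
  moreover have "(B0 * A0) $$ (b, b) = (\<Sum>l<dim_row A0. B0 $$ (b, l) * A0 $$ (l, b))"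
    using c A0 B0 by (intro index_mult_sum) auto
  moreover have "\<dots> = 0" using c A0 by (intro sum.neutral) (auto simp: B0_def)
  ultimately show False by simp
qed

lemma hcat_mult_adjoint_hcat:
  fixes X Y U V :: "complex mat"
  assumes "dim_row Y = dim_row X" "dim_row V = dim_row U" "dim_col U = dim_col X" "dim_col V = dim_col Y"
  shows "hcat X Y * adj (hcat U V) = X * adj U + Y * adj V"
  using assms
  by (intro eq_matI) (auto simp: index_mult_sum sum_lessThan_add)

text \<open>\<open>X\<close> is half of a partial quaternionic frame, \<open>quat_conj n X\<close>
  the other half. The last clause keeps the halves orthogonal, so the Gram matrix of the frame
  consists of two copies of \<open>canon_N D\<close>.\<close>

definition partial_form :: "nat \<Rightarrow> complex mat \<Rightarrow> complex mat \<Rightarrow> complex mat \<Rightarrow>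
    (complex \<times> nat \<times> int) list \<Rightarrow> bool" where
  "partial_form n A H X D \<longleftrightarrow> canon_data D \<and> dim_row X = 2 * n \<and> dim_col X = dim_row (canon_M D) \<and>
     A * X = X * canon_M D \<and> adj X * H * X = canon_N D \<and>
     adj X * H * quat_conj n X = 0\<^sub>m (dim_col X) (dim_col X)"

locale selfadjoint_pair =
  fixes n :: nat and A H :: "complex mat"
  assumes A: "A \<in> Omega n" and H: "H \<in> Omega n"
    and herm: "adj H = H" and inv: "\<exists>Hi \<in> sq_mats (2 * n). Hi * H = 1\<^sub>m (2 * n)"
    and HA: "H * A = adj A * H"
begin

lemma dims [simp]:
  "dim_row A = 2 * n" "dim_col A = 2 * n" "dim_row H = 2 * n" "dim_col H = 2 * n"
  using OmegaD[OF A] OmegaD[OF H] by auto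

context
  fixes X D Z p N M
  assumes pf: "partial_form n A H X D"
  defines "Z \<equiv> quat_conj n X" and "p \<equiv> dim_col X" and "N \<equiv> canon_N D" and "M \<equiv> canon_M D"
begin

lemma pf_dims:
  "dim_row X = 2 * n" "dim_col X = p" "dim_row Z = 2 * n" "dim_col Z = p"
  "dim_row N = p" "dim_col N = p" "dim_row M = p" "dim_col M = p"
  using pf by (auto simp: partial_form_def Z_def p_def N_def M_def)

lemma pf_facts:
  "canon_data D" "A * X = X * M" "A * Z = Z * conj_mat M" "N * N = 1\<^sub>m p"
  "adj N = N" "conj_mat N = N"
  "adj X * (H * X) = N" "adj X * (H * Z) = 0\<^sub>m p p"
  "adj Z * (H * X) = 0\<^sub>m p p" "adj Z * (H * Z) = N"
  "N * M = adj M * N"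
proof -
  note d = pf_dims
  show "canon_data D" using pf by (simp add: partial_form_def)
  then show "N * N = 1\<^sub>m p" using canon_N_square[of D] d by (simp add: N_def M_def)
  show n: "adj N = N" "conj_mat N = N" by (auto simp: N_def)
  show AX: "A * X = X * M" using pf by (simp add: partial_form_def M_def)
  then show "A * Z = Z * conj_mat M"
    using d by (simp add: Z_def quat_conj_Omega_mult[OF A] quat_conj_mult_right)
  have "adj X * H * X = N" "adj X * H * Z = 0\<^sub>m p p"
    using pf by (simp_all add: partial_form_def N_def Z_def p_def)
  then show XX: "adj X * (H * X) = N" and XZ: "adj X * (H * Z) = 0\<^sub>m p p"
    using d by (simp_all add: mat_ring)
  show "adj Z * (H * X) = 0\<^sub>m p p"
    using arg_cong[OF XZ, of adj] d herm by (simp add: mat_adjoint_mult mat_ring)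
  show "adj Z * (H * Z) = N"
    using gram_quat_conj_conj[OF H, of X X] d XX n by (simp add: Z_def mat_ring)
  show "N * M = adj M * N" unfolding N_def M_def by (rule canon_N_intertwines)
qed

lemma gram_frame: "adj (hcat X Z) * H * hcat X Z = dsum N N"
  unfolding dsum_four_block using pf_dims by (subst gram_form_hcat) (simp_all add: mat_ring pf_facts)

lemma frame_square: "dsum N N * dsum N N = 1\<^sub>m (2 * p)"
  using pf_dims by (simp add: dsum_mult pf_facts dsum_one mult_2)

lemma frame_intertwines: "A * hcat X Z = hcat X Z * dsum M (conj_mat M)"
proof -
  note d = pf_dims
  have "A * hcat X Z = hcat (X * M) (Z * conj_mat M)"
    using d by (simp add: mult_hcat pf_facts)
  also have "\<dots> = hcat X Z * dsum M (conj_mat M)"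
    unfolding dsum_four_block using d by (subst hcat_mult_four_block) (auto simp: mat_ring)
  finally show ?thesis .
qed

text \<open>The frame has an invertible Gram matrix, hence a left inverse, hence at most 2n
  columns.\<close>

lemma pf_bound: "p \<le> n"
proof -
  note d = pf_dims
  let ?S = "hcat X Z"
  have "(dsum N N * (adj ?S * H)) * ?S = dsum N N * (adj ?S * H * ?S)"
    using d by (simp add: mat_ring)
  also have "\<dots> = 1\<^sub>m (2 * p)" unfolding gram_frame by (rule frame_square)
  finally have "(dsum N N * (adj ?S * H)) * ?S = 1\<^sub>m (2 * p)" .
  then have "2 * p \<le> 2 * n" by (rule mult_one_dim_le[rotated -1]) (auto simp: d intro!: carrier_matI)
  then show ?thesis by simp
qed

text \<open>The orthogonal projection onto the complement of a frame S with Gram matrix G is 1 - S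
  G^(-1) S^* H; here S is \<open>hcat X Z\<close> and G is \<open>dsum N N\<close>, its own
  inverse.\<close>

definition cproj :: "complex mat" where
  "cproj = 1\<^sub>m (2 * n) - (X * (N * adj X) + Z * (N * adj Z)) * H"

lemma cproj_projection:
  assumes "p < n"
  shows "selfadjoint_projection n A H cproj" "cproj * X = 0\<^sub>m (2 * n) p" "cproj * Z = 0\<^sub>m (2 * n) p"
proof -
  note d = pf_dims and f = pf_facts
  define E where "E = X * (N * adj X) + Z * (N * adj Z)"
  define P where "P = E * H"
  have dE: "dim_row E = 2 * n" "dim_col E = 2 * n" using d by (auto simp: E_def)
  have dP: "dim_row P = 2 * n" "dim_col P = 2 * n" using dE by (auto simp: P_def)
  have R: "cproj = 1\<^sub>m (2 * n) - P" by (simp add: cproj_def P_def E_def)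
  have diff0: "Y - Y = 0\<^sub>m (dim_row Y) (dim_col Y)" for Y :: "complex mat" by (intro eq_matI) auto
  have PX: "P * X = X" and PZ: "P * Z = Z"
    using d by (simp_all add: P_def E_def mat_ring f)
  show RX: "cproj * X = 0\<^sub>m (2 * n) p" using d dP by (simp add: R mat_ring PX diff0)
  show RZ: "cproj * Z = 0\<^sub>m (2 * n) p" using d dP by (simp add: R mat_ring PZ diff0)
  have PP: "P * P = P"
  proof -
    have "P * P = ((P * X) * (N * adj X) + (P * Z) * (N * adj Z)) * H"
      unfolding P_def using d dE by (simp add: E_def mat_ring)
    then show ?thesis unfolding PX PZ by (simp add: P_def E_def)
  qed
  have diff_diff0: "Y - Z - (Z - Z) = Y - Z" if "dim_row Y = dim_row Z" "dim_col Y = dim_col Z"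
    for Y Z :: "complex mat" using that by (intro eq_matI) auto
  have RR: "cproj * cproj = cproj" using dP by (simp add: R mat_ring PP diff_diff0)
  have MN: "M * N = N * adj M"
  proof -
    have "M * N = N * (N * M) * N"
      using d by (simp add: mat_ring mat_rewrite1[OF f(4)])
    also have "\<dots> = N * adj M" unfolding f(11) using d by (simp add: mat_ring f(4))
    finally show ?thesis .
  qed
  have MN': "conj_mat M * N = N * adj (conj_mat M)"
  proof -
    show ?thesis using arg_cong[OF MN, of conj_mat] d by (simp add: conj_mat_mult f conj_mat_adjoint)
  qed
  have adjA: "adj X * adj A = adj M * adj X"
    "adj Z * adj A = adj (conj_mat M) * adj Z"
    using arg_cong[OF f(2), of adj] arg_cong[OF f(3), of adj] d
    by (simp_all add: mat_adjoint_mult)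
  have AP: "A * P = P * A"
    using d by (simp add: P_def E_def mat_ring HA mat_rewrite[OF f(2)]
        mat_rewrite[OF f(3)] mat_rewrite[OF MN] mat_rewrite[OF MN']
        mat_rewrite[OF adjA(1)] mat_rewrite[OF adjA(2)])
  have AR: "A * cproj = cproj * A" using dP by (simp add: R mat_ring AP)
  have HP: "H * P = adj P * H"
    using d by (simp add: P_def E_def mat_ring mat_adjoint_mult mat_adjoint_add herm f)
  have HR: "H * cproj = adj cproj * H"
    using dP by (simp add: R mat_ring mat_adjoint_diff HP)
  have ZJ: "quat_J n * conj_mat X = Z" by (simp add: Z_def quat_conj_def)
  have ZJ': "quat_J n * conj_mat Z = (-1) \<cdot>\<^sub>m X"
    using quat_conj_quat_conj[of X n] d by (simp add: Z_def quat_conj_def)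
  have XJ: "adj X * quat_J n = (-1) \<cdot>\<^sub>m adj (conj_mat Z)"
  proof -
    have "conj_mat Z = quat_J n * X" using d by (simp add: Z_def quat_conj_def conj_mat_mult)
    then show ?thesis using d by (simp add: mat_adjoint_mult adjoint_quat_J mat_ring smult_smult_mat)
  qed
  have ZJ2: "adj Z * quat_J n = adj (conj_mat X)"
    using d by (simp add: Z_def quat_conj_def mat_adjoint_mult adjoint_quat_J mat_ring quat_J_square smult_smult_mat)
  have comm: "U + V = V + U" if "dim_row U = dim_row V" "dim_col U = dim_col V" for U V :: "complex mat"
    using that by (intro eq_matI) auto
  \<comment> \<open>j exchanges X and Z up to sign, so it interchanges the two summands of
    \<open>E\<close>, with matching signs.\<close>
  have EJ: "quat_J n * conj_mat E = E * quat_J n"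
  proof -
    have "quat_J n * conj_mat E = Z * (N * adj (conj_mat X)) +
        (-1) \<cdot>\<^sub>m (X * (N * adj (conj_mat Z)))"
      using d by (simp add: E_def conj_mat_add conj_mat_mult f conj_mat_adjoint mat_ring
          mat_rewrite1[OF ZJ] mat_rewrite1[OF ZJ'])
    also have "\<dots> = E * quat_J n"
      using d by (simp add: E_def mat_ring XJ ZJ2 comm)
    finally show ?thesis .
  qed
  have PJ: "quat_J n * conj_mat P = P * quat_J n"
    using dE by (simp add: P_def conj_mat_mult mat_ring mat_rewrite[OF EJ] OmegaD(3)[OF H])
  have RO: "cproj \<in> Omega n" unfolding Omega_iff
    using dP by (auto simp: R conj_mat_diff mat_ring PJ intro!: carrier_matI)
  \<comment> \<open>Otherwise the identity of size 2n would factor through dimension 2p.\<close>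
  have R0: "cproj \<noteq> 0\<^sub>m (2 * n) (2 * n)"
  proof
    assume "cproj = 0\<^sub>m (2 * n) (2 * n)"
    then have z: "(1\<^sub>m (2 * n) - P) $$ (i, j) = 0" if "i < 2 * n" "j < 2 * n" for i j
      using that by (simp add: R)
    have "P = 1\<^sub>m (2 * n)"
    proof (intro eq_matI)
      fix i j assume "i < dim_row (1\<^sub>m (2 * n) :: complex mat)" "j < dim_col (1\<^sub>m (2 * n) :: complex mat)"
      then show "P $$ (i, j) = 1\<^sub>m (2 * n) $$ (i, j)" using z[of i j] dP by simp
    qed (auto simp: dP)
    moreover have "P = hcat X Z * (adj (hcat (X * N) (Z * N)) * H)"
    proof -
      have "hcat X Z * adj (hcat (X * N) (Z * N)) = E"
        using d by (subst hcat_mult_adjoint_hcat) (auto simp: E_def mat_adjoint_mult f)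
      then show ?thesis using d by (simp add: P_def mat_ring flip: mult_mat_assoc)
    qed
    ultimately have "hcat X Z * (adj (hcat (X * N) (Z * N)) * H) = 1\<^sub>m (2 * n)" by simp
    then have "2 * n \<le> 2 * p" by (rule mult_one_dim_le[rotated -1]) (auto simp: d intro!: carrier_matI)
    then show False using assms by simp
  qed
  show "selfadjoint_projection n A H cproj"
    by unfold_locales (use A H RO herm inv HA HR AR RR R0 in auto)
qed

lemma pf_extend:
  assumes "p < n"
  obtains X' D' where "partial_form n A H X' D'" "dim_col X' > p"
proof -
  note d = pf_dims and f = pf_facts
  note R = cproj_projection[OF assms]
  interpret sp: selfadjoint_projection n A H cproj by (rule R(1))
  obtain e Y where Y: "canon_data [e]" "dim_row Y = 2 * n" "dim_col Y = dim_row (canon_M [e])"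
    "dim_col Y > 0" "cproj * Y = Y" "A * Y = Y * canon_M [e]" "adj Y * H * Y = canon_N [e]"
    "adj Y * H * quat_conj n Y = 0\<^sub>m (dim_col Y) (dim_col Y)"
    using sp.split_block by blast
  have dR: "dim_row cproj = 2 * n" "dim_col cproj = 2 * n" by (rule sp.dims)+
  have YH: "adj Y * H * U = 0\<^sub>m (dim_col Y) p"
    if "cproj * U = 0\<^sub>m (2 * n) p" "dim_row U = 2 * n" "dim_col U = p" for U
  proof -
    have "adj Y * H * U = adj (cproj * Y) * H * U" unfolding Y(5) ..
    also have "\<dots> = adj Y * (H * (cproj * U))"
      using Y(2) that(2) dR by (simp add: mat_adjoint_mult mat_ring mat_rewrite[OF sp.HR])
    finally show ?thesis unfolding that(1) using Y(2) by (simp add: mat_ring)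
  qed
  have YX: "adj Y * H * X = 0\<^sub>m (dim_col Y) p" by (rule YH) (use R d in auto)
  have YZ: "adj Y * H * Z = 0\<^sub>m (dim_col Y) p" by (rule YH) (use R d in auto)
  have XY: "adj X * H * Y = 0\<^sub>m p (dim_col Y)"
    using arg_cong[OF YX, of adj] d Y(2) herm by (simp add: mat_adjoint_mult mat_ring)
  \<comment> \<open>Skew-symmetry of [x, j y] reduces this to the pairing of Y with the j-image of
    X, which vanishes by \<open>YZ\<close>.\<close>
  have XjY: "adj X * H * quat_conj n Y = 0\<^sub>m p (dim_col Y)"
  proof -
    have "transpose_mat (adj X * H * quat_conj n Y) = (-1) \<cdot>\<^sub>m (adj Y * H * quat_conj n X)"
      by (rule gram_quat_conj_skew[OF H herm]) (use d Y(2) in auto)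
    also have "\<dots> = 0\<^sub>m (dim_col Y) p" using YZ unfolding Z_def by (intro eq_matI) auto
    finally have "transpose_mat (transpose_mat (adj X * H * quat_conj n Y)) = transpose_mat (0\<^sub>m (dim_col Y) p)"
      by simp
    then show ?thesis by simp
  qed
  have XX: "adj X * H * X = N" using f(7) d by (simp add: mat_ring)
  have XZ: "adj X * H * Z = 0\<^sub>m p p" using f(8) d by (simp add: mat_ring)
  have "partial_form n A H (hcat Y X) (e # D)"
    unfolding partial_form_def
  proof (intro conjI)
    show "canon_data (e # D)" using Y(1) f(1) canon_data_Cons[of e D] by simp
    show "dim_row (hcat Y X) = 2 * n" using Y(2) by simp
    show "dim_col (hcat Y X) = dim_row (canon_M (e # D))"
      unfolding canon_Cons[of e D] using Y(3) d by (simp add: M_def)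
    have "A * hcat Y X = hcat (Y * canon_M [e]) (X * M)"
      using Y(2,6) d f(2) by (simp add: mult_hcat)
    also have "\<dots> = hcat Y X * dsum (canon_M [e]) M"
      unfolding dsum_four_block using d Y(2,3) by (subst hcat_mult_four_block) (auto simp: mat_ring)
    finally show "A * hcat Y X = hcat Y X * canon_M (e # D)" unfolding canon_Cons[of e D] M_def .
    have "adj (hcat Y X) * H * hcat Y X = dsum (canon_N [e]) N"
      unfolding dsum_four_block using Y(2,3,7) d by (simp add: gram_form_hcat YX XY XX)
    then show "adj (hcat Y X) * H * hcat Y X = canon_N (e # D)"
      unfolding canon_Cons[of e D] N_def .
    show "adj (hcat Y X) * H * quat_conj n (hcat Y X) = 0\<^sub>m (dim_col (hcat Y X)) (dim_col (hcat Y X))"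
      using Y(2,8) d by (simp add: quat_conj_hcat gram_form_hcat Z_def[symmetric] YZ XZ XjY)
  qed
  then show thesis using that[of "hcat Y X" "e # D"] Y(4) d by simp
qed

end

lemma partial_form_complete:
  assumes "partial_form n A H X D"
  shows "\<exists>X' D'. partial_form n A H X' D' \<and> dim_col X' = n"
  using assms
proof (induction "n - dim_col X" arbitrary: X D rule: less_induct)
  case less
  show ?case
  proof (cases "dim_col X = n")
    case True
    then show ?thesis using less.prems by blast
  next
    case False
    then have lt: "dim_col X < n" using pf_bound[OF less.prems] by simp
    from pf_extend[OF less.prems lt] obtain X' D' where "partial_form n A H X' D'" "dim_col X' > dim_col X" .
    then show ?thesis using less.hyps[of X' D'] lt by simp
  qed
qed

theorem canonical_form_exists: "\<exists>D S. is_canonical_form n A H D S"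
proof -
  have "partial_form n A H (0\<^sub>m (2 * n) 0) []"
    unfolding partial_form_def by (auto simp: canon_data_def intro!: eq_matI)
  from partial_form_complete[OF this] obtain X D where pf: "partial_form n A H X D" and n: "dim_col X = n"
    by blast
  note d = pf_dims[OF pf, unfolded n]
  let ?S = "hcat X (quat_conj n X)"
  have dS: "dim_row ?S = 2 * n" "dim_col ?S = 2 * n" using d by auto
  have S: "?S \<in> sq_mats (2 * n)" using dS by (intro carrier_matI)
  \<comment> \<open>j maps the columns X, jX to jX, -X, which is what right multiplication by
    \<open>quat_J n\<close> does to them.\<close>
  have "quat_J n * conj_mat ?S = ?S * quat_J n"
  proof -
    have "quat_J n * conj_mat ?S = hcat (quat_conj n X) ((-1) \<cdot>\<^sub>m X)"
      using d quat_conj_quat_conj[of X n] quat_conj_hcat[of X n "quat_conj n X"]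
      by (simp add: quat_conj_def[symmetric])
    also have "\<dots> = ?S * quat_J n"
      using d by (intro eq_matI) (auto simp: mult_quat_J)
    finally show ?thesis .
  qed
  then have SO: "?S \<in> Omega n" using S by (simp add: Omega_iff)
  have g: "adj ?S * H * ?S = dsum (canon_N D) (canon_N D)" by (rule gram_frame[OF pf])
  have H': "H \<in> sq_mats (2 * n)" by (intro carrier_matI) auto
  have N': "dsum (canon_N D) (canon_N D) \<in> sq_mats (2 * n)"
    using d by (intro carrier_matI) auto
  from left_invertible_from_gram[OF S H' N' g frame_square[OF pf, unfolded n]]
  obtain Si where Si: "Si \<in> sq_mats (2 * n)" "?S * Si = 1\<^sub>m (2 * n)" "Si * ?S = 1\<^sub>m (2 * n)"
    by blast
  have "Si * A * ?S = Si * (?S * dsum (canon_M D) (conj_mat (canon_M D)))"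
    unfolding frame_intertwines[OF pf, symmetric] using Si(1) dS by (simp add: mat_ring)
  also have "\<dots> = dsum (canon_M D) (canon_M' D)"
    using Si(1) dS d by (simp add: mat_rewrite1[OF Si(3)] mat_ring canon_M'_conj)
  finally have "Si * A * ?S = dsum (canon_M D) (canon_M' D)" .
  then show ?thesis unfolding is_canonical_form_def using pf_facts(1)[OF pf] SO Si g by blast
qed

end

section \<open>Roots and the two conditions\<close>

lemma conj_pow_mat: "dim_row Z = dim_col Z \<Longrightarrow> conj_mat (Z ^\<^sub>m r) = conj_mat Z ^\<^sub>m r"
  by (induction r) (auto simp: conj_mat_mult)

lemma pow_mat_similar:
  fixes A :: "complex mat"
  assumes "A \<in> sq_mats d" "S \<in> sq_mats d" "Si \<in> sq_mats d"
    "S * Si = 1\<^sub>m d" "Si * S = 1\<^sub>m d"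
  shows "Si * A ^\<^sub>m r * S = (Si * A * S) ^\<^sub>m r"
proof (induction r)
  case (Suc r)
  have d: "dim_row A = d" "dim_col A = d" "dim_row S = d" "dim_col S = d" "dim_row Si = d" "dim_col Si = d"
    using assms by auto
  have "(Si * A * S) ^\<^sub>m Suc r = (Si * A ^\<^sub>m r * S) * (Si * A * S)" using Suc by simp
  also have "\<dots> = Si * A ^\<^sub>m Suc r * S"
    by (simp add: d mat_ring mat_rewrite1[OF assms(4)])
  finally show ?case by simp
qed (use assms in \<open>auto simp: mat_ring\<close>)

text \<open>The basis change \<open>T\<close> acts on the frame through
  \<open>dsum T (conj_mat T)\<close>, so the new frame stays in \<open>Omega n\<close>. This leads
  back from one complex copy to the full matrices.\<close>

lemma Omega_frame_transport:
  assumes S: "S \<in> Omega n" and Si: "Si \<in> sq_mats (2 * n)"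
    and SSi: "S * Si = 1\<^sub>m (2 * n)" and SiS: "Si * S = 1\<^sub>m (2 * n)"
    and B: "B \<in> sq_mats (2 * n)" and H: "H \<in> sq_mats (2 * n)"
    and M: "M \<in> sq_mats n" "Si * B * S = dsum M (conj_mat M)"
    and N: "adj S * H * S = dsum N (conj_mat N)"
    and cong: "pair_cong M N M' N'"
  shows "\<exists>S' Si'. S' \<in> Omega n \<and> Si' \<in> sq_mats (2 * n) \<and> S' * Si' = 1\<^sub>m (2 * n) \<and>
    Si' * S' = 1\<^sub>m (2 * n) \<and> Si' * B * S' = dsum M' (conj_mat M') \<and>
    adj S' * H * S' = dsum N' (conj_mat N')"
proof -
  from cong M(1) obtain T Ti where T: "T \<in> sq_mats n" "Ti \<in> sq_mats n"
    "N \<in> sq_mats n" "M' \<in> sq_mats n" "N' \<in> sq_mats n"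
    "T * Ti = 1\<^sub>m n" "Ti * T = 1\<^sub>m n" "M * T = T * M'" "adj T * N * T = N'"
    unfolding pair_cong_def by auto
  have d: "dim_row T = n" "dim_col T = n" "dim_row Ti = n" "dim_col Ti = n" "dim_row N = n" "dim_col N = n"
    "dim_row M = n" "dim_col M = n" "dim_row M' = n" "dim_col M' = n"
    "dim_row S = 2 * n" "dim_col S = 2 * n" "dim_row Si = 2 * n" "dim_col Si = 2 * n"
    "dim_row B = 2 * n" "dim_col B = 2 * n" "dim_row H = 2 * n" "dim_col H = 2 * n"
    using T M(1) Si B H OmegaD[OF S] by auto
  let ?U = "dsum T (conj_mat T)" and ?V = "dsum Ti (conj_mat Ti)"
  have c: "conj_mat T * conj_mat Ti = 1\<^sub>m n" "conj_mat Ti * conj_mat T = 1\<^sub>m n"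
    "conj_mat M * conj_mat T = conj_mat T * conj_mat M'"
    "adj (conj_mat T) * (conj_mat N * conj_mat T) = conj_mat N'"
    using arg_cong[OF T(6), of conj_mat] arg_cong[OF T(7), of conj_mat]
      arg_cong[OF T(8), of conj_mat] arg_cong[OF T(9), of conj_mat] d
    by (simp_all add: conj_mat_mult conj_mat_adjoint mat_ring)
  have UV: "?U * ?V = 1\<^sub>m (2 * n)" "?V * ?U = 1\<^sub>m (2 * n)"
    using d by (simp_all add: dsum_mult T(6,7) c dsum_one mult_2)
  have dUV: "dim_row ?U = 2 * n" "dim_col ?U = 2 * n" "dim_row ?V = 2 * n" "dim_col ?V = 2 * n"
    using d by auto
  have 1: "S * ?U \<in> Omega n" by (rule Omega_mult[OF S dsum_conj_Omega[OF T(1)]])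
  have 2: "?V * Si \<in> sq_mats (2 * n)" using dUV d by (intro carrier_matI) auto
  have 3: "S * ?U * (?V * Si) = 1\<^sub>m (2 * n)"
    using dUV d by (simp add: mat_ring mat_rewrite1[OF UV(1)] SSi)
  have 4: "?V * Si * (S * ?U) = 1\<^sub>m (2 * n)"
    using dUV d by (simp add: mat_ring mat_rewrite1[OF SiS] UV(2))
  have "?V * Si * B * (S * ?U) = ?V * (Si * B * S) * ?U" using dUV d by (simp add: mat_ring)
  also have "\<dots> = dsum M' (conj_mat M')" unfolding M(2)
    using d by (simp add: dsum_mult T(8) c(3) mat_ring mat_rewrite1[OF T(7)]
        mat_rewrite1[OF c(2)])
  finally have 5: "?V * Si * B * (S * ?U) = dsum M' (conj_mat M')" .
  have "adj (S * ?U) * H * (S * ?U) = adj ?U * (adj S * H * S) * ?U"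
    using dUV d by (simp add: mat_ring mat_adjoint_mult)
  also have "\<dots> = dsum (adj T * N * T) (conj_mat N')" unfolding N
    using d c(4) by (simp add: adjoint_dsum dsum_mult mat_ring)
  finally have 6: "adj (S * ?U) * H * (S * ?U) = dsum N' (conj_mat N')" unfolding T(9) .
  show ?thesis using 1 2 3 4 5 6 by blast
qed

text \<open>The root problem in one complex copy; a solution \<open>Z\<close> yields the
  quaternionic matrix \<open>dsum Z (conj_mat Z)\<close>.\<close>

definition rootable :: "nat \<Rightarrow> complex mat \<Rightarrow> complex mat \<Rightarrow> bool" where
  "rootable m M N \<longleftrightarrow> (\<exists>k. \<exists>Z \<in> sq_mats k. N \<in> sq_mats k \<and> Z ^\<^sub>m m = M \<and> N * Z = adj Z * N)"

lemma rootable_cong: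
  assumes "rootable m M N" "pair_cong M N M' N'"
  shows "rootable m M' N'"
proof -
  from assms(1) obtain k Z where Z: "Z \<in> sq_mats k" "N \<in> sq_mats k" "Z ^\<^sub>m m = M"
    "N * Z = adj Z * N" unfolding rootable_def by auto
  from assms(2) Z(2) obtain T Ti where T: "T \<in> sq_mats k" "Ti \<in> sq_mats k"
    "M' \<in> sq_mats k" "N' \<in> sq_mats k"
    "T * Ti = 1\<^sub>m k" "Ti * T = 1\<^sub>m k" "M * T = T * M'" "adj T * N * T = N'"
    unfolding pair_cong_def by auto
  have d: "dim_row T = k" "dim_col T = k" "dim_row Ti = k" "dim_col Ti = k" "dim_row N = k" "dim_col N = k"
    "dim_row Z = k" "dim_col Z = k" "dim_row M' = k" "dim_col M' = k"
    using T Z by auto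
  have "(Ti * Z * T) ^\<^sub>m m = Ti * (M * T)"
    using pow_mat_similar[OF Z(1) T(1,2,5,6), of m] Z(3) d carrier_matD[OF pow_carrier_mat[OF Z(1), of m]]
    by (simp add: mat_ring)
  also have "\<dots> = M'" unfolding T(7) using d by (simp add: mat_rewrite1[OF T(6)] mat_ring)
  finally have 1: "(Ti * Z * T) ^\<^sub>m m = M'" .
  have a: "adj Ti * adj T = 1\<^sub>m k" "adj T * adj Ti = 1\<^sub>m k"
    using arg_cong[OF T(5), of adj] arg_cong[OF T(6), of adj] d
    by (simp_all add: mat_adjoint_mult)
  have 2: "N' * (Ti * Z * T) = adj (Ti * Z * T) * N'"
    unfolding T(8)[symmetric] using d
    by (simp add: mat_ring mat_adjoint_mult mat_rewrite1[OF T(5)] mat_rewrite1[OF a(1)]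
        mat_rewrite[OF Z(4)])
  show ?thesis unfolding rootable_def
    by (intro exI[of _ k] bexI[of _ "Ti * Z * T"] conjI 1 2 T(4)) (use d in \<open>auto intro!: carrier_matI\<close>)
qed

lemma rootable_dsum:
  assumes "rootable m M N" "rootable m M' N'"
  shows "rootable m (dsum M M') (dsum N N')"
proof -
  from assms(1) obtain k Z where Z: "Z \<in> sq_mats k" "N \<in> sq_mats k" "Z ^\<^sub>m m = M"
    "N * Z = adj Z * N" unfolding rootable_def by auto
  from assms(2) obtain j Y where Y: "Y \<in> sq_mats j" "N' \<in> sq_mats j" "Y ^\<^sub>m m = M'"
    "N' * Y = adj Y * N'" unfolding rootable_def by auto
  have d: "dim_row Z = k" "dim_col Z = k" "dim_row N = k" "dim_col N = k"
    "dim_row Y = j" "dim_col Y = j" "dim_row N' = j" "dim_col N' = j" using Z Y by auto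
  show ?thesis unfolding rootable_def
    by (intro exI[of _ "k + j"] bexI[of _ "dsum Z Y"] conjI carrier_matI)
      (simp_all add: d dsum_power dsum_mult adjoint_dsum Z(3,4) Y(3,4))
qed

lemma rootable_canon_power:
  assumes "pair_cong (canon_M D ^\<^sub>m m) (canon_N D) M N"
  shows "rootable m M N"
proof (rule rootable_cong[OF _ assms])
  show "rootable m (canon_M D ^\<^sub>m m) (canon_N D)"
    unfolding rootable_def using canon_carrier canon_N_intertwines by blast
qed

text \<open>Phrased for multisets because the two conditions present the blocks as sums of
  multisets; since reordering blocks is a basis change, one ordering decides for all.\<close>

definition rootable_blocks :: "nat \<Rightarrow> (complex \<times> nat \<times> int) multiset \<Rightarrow> bool" where
  "rootable_blocks m X \<longleftrightarrow> (\<forall>D. mset D = X \<longrightarrow> rootable m (canon_M D) (canon_N D))"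

lemma rootable_blocksI:
  assumes "rootable m (canon_M D) (canon_N D)" "mset D = X"
  shows "rootable_blocks m X"
  unfolding rootable_blocks_def using rootable_cong[OF assms(1) pair_cong_canon_mset] assms(2) by simp

lemma canon_M_Nil_power: "canon_M [] ^\<^sub>m m = canon_M []"
  by (intro eq_matI) auto

lemma rootable_blocks_empty: "rootable_blocks m {#}"
proof (rule rootable_blocksI[of _ "[]"])
  have "pair_cong (canon_M [] ^\<^sub>m m) (canon_N []) (canon_M []) (canon_N [])"
    unfolding canon_M_Nil_power using pair_cong_refl[OF canon_carrier] .
  then show "rootable m (canon_M []) (canon_N [])" by (rule rootable_canon_power)
qed auto

lemma rootable_blocks_add:
  assumes "rootable_blocks m X" "rootable_blocks m Y"
  shows "rootable_blocks m (X + Y)"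
proof -
  obtain D E where D: "mset D = X" "mset E = Y" by (metis ex_mset)
  then have "rootable m (canon_M D) (canon_N D)" "rootable m (canon_M E) (canon_N E)"
    using assms by (auto simp: rootable_blocks_def)
  then have "rootable m (canon_M (D @ E)) (canon_N (D @ E))"
    unfolding canon_append by (rule rootable_dsum)
  then show ?thesis by (rule rootable_blocksI) (use D in auto)
qed

lemma rootable_blocks_sum:
  "(\<And>j. j < t \<Longrightarrow> rootable_blocks m (F j)) \<Longrightarrow> rootable_blocks m (\<Sum>j<(t :: nat). F j)"
  by (induction t) (auto simp: rootable_blocks_empty rootable_blocks_add)

lemma rootable_blocks_mset:
  "(\<And>d. d \<in> set D \<Longrightarrow> rootable_blocks m {#d#}) \<Longrightarrow> rootable_blocks m (mset D)"
proof (induction D)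
  case (Cons d D)
  then show ?case using rootable_blocks_add[of m "{#d#}" "mset D"] by simp
qed (simp add: rootable_blocks_empty)

section \<open>Roots of single blocks and of pairs with opposite signs\<close>

lemma complex_root_exists:
  assumes "m > 0"
  obtains z :: complex where "z ^ m = c"
proof -
  have "rcis (root m (cmod c)) (Arg c / real m) ^ m = rcis (cmod c) (Arg c)"
    using assms by (simp add: DeMoivre2)
  then show thesis using that by (simp add: rcis_cmod_Arg)
qed

lemma real_power_of_Im_zero: "Im z = 0 \<Longrightarrow> z ^ m = complex_of_real (Re z ^ m)"
  by (metis complex_eq_iff complex_of_real_def of_real_power complex.sel)

lemma pair_cong_pair_canon:
  assumes "Im z \<noteq> 0" "k > 0" "m > 0" "Im (z ^ m) \<noteq> 0"
  shows "pair_cong (canon_M [(z, k, 1)] ^\<^sub>m m) (canon_N [(z, k, 1)])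
    (canon_M [(z ^ m, k, 1)]) (canon_N [(z ^ m, k, 1)])"
proof -
  have "z \<noteq> 0" using assms by auto
  from pair_cong_power_pair[OF this assms(2,3)] show ?thesis
    using assms by (simp add: canon_single)
qed

text \<open>When z^m is real the two conjugate eigenvalues coalesce, and a flip between two equal
  blocks splits into opposite signs.\<close>

lemma pair_cong_pair_split:
  assumes "Im z \<noteq> 0" "k > 0" "m > 0" "Im (z ^ m) = 0"
  shows "pair_cong (canon_M [(z, k, 1)] ^\<^sub>m m) (canon_N [(z, k, 1)])
    (canon_M [(z ^ m, k, 1), (z ^ m, k, -1)]) (canon_N [(z ^ m, k, 1), (z ^ m, k, -1)])"
proof -
  have c: "cnj (z ^ m) = z ^ m" using assms(4) by (simp add: complex_eq_iff del: complex_cnj_power)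
  have "z \<noteq> 0" using assms by auto
  from pair_cong_power_pair[OF this assms(2,3), unfolded c]
  have "pair_cong (canon_M [(z, k, 1)] ^\<^sub>m m) (canon_N [(z, k, 1)])
      (dsum (J k (z ^ m)) (J k (z ^ m))) (Qmat (2 * k))"
    using assms by (simp add: canon_single)
  moreover have "pair_cong (dsum (J k (z ^ m)) (J k (z ^ m))) (Qmat (2 * k))
      (canon_M [(z ^ m, k, 1), (z ^ m, k, -1)]) (canon_N [(z ^ m, k, 1), (z ^ m, k, -1)])"
    using pair_cong_split_real[OF assms(4,2), of 1] by simp
  ultimately show ?thesis by (rule pair_cong_trans)
qed

lemma rootable_single:
  assumes "canon_data [(l, k, e)]" "l \<noteq> 0" "m > 0" "even m \<Longrightarrow> \<not> (Im l = 0 \<and> Re l < 0)"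
  shows "rootable_blocks m {#(l, k, e)#}"
proof -
  have k: "k > 0" using assms(1) by (auto simp: canon_data_def)
  show ?thesis
  proof (cases "Im l = 0")
    case True
    then have e: "e = 1 \<or> e = -1" using assms(1) by (auto simp: canon_data_def)
    define c where "c = complex_of_real (root m (Re l))"
    have "root m (Re l) ^ m = Re l"
    proof (cases "Re l \<ge> 0")
      case True
      then show ?thesis using assms(3) by simp
    next
      case False
      then have "odd m" using assms(4) \<open>Im l = 0\<close> by auto
      then show ?thesis by (rule odd_real_root_pow)
    qed
    then have c: "c ^ m = l" using True by (simp add: c_def complex_eq_iff flip: of_real_power)
    have c0: "Im c = 0" "c \<noteq> 0" using c assms(2,3) by (auto simp: c_def)
    from pair_cong_power_real[OF c0 k assms(3)] obtain s where s: "s = 1 \<or> s = -1"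
      "\<And>e. e = 1 \<or> e = -1 \<Longrightarrow> pair_cong (J k c ^\<^sub>m m) (of_int e \<cdot>\<^sub>m Qmat k)
        (canon_M [(c ^ m, k, e * s)]) (canon_N [(c ^ m, k, e * s)])" by blast
    \<comment> \<open>The m-th power multiplies the sign by s, so starting from e * s gives back
      e.\<close>
    have "e * s = 1 \<or> e * s = -1" and ess: "e * s * s = e" using e s(1) by auto
    from s(2)[OF this(1)] have "pair_cong (canon_M [(c, k, e * s)] ^\<^sub>m m) (canon_N [(c, k, e * s)])
        (canon_M [(l, k, e)]) (canon_N [(l, k, e)])"
      unfolding ess c using c0 by (simp add: canon_single)
    from rootable_canon_power[OF this] show ?thesis by (rule rootable_blocksI) simp
  next
    case False
    then have e: "e = 1" using assms(1) by (auto simp: canon_data_def)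
    \<comment> \<open>The chosen c may lie in the lower half plane: \<open>canon_M\<close> still
      assigns a conjugate pair to it, and only the target block has to be canonical.\<close>
    obtain c where c: "c ^ m = l" using complex_root_exists[OF assms(3)] .
    then have "Im c \<noteq> 0" using False real_power_of_Im_zero[of c m] by auto
    from pair_cong_pair_canon[OF this k assms(3)] False c
    have "pair_cong (canon_M [(c, k, 1)] ^\<^sub>m m) (canon_N [(c, k, 1)])
        (canon_M [(l, k, 1)]) (canon_N [(l, k, 1)])" by auto
    from rootable_canon_power[OF this] show ?thesis unfolding e by (rule rootable_blocksI) simp
  qed
qed

text \<open>For even m a negative number has only nonreal m-th roots, so the root is a conjugate
  pair, whose power delivers both signs at once.\<close>

lemma rootable_negative_pair:
  assumes "even m" "m > 0" "k > 0" "x < 0"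
  shows "rootable_blocks m {#(complex_of_real x, k, 1), (complex_of_real x, k, -1)#}"
proof -
  obtain c where c: "c ^ m = complex_of_real x" using complex_root_exists[OF assms(2)] .
  have "Im c \<noteq> 0"
  proof
    assume "Im c = 0"
    then have "complex_of_real (Re c ^ m) = complex_of_real x"
      using real_power_of_Im_zero[of c m] c by metis
    then have "Re c ^ m = x" by (simp only: of_real_eq_iff)
    moreover have "Re c ^ m \<ge> 0" using assms(1) by (simp add: zero_le_even_power)
    ultimately show False using assms(4) by simp
  qed
  from pair_cong_pair_split[OF this assms(3,2)] c
  have "pair_cong (canon_M [(c, k, 1)] ^\<^sub>m m) (canon_N [(c, k, 1)])
      (canon_M [(complex_of_real x, k, 1), (complex_of_real x, k, -1)])
      (canon_N [(complex_of_real x, k, 1), (complex_of_real x, k, -1)])" by auto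
  from rootable_canon_power[OF this] show ?thesis by (rule rootable_blocksI) simp
qed

text \<open>One group of the condition at zero. For admissible signs it is the canonical form of the
  m-th power of a single nilpotent block of size a*m + r, see
  \<open>pair_cong_zero_group\<close>.\<close>

definition zero_group :: "nat \<Rightarrow> nat \<Rightarrow> nat \<Rightarrow> (nat \<Rightarrow> int) \<Rightarrow> (complex \<times> nat \<times> int) list" where
  "zero_group m a r eps = map (\<lambda>i. (0, a + 1, eps i)) [0..<r] @
     filter (\<lambda>(_, k, _). k \<noteq> 0) (map (\<lambda>i. (0, a, eps i)) [r..<m])"

definition group_signs :: "nat \<Rightarrow> nat \<Rightarrow> int \<Rightarrow> (nat \<Rightarrow> int) \<Rightarrow> bool" where
  "group_signs m r eta eps \<longleftrightarrow> 0 < r \<and> r \<le> m \<and> (\<forall>i<m. eps i = 1 \<or> eps i = -1) \<and>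
     (eta = 1 \<or> eta = -1) \<and> sign_balanced eta (map eps [0..<r]) \<and> sign_balanced eta (map eps [r..<m])"

lemma zero_condition_iff:
  "zero_condition m D \<longleftrightarrow> (\<exists>(t :: nat) a r eps. (\<forall>j<t. \<exists>eta. group_signs m (r j) eta (eps j)) \<and>
     mset (filter (\<lambda>(l, _, _). l = 0) D) = (\<Sum>j<t. mset (zero_group m (a j) (r j) (eps j))))"
  unfolding zero_condition_def zero_group_def group_signs_def mset_append by (simp only: ex_simps)

lemma pair_cong_zero_group:
  assumes "group_signs m r e eps"
  shows "pair_cong (canon_M [(0, a * m + r, e)] ^\<^sub>m m) (canon_N [(0, a * m + r, e)])
    (canon_M (zero_group m a r eps)) (canon_N (zero_group m a r eps))"
proof -
  note g = assms[unfolded group_signs_def]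
  have e1: "eps i \<in> {1, -1}" if "i < m" for i using g that by auto
  have "set (map eps [0..<r]) \<subseteq> {1, -1}" "set (map eps [r..<m]) \<subseteq> {1, -1}"
    using e1 g by (simp_all add: image_subset_iff)
  with g pair_cong_power_zero[of r m e "map eps [0..<r]" "map eps [r..<m]" a]
  show ?thesis by (simp add: canon_single zero_group_def comp_def)
qed

text \<open>The blocks are sorted into eigenvalue zero, negative eigenvalues and the rest. Groups at
  zero and, for even m, negative pairs are handled as units, everything else block by block.\<close>

lemma rootable_conditions:
  assumes D: "canon_data D" and m: "m > 0" and neg: "even m \<Longrightarrow> neg_condition D"
    and zero: "zero_condition m D"
  shows "rootable m (canon_M D) (canon_N D)"
proof -
  let ?z = "\<lambda>(l :: complex, _ :: nat, _ :: int). l = 0"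
  let ?n = "\<lambda>(l :: complex, _ :: nat, _ :: int). Im l = 0 \<and> Re l < 0"
  have Z: "rootable_blocks m (mset (filter ?z D))"
  proof -
    from zero[unfolded zero_condition_iff] obtain t :: nat and a r eps
      where c: "\<forall>j<t. \<exists>eta. group_signs m (r j) eta (eps j)"
        and ms: "mset (filter ?z D) = (\<Sum>j<t. mset (zero_group m (a j) (r j) (eps j)))" by blast
    show ?thesis unfolding ms
    proof (rule rootable_blocks_sum)
      fix j assume "j < t"
      with c obtain eta where "group_signs m (r j) eta (eps j)" by blast
      from rootable_canon_power[OF pair_cong_zero_group[OF this]]
      show "rootable_blocks m (mset (zero_group m (a j) (r j) (eps j)))"
        by (rule rootable_blocksI) (rule refl)
    qed
  qed
  have N: "rootable_blocks m (mset (filter ?n D))"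
  proof (cases "even m")
    case True
    from neg[OF True] obtain t :: nat and lam k where c: "\<forall>j<t. lam j < 0 \<and> k j \<ge> 1"
      and ms: "mset (filter ?n D) =
        (\<Sum>j<t. {# (complex_of_real (lam j), k j, 1), (complex_of_real (lam j), k j, -1) #})"
      unfolding neg_condition_def by blast
    show ?thesis unfolding ms
      by (rule rootable_blocks_sum, rule rootable_negative_pair[OF True m]) (use c in auto)
  next
    case False
    show ?thesis
    proof (rule rootable_blocks_mset)
      fix d assume d: "d \<in> set (filter ?n D)"
      obtain l k e where e: "d = (l, k, e)" by (cases d)
      show "rootable_blocks m {#d#}" unfolding e
        by (rule rootable_single) (use d e D m False in \<open>auto simp: canon_data_def\<close>)
    qed
  qed
  have O: "rootable_blocks m (mset (filter (\<lambda>d. \<not> ?z d \<and> \<not> ?n d) D))"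
  proof (rule rootable_blocks_mset)
    fix d assume d: "d \<in> set (filter (\<lambda>d. \<not> ?z d \<and> \<not> ?n d) D)"
    obtain l k e where e: "d = (l, k, e)" by (cases d)
    show "rootable_blocks m {#d#}" unfolding e
      by (rule rootable_single) (use d e D m in \<open>auto simp: canon_data_def\<close>)
  qed
  have "mset D = (mset (filter ?z D) + mset (filter ?n D)) + mset (filter (\<lambda>d. \<not> ?z d \<and> \<not> ?n d) D)"
    by (induction D) (auto split: prod.splits)
  then have "rootable_blocks m (mset D)"
    using rootable_blocks_add[OF rootable_blocks_add[OF Z N] O] by simp
  then show ?thesis by (simp add: rootable_blocks_def)
qed

section \<open>Stability of the two conditions, and canonical forms of powers\<close>

lemma neg_condition_Nil: "neg_condition []"
  unfolding neg_condition_def by (intro exI[of _ 0]) auto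

lemma zero_condition_Nil: "zero_condition m []"
  unfolding zero_condition_def by (intro exI[of _ 0]) auto

lemma neg_condition_skip:
  assumes "neg_condition D" "\<And>l k e. (l, k, e) \<in> set E \<Longrightarrow> \<not> (Im l = 0 \<and> Re l < 0)"
  shows "neg_condition (E @ D)"
proof -
  have "filter (\<lambda>(l, _, _). Im l = 0 \<and> Re l < 0) E = []" using assms(2) by (auto simp: filter_empty_conv)
  then show ?thesis using assms(1) unfolding neg_condition_def filter_append by simp
qed

lemma zero_condition_skip:
  assumes "zero_condition m D" "\<And>l k e. (l, k, e) \<in> set E \<Longrightarrow> l \<noteq> 0"
  shows "zero_condition m (E @ D)"
proof -
  have "filter (\<lambda>(l, _, _). l = 0) E = []" using assms(2) by (auto simp: filter_empty_conv)
  then show ?thesis using assms(1) unfolding zero_condition_def filter_append by simp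
qed

lemma neg_condition_pair:
  assumes "neg_condition D" "x < 0" "k0 > 0"
  shows "neg_condition ([(complex_of_real x, k0, 1), (complex_of_real x, k0, -1)] @ D)"
proof -
  from assms(1) obtain t :: nat and lam k where c: "\<forall>j<t. lam j < 0 \<and> k j \<ge> 1"
    and ms: "mset (filter (\<lambda>(l, _, _). Im l = 0 \<and> Re l < 0) D) =
      (\<Sum>j<t. {# (complex_of_real (lam j), k j, 1), (complex_of_real (lam j), k j, -1) #})"
    unfolding neg_condition_def by blast
  \<comment> \<open>The new pair receives index t; updating the families there leaves the sum below
    t unchanged.\<close>
  have s: "(\<Sum>j<t. {# (complex_of_real ((lam(t := x)) j), (k(t := k0)) j, 1), (complex_of_real ((lam(t := x)) j), (k(t := k0)) j, -1 :: int) #})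
      = (\<Sum>j<t. {# (complex_of_real (lam j), k j, 1), (complex_of_real (lam j), k j, -1) #})"
    by (intro sum.cong) auto
  let ?E = "[(complex_of_real x, k0, 1), (complex_of_real x, k0, -1 :: int)]"
  have "mset (filter (\<lambda>(l, _, _). Im l = 0 \<and> Re l < 0) (?E @ D)) =
      mset ?E + mset (filter (\<lambda>(l, _, _). Im l = 0 \<and> Re l < 0) D)"
    using assms(2) by simp
  then have ms': "mset (filter (\<lambda>(l, _, _). Im l = 0 \<and> Re l < 0) (?E @ D)) =
      (\<Sum>j<Suc t. {# (complex_of_real ((lam(t := x)) j), (k(t := k0)) j, 1),
        (complex_of_real ((lam(t := x)) j), (k(t := k0)) j, -1) #})"
    unfolding sum.lessThan_Suc s ms by simp
  have c': "(lam(t := x)) j < 0 \<and> (k(t := k0)) j \<ge> 1" if "j < Suc t" for j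
    using c assms(2,3) that by (cases "j = t") auto
  show ?thesis unfolding neg_condition_def
    by (rule exI[of _ "Suc t"], rule exI[of _ "lam(t := x)"], rule exI[of _ "k(t := k0)"], rule conjI,
        intro allI impI, erule c', rule ms')
qed

lemma zero_condition_group:
  assumes "zero_condition m D" "group_signs m r0 e eps0"
  shows "zero_condition m (zero_group m a0 r0 eps0 @ D)"
proof -
  from assms(1)[unfolded zero_condition_iff] obtain t :: nat and a r eps
    where c: "\<forall>j<t. \<exists>eta. group_signs m (r j) eta (eps j)"
      and ms: "mset (filter (\<lambda>(l, _, _). l = 0) D) = (\<Sum>j<t. mset (zero_group m (a j) (r j) (eps j)))"
    by blast
  let ?a = "a(t := a0)" and ?r = "r(t := r0)" and ?eps = "eps(t := eps0)"
  have s: "(\<Sum>j<t. mset (zero_group m (?a j) (?r j) (?eps j))) =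
      (\<Sum>j<t. mset (zero_group m (a j) (r j) (eps j)))" by (intro sum.cong) auto
  have "filter (\<lambda>(l, _, _). l = 0) (zero_group m a0 r0 eps0) = zero_group m a0 r0 eps0"
    by (rule filter_True) (auto simp: zero_group_def)
  then have "mset (filter (\<lambda>(l, _, _). l = 0) (zero_group m a0 r0 eps0 @ D)) =
      (\<Sum>j<Suc t. mset (zero_group m (?a j) (?r j) (?eps j)))"
    unfolding sum.lessThan_Suc s filter_append mset_append ms by simp
  moreover have "\<forall>j<Suc t. \<exists>eta. group_signs m (?r j) eta (?eps j)"
    using c assms(2) by (auto simp: less_Suc_eq)
  ultimately show ?thesis unfolding zero_condition_iff by blast
qed

text \<open>The partial sums of e, -e, e, ... alternate between e and 0.\<close>

lemma sign_balanced_alternating: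
  assumes "e = 1 \<or> e = (-1 :: int)"
  shows "sign_balanced e (map (\<lambda>i. e * (-1) ^ i) [0..<n])"
proof -
  have "int (count_list (map (\<lambda>i. e * (-1) ^ i) [0..<n]) e) -
      int (count_list (map (\<lambda>i. e * (-1) ^ i) [0..<n]) (-e)) = (if even n then 0 else 1)"
    using assms by (induction n) auto
  then show ?thesis by (simp add: sign_balanced_def)
qed

text \<open>The last two clauses are phrased as preservation under prepending, so that the forms
  obtained for single blocks can be concatenated.\<close>

lemma block_power_canonical:
  assumes d: "canon_data [d]" and m: "m > 0"
  shows "\<exists>E. canon_data E \<and> pair_cong (canon_M [d] ^\<^sub>m m) (canon_N [d]) (canon_M E) (canon_N E) \<and>
    (\<forall>D. even m \<longrightarrow> neg_condition D \<longrightarrow> neg_condition (E @ D)) \<and>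
    (\<forall>D. zero_condition m D \<longrightarrow> zero_condition m (E @ D))"
proof -
  obtain l k e where dd: "d = (l, k, e)" by (cases d)
  have k: "k > 0" using d by (auto simp: canon_data_def dd)
  consider "l = 0" | "l \<noteq> 0" "Im l = 0" | "Im l > 0" "Im (l ^ m) = 0" | "Im l > 0" "Im (l ^ m) > 0"
    | "Im l > 0" "Im (l ^ m) < 0"
    using d by (fastforce simp: canon_data_def dd)
  then show ?thesis
  proof cases
    case 1
    then have e: "e = 1 \<or> e = -1" using d by (auto simp: canon_data_def dd)
    \<comment> \<open>Dividing k - 1 instead of k puts r into the range from 1 to m that a group
      requires.\<close>
    define a where "a = (k - 1) div m"
    define r where "r = (k - 1) mod m + 1"
    have kar: "k = a * m + r" using k unfolding a_def r_def
      by (metis Suc_eq_plus1 Suc_pred' add.assoc div_mult_mod_eq)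
    have r: "0 < r" "r \<le> m" using m by (auto simp: r_def Suc_le_eq)
    \<comment> \<open>The alternation restarts at index r, so both halves begin with e and are
      balanced for the same e.\<close>
    define eps where "eps i = (if i < r then e * (-1) ^ i else e * (-1) ^ (i - r))" for i
    have eps1: "eps i = 1 \<or> eps i = -1" for i
      using e by (cases "even i"; cases "even (i - r)") (auto simp: eps_def)
    then have eps: "\<forall>i<m. eps i = 1 \<or> eps i = -1" by blast
    have "map eps [0..<r] = map (\<lambda>i. e * (-1) ^ i) [0..<r]" by (auto simp: eps_def)
    then have b1: "sign_balanced e (map eps [0..<r])" by (simp only: sign_balanced_alternating[OF e])
    have "map eps [r..<m] = map (\<lambda>i. e * (-1) ^ i) [0..<m - r]"
      by (intro nth_equalityI) (auto simp: eps_def)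
    then have b2: "sign_balanced e (map eps [r..<m])" by (simp only: sign_balanced_alternating[OF e])
    have g: "group_signs m r e eps" using r eps e b1 b2 by (simp add: group_signs_def)
    let ?E = "zero_group m a r eps"
    have "canon_data ?E" using eps1 by (auto simp: canon_data_def zero_group_def)
    moreover have "pair_cong (canon_M [d] ^\<^sub>m m) (canon_N [d]) (canon_M ?E) (canon_N ?E)"
      using pair_cong_zero_group[OF g, of a] by (simp add: dd 1 kar[symmetric])
    moreover have "neg_condition D \<longrightarrow> neg_condition (?E @ D)" for D
      by (intro impI neg_condition_skip) (auto simp: zero_group_def)
    moreover have "zero_condition m D \<longrightarrow> zero_condition m (?E @ D)" for D
      using zero_condition_group[OF _ g] by blast
    ultimately show ?thesis by blast
  next
    case 2
    then have e: "e = 1 \<or> e = -1" using d by (auto simp: canon_data_def dd)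
    from pair_cong_power_real[OF 2(2,1) k m] obtain s where s: "s = 1 \<or> s = -1"
      "pair_cong (J k l ^\<^sub>m m) (of_int e \<cdot>\<^sub>m Qmat k)
        (canon_M [(l ^ m, k, e * s)]) (canon_N [(l ^ m, k, e * s)])" using e by blast
    have lm: "l ^ m = complex_of_real (Re l ^ m)" by (rule real_power_of_Im_zero[OF 2(2)])
    let ?E = "[(l ^ m, k, e * s)]"
    have "canon_data ?E" using k e s(1) lm by (auto simp: canon_data_def)
    moreover have "pair_cong (canon_M [d] ^\<^sub>m m) (canon_N [d]) (canon_M ?E) (canon_N ?E)"
      using s(2) 2 by (simp add: dd canon_single)
    \<comment> \<open>An even power of a real number is not negative, so no negative block
      arises.\<close>
    moreover have "even m \<longrightarrow> neg_condition D \<longrightarrow> neg_condition (?E @ D)" for D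
      using neg_condition_skip[of D ?E] zero_le_even_power[of m "Re l"] lm by auto
    moreover have "zero_condition m D \<longrightarrow> zero_condition m (?E @ D)" for D
      using zero_condition_skip[of m D ?E] 2 by auto
    ultimately show ?thesis by blast
  next
    case 3
    then have e: "e = 1" using d by (auto simp: canon_data_def dd)
    have l0: "l \<noteq> 0" using 3 by auto
    let ?E = "[(l ^ m, k, 1), (l ^ m, k, -1)]"
    have lm: "l ^ m = complex_of_real (Re (l ^ m))" using 3 by (simp add: complex_eq_iff)
    have "canon_data ?E" using k 3 by (auto simp: canon_data_def)
    moreover have "pair_cong (canon_M [d] ^\<^sub>m m) (canon_N [d]) (canon_M ?E) (canon_N ?E)"
      using pair_cong_pair_split[OF _ k m 3(2)] 3 by (simp add: dd e)
    moreover have "neg_condition D \<longrightarrow> neg_condition (?E @ D)" for D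
    \<comment> \<open>If the real number l^m is negative, the two blocks form a pair as the negative
      condition demands.\<close>
    proof (cases "Re (l ^ m) < 0")
      case True
      then show ?thesis using neg_condition_pair[OF _ True k, of D] lm[symmetric] by simp
    next
      case False
      then show ?thesis using neg_condition_skip[of D ?E] by auto
    qed
    moreover have "zero_condition m D \<longrightarrow> zero_condition m (?E @ D)" for D
      by (intro impI zero_condition_skip) (use l0 in auto)
    ultimately show ?thesis by blast
  next
    case 4
    then have e: "e = 1" using d by (auto simp: canon_data_def dd)
    have l0: "l \<noteq> 0" using 4 by auto
    let ?E = "[(l ^ m, k, 1)]"
    have "canon_data ?E" using k 4 by (auto simp: canon_data_def)
    moreover have "pair_cong (canon_M [d] ^\<^sub>m m) (canon_N [d]) (canon_M ?E) (canon_N ?E)"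
      using pair_cong_pair_canon[OF _ k m] 4 by (simp add: dd e)
    moreover have "neg_condition D \<longrightarrow> neg_condition (?E @ D)" for D
      using neg_condition_skip[of D ?E] 4 by auto
    moreover have "zero_condition m D \<longrightarrow> zero_condition m (?E @ D)" for D
      by (intro impI zero_condition_skip) (use l0 in auto)
    ultimately show ?thesis by blast
  next
    case 5
    then have e: "e = 1" using d by (auto simp: canon_data_def dd)
    have l0: "l \<noteq> 0" using 5 by auto
    \<comment> \<open>Canonical data record the eigenvalue in the upper half plane, so the two
      members of the pair are exchanged.\<close>
    let ?E = "[(cnj (l ^ m), k, 1)]"
    have "canon_data ?E" using k 5 by (auto simp: canon_data_def simp del: complex_cnj_power)
    moreover have "pair_cong (canon_M [d] ^\<^sub>m m) (canon_N [d]) (canon_M ?E) (canon_N ?E)"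
    proof -
      have "pair_cong (canon_M [d] ^\<^sub>m m) (canon_N [d]) (canon_M [(l ^ m, k, 1)]) (canon_N [(l ^ m, k, 1)])"
        using pair_cong_pair_canon[OF _ k m] 5 by (simp add: dd e)
      moreover have "pair_cong (canon_M [(l ^ m, k, 1)]) (canon_N [(l ^ m, k, 1)]) (canon_M ?E) (canon_N ?E)"
        using pair_cong_swap_conj[of k "l ^ m" "cnj (l ^ m)"] 5 by (simp add: canon_single del: complex_cnj_power)
      ultimately show ?thesis by (rule pair_cong_trans)
    qed
    moreover have "neg_condition D \<longrightarrow> neg_condition (?E @ D)" for D
      using neg_condition_skip[of D ?E] 5 by (auto simp del: complex_cnj_power)
    moreover have "zero_condition m D \<longrightarrow> zero_condition m (?E @ D)" for D
      by (intro impI zero_condition_skip) (use l0 in auto)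
    ultimately show ?thesis by blast
  qed
qed

lemma power_canonical:
  assumes "canon_data D" "m > 0"
  shows "\<exists>E. canon_data E \<and> pair_cong (canon_M D ^\<^sub>m m) (canon_N D) (canon_M E) (canon_N E) \<and>
    (even m \<longrightarrow> neg_condition E) \<and> zero_condition m E"
  using assms(1)
proof (induction D)
  case Nil
  show ?case
    by (intro exI[of _ "[]"]) (auto simp: canon_M_Nil_power[simplified] canon_data_def neg_condition_Nil zero_condition_Nil
        intro!: pair_cong_refl[of _ 0])
next
  case (Cons d D)
  then have dD: "canon_data [d]" "canon_data D" using canon_data_Cons[of d D] by auto
  from block_power_canonical[OF dD(1) assms(2)] obtain E1 where E1: "canon_data E1"
    "pair_cong (canon_M [d] ^\<^sub>m m) (canon_N [d]) (canon_M E1) (canon_N E1)"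
    "\<And>D. even m \<Longrightarrow> neg_condition D \<Longrightarrow> neg_condition (E1 @ D)"
    "\<And>D. zero_condition m D \<Longrightarrow> zero_condition m (E1 @ D)" by blast
  from Cons.IH[OF dD(2)] obtain E2 where E2: "canon_data E2"
    "pair_cong (canon_M D ^\<^sub>m m) (canon_N D) (canon_M E2) (canon_N E2)"
    "even m \<Longrightarrow> neg_condition E2" "zero_condition m E2" by blast
  have "pair_cong (canon_M (d # D) ^\<^sub>m m) (canon_N (d # D)) (canon_M (E1 @ E2)) (canon_N (E1 @ E2))"
    using pair_cong_dsum[OF E1(2) E2(2)] unfolding canon_Cons[of d D] canon_append
    by (subst dsum_power) auto
  moreover have "canon_data (E1 @ E2)" using E1(1) E2(1) by (auto simp: canon_data_def)
  ultimately show ?case using E1(3,4) E2(3,4) by blast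
qed

theorem mainTheorem5:
  fixes m n :: nat and B H :: "complex mat"
  assumes "m \<ge> 1"
    and "B \<in> Omega n" and "H \<in> Omega n"
    and "invertible_mat H" and "hermitian_mat H"
    and "H_selfadjoint H B"
  shows "(\<exists>A. A \<in> Omega n \<and> H_selfadjoint H A \<and> A ^\<^sub>m m = B) \<longleftrightarrow>
         (\<exists>D S. is_canonical_form n B H D S \<and>
                (even m \<longrightarrow> neg_condition D) \<and> zero_condition m D)"
proof -
  have m: "m > 0" using assms(1) by simp
  note Hc = OmegaD(4)[OF assms(3)] and Bc = OmegaD(4)[OF assms(2)]
  have dH: "dim_row H = 2 * n" "dim_col H = 2 * n" by (rule OmegaD[OF assms(3)])+
  have herm: "adj H = H" using assms(5) by (simp add: hermitian_mat_def)
  obtain Hi where Hi: "Hi \<in> sq_mats (2 * n)" "Hi * H = 1\<^sub>m (2 * n)"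
  proof -
    from assms(4) obtain Hi where "H * Hi = 1\<^sub>m (2 * n)" "Hi * H = 1\<^sub>m (dim_row Hi)"
      unfolding invertible_mat_def inverts_mat_def using dH by auto
    moreover from this have "dim_col Hi = 2 * n" "dim_row Hi = 2 * n"
      using dH by (metis index_mult_mat(3) index_one_mat(3))+
    ultimately show thesis using that[of Hi] by (metis carrier_matI)
  qed
  show ?thesis
  proof
    assume "\<exists>A. A \<in> Omega n \<and> H_selfadjoint H A \<and> A ^\<^sub>m m = B"
    then obtain A where rt: "A \<in> Omega n" "H_selfadjoint H A" "A ^\<^sub>m m = B" by blast
    note Ac = OmegaD(4)[OF rt(1)]
    interpret selfadjoint_pair n A H
      by unfold_locales (use rt assms(3) herm Hi in \<open>auto simp: H_selfadjoint_def\<close>)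
    from canonical_form_exists obtain D S Si where D: "canon_data D" and S: "S \<in> Omega n"
      and Si: "Si \<in> sq_mats (2 * n)" "S * Si = 1\<^sub>m (2 * n)" "Si * S = 1\<^sub>m (2 * n)"
      and AS: "Si * A * S = dsum (canon_M D) (canon_M' D)"
      and HS: "adj S * H * S = dsum (canon_N D) (canon_N D)"
      unfolding is_canonical_form_def by blast
    have dM: "dim_row (canon_M D) = n"
      using arg_cong[OF HS, of dim_row] OmegaD[OF S] by simp
    have "Si * B * S = (Si * A * S) ^\<^sub>m m"
      unfolding rt(3)[symmetric] by (rule pow_mat_similar[OF Ac OmegaD(4)[OF S] Si])
    then have BS: "Si * B * S = dsum (canon_M D ^\<^sub>m m) (conj_mat (canon_M D ^\<^sub>m m))"
      unfolding AS canon_M'_conj by (simp add: dsum_power conj_pow_mat)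
    from power_canonical[OF D m] obtain E where E: "canon_data E"
      "pair_cong (canon_M D ^\<^sub>m m) (canon_N D) (canon_M E) (canon_N E)"
      "even m \<longrightarrow> neg_condition E" "zero_condition m E" by blast
    have HS': "adj S * H * S = dsum (canon_N D) (conj_mat (canon_N D))" using HS by simp
    have Mc: "canon_M D ^\<^sub>m m \<in> sq_mats n" using dM by (intro carrier_matI) auto
    from Omega_frame_transport[OF S Si Bc Hc Mc BS HS' E(2)] E(1)
    have "\<exists>S'. is_canonical_form n B H E S'"
      unfolding is_canonical_form_def canon_M'_conj conj_canon_N by blast
    then show "\<exists>D S. is_canonical_form n B H D S \<and> (even m \<longrightarrow> neg_condition D) \<and> zero_condition m D"
      using E(3,4) by blast
  next
    assume "\<exists>D S. is_canonical_form n B H D S \<and> (even m \<longrightarrow> neg_condition D) \<and> zero_condition m D"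
    then obtain D S Si where D: "canon_data D" and S: "S \<in> Omega n"
      and Si: "Si \<in> sq_mats (2 * n)" "S * Si = 1\<^sub>m (2 * n)" "Si * S = 1\<^sub>m (2 * n)"
      and BS: "Si * B * S = dsum (canon_M D) (canon_M' D)"
      and HS: "adj S * H * S = dsum (canon_N D) (canon_N D)"
      and cond: "even m \<longrightarrow> neg_condition D" "zero_condition m D"
      unfolding is_canonical_form_def by blast
    have dM: "dim_row (canon_M D) = n"
      using arg_cong[OF HS, of dim_row] OmegaD[OF S] by simp
    \<comment> \<open>The root is found in one copy of the canonical form, doubled by conjugation
      and carried back along \<open>S\<close>.\<close>
    from rootable_conditions[OF D m] cond obtain k Z where Z: "Z \<in> sq_mats k"
      "canon_N D \<in> sq_mats k" "Z ^\<^sub>m m = canon_M D" "canon_N D * Z = adj Z * canon_N D"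
      unfolding rootable_def by blast
    have k: "k = n" using Z(2) dM by auto
    let ?U = "dsum Z (conj_mat Z)"
    have U: "?U \<in> Omega n" using Z(1) k by (intro dsum_conj_Omega) simp
    have SiO: "Si \<in> Omega n" by (rule Omega_inverse[OF S Si])
    have d: "dim_row S = 2 * n" "dim_col S = 2 * n" "dim_row Si = 2 * n" "dim_col Si = 2 * n"
      "dim_row ?U = 2 * n" "dim_col ?U = 2 * n" "dim_row B = 2 * n" "dim_col B = 2 * n"
      "dim_row Z = n" "dim_col Z = n"
      using OmegaD[OF S] OmegaD[OF SiO] OmegaD[OF U] Bc Z(1) k by auto
    define A where "A = S * ?U * Si"
    have A: "A \<in> Omega n" unfolding A_def by (intro Omega_mult S U SiO)
    have "A ^\<^sub>m m = B"
    proof -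
      have "S * ?U ^\<^sub>m m * Si = A ^\<^sub>m m" unfolding A_def
        by (rule pow_mat_similar[OF OmegaD(4)[OF U] Si(1) OmegaD(4)[OF S] Si(3,2)])
      moreover have "?U ^\<^sub>m m = Si * B * S"
        unfolding BS canon_M'_conj using Z(3) d by (simp add: dsum_power conj_pow_mat[symmetric])
      moreover have "S * (Si * B * S) * Si = B"
        using d by (simp add: mat_ring mat_rewrite1[OF Si(2)] Si(2))
      ultimately show ?thesis by simp
    qed
    moreover have "H * A = adj A * H"
    proof -
      let ?N = "dsum (canon_N D) (canon_N D)"
      have NU: "?N * ?U = adj ?U * ?N"
      proof -
        have "canon_N D * conj_mat Z = adj (conj_mat Z) * canon_N D"
          using arg_cong[OF Z(4), of conj_mat] d dM by (simp add: conj_mat_mult conj_mat_adjoint)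
        then show ?thesis using d dM by (simp add: dsum_mult adjoint_dsum Z(4))
      qed
      have aS: "adj Si * adj S = 1\<^sub>m (2 * n)"
        using arg_cong[OF Si(2), of adj] d by (simp add: mat_adjoint_mult)
      \<comment> \<open>Expressing \<open>H\<close> through the frame reduces selfadjointness of
        \<open>A\<close> to that of \<open>?U\<close> with respect to \<open>?N\<close>.\<close>
      have H: "H = adj Si * (?N * Si)"
        unfolding HS[symmetric] using d dH
        by (simp add: mat_ring mat_rewrite1[OF aS] Si(2))
      have "H * A = adj Si * ((?N * ?U) * Si)"
        unfolding A_def by (subst H) (use d dM in \<open>simp add: mat_ring mat_rewrite1[OF Si(3)]\<close>)
      also have "\<dots> = adj A * H"
        unfolding NU A_def
        by (subst H) (use d dM in \<open>simp add: mat_ring mat_adjoint_mult mat_rewrite1[OF arg_cong[OF Si(3), of adj, unfolded mat_adjoint_mult[OF trans[OF d(4) d(1)[symmetric]]] mat_adjoint_one]]\<close>)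
      finally show ?thesis .
    qed
    ultimately show "\<exists>A. A \<in> Omega n \<and> H_selfadjoint H A \<and> A ^\<^sub>m m = B"
      using A OmegaD(4)[OF A] dH by (intro exI[of _ A]) (simp add: H_selfadjoint_def)
  qed
qed

end
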